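(* Let $\mathcal A$ be a small contextual category and $F:|\mathcal A|\to\mathrm{Set}$ a set-model of $\mathcal A$. Then $F$ is strictifiable if and only if it is loop-free (hence, if and only if any one of the following equivalent conditions holds, where $\pi^F:F_{\mathbf s}\Rightarrow F_{\mathbf t}$ is the cartesian natural transformation associated with $F$ and $\pi^F_*:\int F_{\mathbf s}\to\int F_{\mathbf t}$ is the induced functor between categories of elements: (a) $\pi^F$ is loop-free, i.e. $\overline\Phi^F$ sends every automorphism to an identity map; (b) the commutative square in $\mathrm{Cat}$ with top $\mathrm{gpd}(\int F_{\mathbf s})\to\pi_0(\mathrm{gpd}\int F_{\mathbf s})$, bottom $\mathrm{gpd}(\int F_{\mathbf t})\to\pi_0(\mathrm{gpd}\int F_{\mathbf t})$ (quotient maps onto the discrete categories of connected components) and vertical maps $\mathrm{gpd}(\pi^F_* )$ and $\pi_0(\mathrm{gpd}(\pi^F_* ))$ is cartesian; (c) the commutative square in $\mathrm{Set}^{\mathbf D(\mathcal A)}$ with top $F_{\mathbf s}\Rightarrow\Delta\,\mathrm{colim}\,F_{\mathbf s}$, bottom $F_{\mathbf t}\Rightarrow\Delta\,\mathrm{colim}\,F_{\mathbf t}$ (universal cocones) and vertical maps $\pi^F$ and $\Delta\,\mathrm{colim}\,\pi^F$ is cartesian).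
   Context: **Contextual categories.** A contextual category $\mathcal A$ consists of a category $|\mathcal A|$, a length function $\ell:\mathrm{Ob}(|\mathcal A|)\to\mathbb N$, a function $\partial$ on objects with $\ell(\partial a)=\ell(a)-1$ if $\ell(a)\ge1$ and $\ell(\partial a)=0$ if $\ell(a)=0$, for each $a$ with $\ell(a)\ge 1$ an arrow $\mathbf p_a:a\to\partial a$ (a strict display map), and a set of pullback squares, called distinguished squares, each with top arrow $f':a\to b$, bottom arrow $f:\partial a\to\partial b$, left side $\mathbf p_a$ and right side $\mathbf p_b$; it is required that there is a unique object $1_{\mathcal A}$ of length $0$, which is terminal; that for each $b$ with $\ell(b)\ge1$ and each arrow $f$ with codomain $\partial b$ there is a unique distinguished square with right side $\mathbf p_b$ and bottom $f$; and that distinguished squares are closed under horizontal composition and contain the identity squares of all $\mathbf p_a$. A strict morphism is a functor strictly preserving $\ell$, $\partial$, $\mathbf p$ and distinguished squares. $\mathbf D(\mathcal A)$ is the category whose objects are the strict display maps and whose morphisms $\mathbf p_a\to\mathbf p_b$ are the distinguished squares, composed horizontally. **Models.** A set-model of $\mathcal A$ is a functor $F:|\mathcal A|\to\mathrm{Set}$ sending distinguished squares to pullback squares and $1_{\mathcal A}$ to a terminal object. Let $\mathscr U$ be a Grothendieck universe, whose elements are the small sets, and $\mathrm{Set}$ the category of small sets. $\mathrm{Fam}$ is the contextual category whose length-$n$ objects are sequences $(X_1,\dots,X_n)$ with $X_{i+1}:\Sigma(X_1,\dots,X_i)\to\mathscr U$, where $\Sigma()=\{*\}$ and $\Sigma(X_1,\dots,X_{i+1})=\coprod_{x\in\Sigma(X_1,\dots,X_i)}X_{i+1}(x)$;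 morphisms are functions between the total sets $\Sigma(-)$; strict display maps are the projections $\Sigma(X_1,\dots,X_{n+1})\to\Sigma(X_1,\dots,X_n)$; the distinguished pullback of $(X_1,\dots,X_{n+1})$ along $f:(Y_1,\dots,Y_m)\to(X_1,\dots,X_n)$ is $(Y_1,\dots,Y_m,X_{n+1}\circ f)$ with top arrow $(y,x)\mapsto(f(y),x)$. Taking total sets gives a functor $\Sigma:|\mathrm{Fam}|\to\mathrm{Set}$. $F$ is strictifiable if there is a strict morphism $G:\mathcal A\to\mathrm{Fam}$ with $\Sigma\circ G\cong F$. **Loop freeness.** Define $F_{\mathbf s},F_{\mathbf t}:\mathbf D(\mathcal A)\to\mathrm{Set}$ by $F_{\mathbf s}(\mathbf p_a)=F(a)$, $F_{\mathbf t}(\mathbf p_a)=F(\partial a)$, and $\pi^F:F_{\mathbf s}\Rightarrow F_{\mathbf t}$ by $\pi^F_{\mathbf p_a}=F(\mathbf p_a)$; every naturality square of $\pi^F$ is a pullback. Write $\int$ for the category of elements, and $\mathrm{gpd}(C)=C[\mathrm{Ar}(C)^{-1}]$ for the groupoid obtained by localizing $C$ at all its arrows. The functor $\pi^F_*:\int F_{\mathbf s}\to\int F_{\mathbf t}$ is a discrete opfibration; its fiber functor $\Phi^F:\int F_{\mathbf t}\to\mathrm{Set}$, $(\mathbf p_a,x)\mapsto F(\mathbf p_a)^{-1}(x)$, sends every arrow to a bijection, so it extends uniquely to $\overline\Phi^F:\mathrm{gpd}(\int F_{\mathbf t})\to\mathrm{Set}$. $F$ is loop-free if $\overline\Phi^F$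 sends every automorphism to an identity map. *)

theory Defs
  imports Main "HOL-Library.FuncSet"
begin

section \<open>Grothendieck universes\<close>

text \<open>
  A Grothendieck universe in the sense of SGA 4, presented as a type: the inhabitants are the
  small sets, and \<^term>\<open>elems x\<close> is the set of elements of \<open>x\<close>, all of which are again small
  because the universe is transitive. Extensionality and foundation are inherited from the
  ambient set theory. In \<open>elems_Pow\<close> the right-hand side ranges over all HOL-subsets of
  \<^term>\<open>elems x\<close>, and in \<open>elems_UN\<close> the family \<open>f\<close> is an arbitrary HOL-function, so these are
  closure under the genuine power set and under genuine unions of small families.
  As in SGA 4, an infinite element is not required; the empty set is the minimal inhabitant.
\<close>

class grothendieck_universe =
  fixes elems :: "'a \<Rightarrow> 'a set"
  assumes elems_inject: "elems x = elems y \<Longrightarrow> x = y"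
    and elems_wf: "wf {(y, x). y \<in> elems x}"
    and elems_pair: "\<exists>z. elems z = {x, y}"
    and elems_Pow: "\<exists>z. elems ` elems z = Pow (elems x)"
    and elems_UN: "\<exists>z. elems z = (\<Union>i\<in>elems x. elems (f i))"

definition mk_set :: "'u::grothendieck_universe set \<Rightarrow> 'u" where
  "mk_set S = (THE x. elems x = S)"

text \<open>Kuratowski pairs.\<close>

definition vpair :: "'u::grothendieck_universe \<Rightarrow> 'u \<Rightarrow> 'u" where
  "vpair x y = mk_set {mk_set {x}, mk_set {x, y}}"

definition vfst :: "'u::grothendieck_universe \<Rightarrow> 'u" where
  "vfst z = (THE x. \<exists>y. z = vpair x y)"

definition vsnd :: "'u::grothendieck_universe \<Rightarrow> 'u" where
  "vsnd z = (THE y. \<exists>x. z = vpair x y)"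

definition vcoprod :: "'u::grothendieck_universe \<Rightarrow> ('u \<Rightarrow> 'u) \<Rightarrow> 'u" where
  "vcoprod A X = mk_set {vpair x y | x y. x \<in> elems A \<and> y \<in> elems (X x)}"

text \<open>A set of any type is small if it is in bijection with an element of the universe.\<close>

definition small_set :: "'u::grothendieck_universe itself \<Rightarrow> 'a set \<Rightarrow> bool" where
  "small_set _ S \<longleftrightarrow> (\<exists>(x::'u) f. bij_betw f (elems x) S)"


section \<open>Categories, functors and natural transformations\<close>

text \<open>\<open>Comp C g f\<close> is the composite \<open>g \<circ> f\<close>.\<close>

record ('o, 'm) cat =
  Ob :: "'o set"
  Ar :: "'m set"
  Dom :: "'m \<Rightarrow> 'o"
  Cod :: "'m \<Rightarrow> 'o"
  Idn :: "'o \<Rightarrow> 'm"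
  Comp :: "'m \<Rightarrow> 'm \<Rightarrow> 'm"

definition hom :: "('o, 'm, 'z) cat_scheme \<Rightarrow> 'o \<Rightarrow> 'o \<Rightarrow> 'm set" where
  "hom C a b = {f \<in> Ar C. Dom C f = a \<and> Cod C f = b}"

definition category :: "('o, 'm, 'z) cat_scheme \<Rightarrow> bool" where
  "category C \<longleftrightarrow>
     (\<forall>f\<in>Ar C. Dom C f \<in> Ob C \<and> Cod C f \<in> Ob C) \<and>
     (\<forall>a\<in>Ob C. Idn C a \<in> hom C a a) \<and>
     (\<forall>f\<in>Ar C. \<forall>g\<in>Ar C. Cod C f = Dom C g \<longrightarrow> Comp C g f \<in> hom C (Dom C f) (Cod C g)) \<and>
     (\<forall>f\<in>Ar C. Comp C f (Idn C (Dom C f)) = f \<and> Comp C (Idn C (Cod C f)) f = f) \<and>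
     (\<forall>f\<in>Ar C. \<forall>g\<in>Ar C. \<forall>h\<in>Ar C. Cod C f = Dom C g \<longrightarrow> Cod C g = Dom C h \<longrightarrow>
        Comp C h (Comp C g f) = Comp C (Comp C h g) f)"

definition iso_arrow :: "('o, 'm, 'z) cat_scheme \<Rightarrow> 'm \<Rightarrow> bool" where
  "iso_arrow C f \<longleftrightarrow> f \<in> Ar C \<and>
     (\<exists>g\<in>hom C (Cod C f) (Dom C f).
        Comp C g f = Idn C (Dom C f) \<and> Comp C f g = Idn C (Cod C f))"

definition automorphism :: "('o, 'm, 'z) cat_scheme \<Rightarrow> 'm \<Rightarrow> bool" where
  "automorphism C f \<longleftrightarrow> iso_arrow C f \<and> Dom C f = Cod C f"

definition terminal :: "('o, 'm, 'z) cat_scheme \<Rightarrow> 'o \<Rightarrow> bool" where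
  "terminal C t \<longleftrightarrow> t \<in> Ob C \<and> (\<forall>a\<in>Ob C. \<exists>!f. f \<in> hom C a t)"

text \<open>
  \<open>pullback_square C t l r b\<close>: the square with top \<open>t\<close>, left side \<open>l\<close>, right side \<open>r\<close> and
  bottom \<open>b\<close> commutes and is a pullback.
\<close>

definition pullback_square :: "('o, 'm, 'z) cat_scheme \<Rightarrow> 'm \<Rightarrow> 'm \<Rightarrow> 'm \<Rightarrow> 'm \<Rightarrow> bool" where
  "pullback_square C t l r b \<longleftrightarrow>
     t \<in> Ar C \<and> l \<in> Ar C \<and> r \<in> Ar C \<and> b \<in> Ar C \<and>
     Dom C t = Dom C l \<and> Cod C t = Dom C r \<and> Cod C l = Dom C b \<and> Cod C r = Cod C b \<and>
     Comp C r t = Comp C b l \<and>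
     (\<forall>u\<in>Ar C. \<forall>v\<in>Ar C. Dom C u = Dom C v \<and> Cod C u = Dom C r \<and> Cod C v = Dom C b \<and>
        Comp C r u = Comp C b v \<longrightarrow>
        (\<exists>!w. w \<in> hom C (Dom C u) (Dom C t) \<and> Comp C t w = u \<and> Comp C l w = v))"

record ('o, 'm, 'p, 'n) functr =
  FO :: "'o \<Rightarrow> 'p"
  FA :: "'m \<Rightarrow> 'n"

text \<open>
  Functors and natural transformations are extensional (undefined off the source category),
  so that HOL-equality is equality of functors, respectively of natural transformations.
\<close>

definition mk_functor ::
  "('o, 'm, 'z) cat_scheme \<Rightarrow> ('o \<Rightarrow> 'p) \<Rightarrow> ('m \<Rightarrow> 'n) \<Rightarrow> ('o, 'm, 'p, 'n) functr" where
  "mk_functor C fo fa = \<lparr>FO = restrict fo (Ob C), FA = restrict fa (Ar C)\<rparr>"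

definition is_functor ::
  "('o, 'm, 'z) cat_scheme \<Rightarrow> ('p, 'n, 'y) cat_scheme \<Rightarrow> ('o, 'm, 'p, 'n) functr \<Rightarrow> bool" where
  "is_functor C D F \<longleftrightarrow>
     FO F \<in> Ob C \<rightarrow>\<^sub>E Ob D \<and>
     FA F \<in> Ar C \<rightarrow>\<^sub>E Ar D \<and>
     (\<forall>f\<in>Ar C. Dom D (FA F f) = FO F (Dom C f) \<and> Cod D (FA F f) = FO F (Cod C f)) \<and>
     (\<forall>a\<in>Ob C. FA F (Idn C a) = Idn D (FO F a)) \<and>
     (\<forall>f\<in>Ar C. \<forall>g\<in>Ar C. Cod C f = Dom C g \<longrightarrow>
        FA F (Comp C g f) = Comp D (FA F g) (FA F f))"

text \<open>\<open>functor_comp C G F\<close> is the composite \<open>G \<circ> F\<close>, where \<open>C\<close> is the source of \<open>F\<close>.\<close>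

definition functor_comp ::
  "('o, 'm, 'z) cat_scheme \<Rightarrow> ('p, 'n, 'q, 'k) functr \<Rightarrow> ('o, 'm, 'p, 'n) functr
     \<Rightarrow> ('o, 'm, 'q, 'k) functr" where
  "functor_comp C G F = mk_functor C (\<lambda>a. FO G (FO F a)) (\<lambda>f. FA G (FA F f))"

definition nat_trans ::
  "('o, 'm, 'z) cat_scheme \<Rightarrow> ('p, 'n, 'y) cat_scheme \<Rightarrow> ('o, 'm, 'p, 'n) functr
     \<Rightarrow> ('o, 'm, 'p, 'n) functr \<Rightarrow> ('o \<Rightarrow> 'n) \<Rightarrow> bool" where
  "nat_trans C D F G \<eta> \<longleftrightarrow>
     \<eta> \<in> extensional (Ob C) \<and>
     (\<forall>a\<in>Ob C. \<eta> a \<in> hom D (FO F a) (FO G a)) \<and>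
     (\<forall>f\<in>Ar C. Comp D (FA G f) (\<eta> (Dom C f)) = Comp D (\<eta> (Cod C f)) (FA F f))"

definition naturally_isomorphic ::
  "('o, 'm, 'z) cat_scheme \<Rightarrow> ('p, 'n, 'y) cat_scheme \<Rightarrow> ('o, 'm, 'p, 'n) functr
     \<Rightarrow> ('o, 'm, 'p, 'n) functr \<Rightarrow> bool" where
  "naturally_isomorphic C D F G \<longleftrightarrow>
     (\<exists>\<eta>. nat_trans C D F G \<eta> \<and> (\<forall>a\<in>Ob C. iso_arrow D (\<eta> a)))"

type_synonym ('o, 'm, 'p, 'n) nt =
  "('o, 'm, 'p, 'n) functr \<times> ('o \<Rightarrow> 'n) \<times> ('o, 'm, 'p, 'n) functr"

text \<open>The functor category \<open>D\<^sup>C\<close>.\<close>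

definition functor_cat ::
  "('o, 'm, 'z) cat_scheme \<Rightarrow> ('p, 'n, 'y) cat_scheme
     \<Rightarrow> (('o, 'm, 'p, 'n) functr, ('o, 'm, 'p, 'n) nt) cat" where
  "functor_cat C D =
     \<lparr>Ob = {F. is_functor C D F},
      Ar = {(F, \<eta>, G). is_functor C D F \<and> is_functor C D G \<and> nat_trans C D F G \<eta>},
      Dom = (\<lambda>(F, \<eta>, G). F),
      Cod = (\<lambda>(F, \<eta>, G). G),
      Idn = (\<lambda>F. (F, \<lambda>a\<in>Ob C. Idn D (FO F a), F)),
      Comp = (\<lambda>(G, \<theta>, H) (F, \<eta>, G'). (F, \<lambda>a\<in>Ob C. Comp D (\<theta> a) (\<eta> a), H))\<rparr>"


section \<open>The category of small sets, colimits\<close>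

type_synonym 'u setmap = "'u \<times> ('u \<Rightarrow> 'u) \<times> 'u"

definition set_cat :: "('u::grothendieck_universe, 'u setmap) cat" where
  "set_cat =
     \<lparr>Ob = UNIV,
      Ar = {(A, f, B). f \<in> elems A \<rightarrow>\<^sub>E elems B},
      Dom = (\<lambda>(A, f, B). A),
      Cod = (\<lambda>(A, f, B). B),
      Idn = (\<lambda>A. (A, \<lambda>x\<in>elems A. x, A)),
      Comp = (\<lambda>(B, g, C) (A, f, B'). (A, compose (elems A) g f, C))\<rparr>"

definition ap :: "'u setmap \<Rightarrow> 'u \<Rightarrow> 'u" where
  "ap h = fst (snd h)"

definition const_functor ::
  "('o, 'm, 'z) cat_scheme \<Rightarrow> ('p, 'n, 'y) cat_scheme \<Rightarrow> 'p \<Rightarrow> ('o, 'm, 'p, 'n) functr" where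
  "const_functor J C c = mk_functor J (\<lambda>_. c) (\<lambda>_. Idn C c)"

definition universal_cocone ::
  "('o, 'm, 'z) cat_scheme \<Rightarrow> ('p, 'n, 'y) cat_scheme \<Rightarrow> ('o, 'm, 'p, 'n) functr
     \<Rightarrow> 'p \<Rightarrow> ('o \<Rightarrow> 'n) \<Rightarrow> bool" where
  "universal_cocone J C H L \<iota> \<longleftrightarrow>
     L \<in> Ob C \<and> nat_trans J C H (const_functor J C L) \<iota> \<and>
     (\<forall>M\<in>Ob C. \<forall>\<kappa>. nat_trans J C H (const_functor J C M) \<kappa> \<longrightarrow>
        (\<exists>!u. u \<in> hom C L M \<and> (\<forall>j\<in>Ob J. Comp C u (\<iota> j) = \<kappa> j)))"

text \<open>A choice of colimits of set-valued functors; it is meaningful whenever a colimit exists.\<close>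

definition colim_cocone ::
  "('o, 'm, 'z) cat_scheme \<Rightarrow> ('o, 'm, 'u::grothendieck_universe, 'u setmap) functr
     \<Rightarrow> 'u \<times> ('o \<Rightarrow> 'u setmap)" where
  "colim_cocone J H = (SOME (L, \<iota>). universal_cocone J set_cat H L \<iota>)"

definition colim ::
  "('o, 'm, 'z) cat_scheme \<Rightarrow> ('o, 'm, 'u::grothendieck_universe, 'u setmap) functr \<Rightarrow> 'u" where
  "colim J H = fst (colim_cocone J H)"

definition colim_inj ::
  "('o, 'm, 'z) cat_scheme \<Rightarrow> ('o, 'm, 'u::grothendieck_universe, 'u setmap) functr
     \<Rightarrow> 'o \<Rightarrow> 'u setmap" where
  "colim_inj J H = snd (colim_cocone J H)"

definition colim_map ::
  "('o, 'm, 'z) cat_scheme \<Rightarrow> ('o, 'm, 'u::grothendieck_universe, 'u setmap) functr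
     \<Rightarrow> ('o, 'm, 'u, 'u setmap) functr \<Rightarrow> ('o \<Rightarrow> 'u setmap) \<Rightarrow> 'u setmap" where
  "colim_map J S T \<pi> = (THE u. u \<in> hom set_cat (colim J S) (colim J T) \<and>
     (\<forall>j\<in>Ob J. Comp set_cat u (colim_inj J S j) = Comp set_cat (colim_inj J T j) (\<pi> j)))"


section \<open>Contextual categories\<close>

text \<open>
  The underlying category is the \<^typ>\<open>('o, 'm) cat\<close> part of the record. A distinguished square
  is encoded by the pair \<open>(f', f)\<close> of its top and bottom arrows: its left and right sides are
  the strict display maps at the domain and codomain of \<open>f'\<close>.
  The values of \<open>disp\<close> at objects of length 0 are irrelevant.
\<close>

record ('o, 'm) ctx_cat = "('o, 'm) cat" +
  len :: "'o \<Rightarrow> nat"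
  ft :: "'o \<Rightarrow> 'o"
  disp :: "'o \<Rightarrow> 'm"
  dsq :: "('m \<times> 'm) set"

definition contextual_category :: "('o, 'm) ctx_cat \<Rightarrow> bool" where
  "contextual_category A \<longleftrightarrow>
     category A \<and>
     (\<forall>a\<in>Ob A. ft A a \<in> Ob A \<and>
        (1 \<le> len A a \<longrightarrow> len A (ft A a) = len A a - 1) \<and>
        (len A a = 0 \<longrightarrow> len A (ft A a) = 0)) \<and>
     (\<forall>a\<in>Ob A. 1 \<le> len A a \<longrightarrow> disp A a \<in> hom A a (ft A a)) \<and>
     (\<forall>(f', f)\<in>dsq A.
        f' \<in> Ar A \<and> f \<in> Ar A \<and> 1 \<le> len A (Dom A f') \<and> 1 \<le> len A (Cod A f') \<and>
        pullback_square A f' (disp A (Dom A f')) (disp A (Cod A f')) f) \<and>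
     (\<exists>!e. e \<in> Ob A \<and> len A e = 0) \<and>
     (\<forall>e\<in>Ob A. len A e = 0 \<longrightarrow> terminal A e) \<and>
     (\<forall>b\<in>Ob A. \<forall>f\<in>Ar A. 1 \<le> len A b \<and> Cod A f = ft A b \<longrightarrow>
        (\<exists>!f'. (f', f) \<in> dsq A \<and> Cod A f' = b)) \<and>
     (\<forall>(f', f)\<in>dsq A. \<forall>(g', g)\<in>dsq A. Cod A f' = Dom A g' \<longrightarrow>
        (Comp A g' f', Comp A g f) \<in> dsq A) \<and>
     (\<forall>a\<in>Ob A. 1 \<le> len A a \<longrightarrow> (Idn A a, Idn A (ft A a)) \<in> dsq A)"

definition small_ctx_cat :: "'u::grothendieck_universe itself \<Rightarrow> ('o, 'm) ctx_cat \<Rightarrow> bool" where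
  "small_ctx_cat U A \<longleftrightarrow> small_set U (Ob A) \<and> small_set U (Ar A)"

definition strict_morphism ::
  "('o, 'm) ctx_cat \<Rightarrow> ('p, 'n) ctx_cat \<Rightarrow> ('o, 'm, 'p, 'n) functr \<Rightarrow> bool" where
  "strict_morphism A B G \<longleftrightarrow>
     is_functor A B G \<and>
     (\<forall>a\<in>Ob A. len B (FO G a) = len A a) \<and>
     (\<forall>a\<in>Ob A. FO G (ft A a) = ft B (FO G a)) \<and>
     (\<forall>a\<in>Ob A. 1 \<le> len A a \<longrightarrow> FA G (disp A a) = disp B (FO G a)) \<and>
     (\<forall>(f', f)\<in>dsq A. (FA G f', FA G f) \<in> dsq B)"

text \<open>The category \<open>D(A)\<close> of strict display maps and distinguished squares.\<close>

definition disp_cat :: "('o, 'm) ctx_cat \<Rightarrow> ('m, 'm \<times> 'm) cat" where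
  "disp_cat A =
     \<lparr>Ob = disp A ` {a \<in> Ob A. 1 \<le> len A a},
      Ar = dsq A,
      Dom = (\<lambda>(f', f). disp A (Dom A f')),
      Cod = (\<lambda>(f', f). disp A (Cod A f')),
      Idn = (\<lambda>p. (Idn A (Dom A p), Idn A (Cod A p))),
      Comp = (\<lambda>(g', g) (f', f). (Comp A g' f', Comp A g f))\<rparr>"


section \<open>The contextual category of families\<close>

text \<open>
  A sequence \<open>(X\<^sub>1, \<dots>, X\<^sub>n)\<close> is a list of functions on the universe; \<open>fam_total\<close> computes its total
  set from the left, starting with a one-element set. \<open>X\<^sub>i\<^sub>+\<^sub>1\<close> is extensional outside the
  total set of \<open>(X\<^sub>1, \<dots>, X\<^sub>i)\<close>, so that equality of lists is equality of sequences of functions.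
\<close>

definition fam_total :: "('u::grothendieck_universe \<Rightarrow> 'u) list \<Rightarrow> 'u" where
  "fam_total Xs = foldl vcoprod (mk_set {mk_set {}}) Xs"

inductive_set fam_ob :: "('u::grothendieck_universe \<Rightarrow> 'u) list set" where
  fam_ob_Nil: "[] \<in> fam_ob"
| fam_ob_snoc: "Xs \<in> fam_ob \<Longrightarrow> X \<in> extensional (elems (fam_total Xs)) \<Longrightarrow> Xs @ [X] \<in> fam_ob"

type_synonym 'u fam_arrow = "('u \<Rightarrow> 'u) list \<times> ('u \<Rightarrow> 'u) \<times> ('u \<Rightarrow> 'u) list"

definition fam_reindex ::
  "('u::grothendieck_universe \<Rightarrow> 'u) list \<Rightarrow> ('u \<Rightarrow> 'u) \<Rightarrow> ('u \<Rightarrow> 'u) \<Rightarrow> ('u \<Rightarrow> 'u) list" where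
  "fam_reindex Ys f X = Ys @ [compose (elems (fam_total Ys)) X f]"

definition fam_lift ::
  "('u::grothendieck_universe \<Rightarrow> 'u) list \<Rightarrow> ('u \<Rightarrow> 'u) \<Rightarrow> ('u \<Rightarrow> 'u) \<Rightarrow> 'u \<Rightarrow> 'u" where
  "fam_lift Ys f X = (\<lambda>z\<in>elems (fam_total (fam_reindex Ys f X)). vpair (f (vfst z)) (vsnd z))"

definition fam_cat :: "(('u::grothendieck_universe \<Rightarrow> 'u) list, 'u fam_arrow) ctx_cat" where
  "fam_cat =
     \<lparr>Ob = fam_ob,
      Ar = {(Ys, f, Xs). Ys \<in> fam_ob \<and> Xs \<in> fam_ob \<and>
              f \<in> elems (fam_total Ys) \<rightarrow>\<^sub>E elems (fam_total Xs)},
      Dom = (\<lambda>(Ys, f, Xs). Ys),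
      Cod = (\<lambda>(Ys, f, Xs). Xs),
      Idn = (\<lambda>Xs. (Xs, \<lambda>x\<in>elems (fam_total Xs). x, Xs)),
      Comp = (\<lambda>(Ys, g, Zs) (Xs, f, Ys'). (Xs, compose (elems (fam_total Xs)) g f, Zs)),
      len = length,
      ft = butlast,
      disp = (\<lambda>Xs. (Xs, \<lambda>z\<in>elems (fam_total Xs). vfst z, butlast Xs)),
      dsq = {((fam_reindex Ys f X, fam_lift Ys f X, Xs @ [X]), (Ys, f, Xs)) | Ys f Xs X.
               Ys \<in> fam_ob \<and> Xs @ [X] \<in> fam_ob \<and>
               f \<in> elems (fam_total Ys) \<rightarrow>\<^sub>E elems (fam_total Xs)}\<rparr>"

definition fam_total_functor ::
  "(('u::grothendieck_universe \<Rightarrow> 'u) list, 'u fam_arrow, 'u, 'u setmap) functr" where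
  "fam_total_functor =
     mk_functor fam_cat fam_total (\<lambda>(Ys, f, Xs). (fam_total Ys, f, fam_total Xs))"


section \<open>Set-models and strictifiability\<close>

definition set_model ::
  "('o, 'm) ctx_cat \<Rightarrow> ('o, 'm, 'u::grothendieck_universe, 'u setmap) functr \<Rightarrow> bool" where
  "set_model A F \<longleftrightarrow>
     is_functor A set_cat F \<and>
     (\<forall>(f', f)\<in>dsq A. pullback_square set_cat
        (FA F f') (FA F (disp A (Dom A f'))) (FA F (disp A (Cod A f'))) (FA F f)) \<and>
     (\<forall>e\<in>Ob A. len A e = 0 \<longrightarrow> terminal set_cat (FO F e))"

definition strictifiable ::
  "('o, 'm) ctx_cat \<Rightarrow> ('o, 'm, 'u::grothendieck_universe, 'u setmap) functr \<Rightarrow> bool" where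
  "strictifiable A F \<longleftrightarrow>
     (\<exists>G. strict_morphism A fam_cat G \<and>
        naturally_isomorphic A set_cat (functor_comp A fam_total_functor G) F)"

definition model_src ::
  "('o, 'm) ctx_cat \<Rightarrow> ('o, 'm, 'u::grothendieck_universe, 'u setmap) functr
     \<Rightarrow> ('m, 'm \<times> 'm, 'u, 'u setmap) functr" where
  "model_src A F = mk_functor (disp_cat A) (\<lambda>p. FO F (Dom A p)) (\<lambda>(f', f). FA F f')"

definition model_tgt ::
  "('o, 'm) ctx_cat \<Rightarrow> ('o, 'm, 'u::grothendieck_universe, 'u setmap) functr
     \<Rightarrow> ('m, 'm \<times> 'm, 'u, 'u setmap) functr" where
  "model_tgt A F = mk_functor (disp_cat A) (\<lambda>p. FO F (Cod A p)) (\<lambda>(f', f). FA F f)"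

definition model_proj ::
  "('o, 'm) ctx_cat \<Rightarrow> ('o, 'm, 'u::grothendieck_universe, 'u setmap) functr
     \<Rightarrow> 'm \<Rightarrow> 'u setmap" where
  "model_proj A F = (\<lambda>p\<in>Ob (disp_cat A). FA F p)"


section \<open>Categories of elements\<close>

text \<open>The pair \<open>(f, x)\<close> with \<open>x \<in> H(dom f)\<close> is the arrow \<open>(dom f, x) \<rightarrow> (cod f, H(f)(x))\<close>.\<close>

definition elements_cat ::
  "('o, 'm, 'z) cat_scheme \<Rightarrow> ('o, 'm, 'u::grothendieck_universe, 'u setmap) functr
     \<Rightarrow> ('o \<times> 'u, 'm \<times> 'u) cat" where
  "elements_cat C H =
     \<lparr>Ob = {(c, x). c \<in> Ob C \<and> x \<in> elems (FO H c)},
      Ar = {(f, x). f \<in> Ar C \<and> x \<in> elems (FO H (Dom C f))},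
      Dom = (\<lambda>(f, x). (Dom C f, x)),
      Cod = (\<lambda>(f, x). (Cod C f, ap (FA H f) x)),
      Idn = (\<lambda>(c, x). (Idn C c, x)),
      Comp = (\<lambda>(g, y) (f, x). (Comp C g f, x))\<rparr>"

definition elements_map ::
  "('o, 'm, 'z) cat_scheme \<Rightarrow> ('o, 'm, 'u::grothendieck_universe, 'u setmap) functr
     \<Rightarrow> ('o \<Rightarrow> 'u setmap) \<Rightarrow> ('o \<times> 'u, 'm \<times> 'u, 'o \<times> 'u, 'm \<times> 'u) functr" where
  "elements_map C S \<pi> = mk_functor (elements_cat C S)
     (\<lambda>(c, x). (c, ap (\<pi> c) x))
     (\<lambda>(f, x). (f, ap (\<pi> (Dom C f)) x))"

text \<open>
  The fiber functor \<open>\<integral>T \<rightarrow> Set\<close> of \<open>\<pi>\<^sub>* : \<integral>S \<rightarrow> \<integral>T\<close>. The fiber over \<open>(c, x)\<close> is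
  identified with the subset \<open>\<pi>\<^sub>c\<^sup>-\<^sup>1(x)\<close> of \<open>S(c)\<close>.
\<close>

definition fiber ::
  "('o, 'm, 'u::grothendieck_universe, 'u setmap) functr \<Rightarrow> ('o \<Rightarrow> 'u setmap) \<Rightarrow> 'o \<times> 'u \<Rightarrow> 'u" where
  "fiber S \<pi> = (\<lambda>(c, x). mk_set {y \<in> elems (FO S c). ap (\<pi> c) y = x})"

definition fiber_functor ::
  "('o, 'm, 'z) cat_scheme \<Rightarrow> ('o, 'm, 'u::grothendieck_universe, 'u setmap) functr
     \<Rightarrow> ('o, 'm, 'u, 'u setmap) functr \<Rightarrow> ('o \<Rightarrow> 'u setmap)
     \<Rightarrow> ('o \<times> 'u, 'm \<times> 'u, 'u, 'u setmap) functr" where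
  "fiber_functor C S T \<pi> = mk_functor (elements_cat C T)
     (fiber S \<pi>)
     (\<lambda>e. (fiber S \<pi> (Dom (elements_cat C T) e),
           \<lambda>y\<in>elems (fiber S \<pi> (Dom (elements_cat C T) e)). ap (FA S (fst e)) y,
           fiber S \<pi> (Cod (elements_cat C T) e)))"


section \<open>Groupoid completion\<close>

text \<open>
  The localization of \<open>C\<close> at all its arrows is constructed from zigzags: words, read in the order
  of traversal, in the letters \<open>Inl f\<close> (the arrow \<open>f\<close> itself) and \<open>Inr f\<close> (a formal inverse
  of \<open>f\<close>).
\<close>

fun letter_src :: "('o, 'm, 'z) cat_scheme \<Rightarrow> 'm + 'm \<Rightarrow> 'o" where
  "letter_src C (Inl f) = Dom C f"
| "letter_src C (Inr f) = Cod C f"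

fun letter_tgt :: "('o, 'm, 'z) cat_scheme \<Rightarrow> 'm + 'm \<Rightarrow> 'o" where
  "letter_tgt C (Inl f) = Cod C f"
| "letter_tgt C (Inr f) = Dom C f"

fun zigzag :: "('o, 'm, 'z) cat_scheme \<Rightarrow> 'o \<Rightarrow> ('m + 'm) list \<Rightarrow> 'o \<Rightarrow> bool" where
  "zigzag C a [] b \<longleftrightarrow> a \<in> Ob C \<and> a = b"
| "zigzag C a (l # w) b \<longleftrightarrow>
     l \<in> Ar C <+> Ar C \<and> letter_src C l = a \<and> zigzag C (letter_tgt C l) w b"

inductive zz_reduces :: "('o, 'm, 'z) cat_scheme \<Rightarrow> ('m + 'm) list \<Rightarrow> ('m + 'm) list \<Rightarrow> bool"
  for C where
  zz_id: "a \<in> Ob C \<Longrightarrow> zz_reduces C [Inl (Idn C a)] []"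
| zz_comp: "f \<in> Ar C \<Longrightarrow> g \<in> Ar C \<Longrightarrow> Cod C f = Dom C g \<Longrightarrow>
    zz_reduces C [Inl f, Inl g] [Inl (Comp C g f)]"
| zz_cancel_right: "f \<in> Ar C \<Longrightarrow> zz_reduces C [Inl f, Inr f] []"
| zz_cancel_left: "f \<in> Ar C \<Longrightarrow> zz_reduces C [Inr f, Inl f] []"

definition zz_step ::
  "('o, 'm, 'z) cat_scheme \<Rightarrow> 'o \<Rightarrow> 'o \<Rightarrow> (('m + 'm) list \<times> ('m + 'm) list) set" where
  "zz_step C a b = {(u @ x @ v, u @ y @ v) | u x y v.
     zz_reduces C x y \<and> zigzag C a (u @ x @ v) b \<and> zigzag C a (u @ y @ v) b}"

definition zz_class :: "('o, 'm, 'z) cat_scheme \<Rightarrow> 'o \<Rightarrow> ('m + 'm) list \<Rightarrow> 'o \<Rightarrow> ('m + 'm) list set"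
  where "zz_class C a w b = (zz_step C a b \<union> (zz_step C a b)\<inverse>)\<^sup>* `` {w}"

type_synonym ('o, 'm) gpd_arrow = "'o \<times> ('m + 'm) list set \<times> 'o"

text \<open>
  In \<open>Comp\<close>, and in \<open>gpd_map\<close> below, all classes in the union coincide.
\<close>

definition gpd :: "('o, 'm, 'z) cat_scheme \<Rightarrow> ('o, ('o, 'm) gpd_arrow) cat" where
  "gpd C =
     \<lparr>Ob = Ob C,
      Ar = {(a, zz_class C a w b, b) | a w b. zigzag C a w b},
      Dom = (\<lambda>(a, W, b). a),
      Cod = (\<lambda>(a, W, b). b),
      Idn = (\<lambda>a. (a, zz_class C a [] a, a)),
      Comp = (\<lambda>(b, V, c) (a, W, b'). (a, \<Union>w\<in>W. \<Union>v\<in>V. zz_class C a (w @ v) c, c))\<rparr>"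

definition gpd_unit ::
  "('o, 'm, 'z) cat_scheme \<Rightarrow> ('o, 'm, 'o, ('o, 'm) gpd_arrow) functr" where
  "gpd_unit C = mk_functor C (\<lambda>a. a)
     (\<lambda>f. (Dom C f, zz_class C (Dom C f) [Inl f] (Cod C f), Cod C f))"

definition gpd_map ::
  "('o, 'm, 'z) cat_scheme \<Rightarrow> ('p, 'n, 'y) cat_scheme \<Rightarrow> ('o, 'm, 'p, 'n) functr
     \<Rightarrow> ('o, ('o, 'm) gpd_arrow, 'p, ('p, 'n) gpd_arrow) functr" where
  "gpd_map C D H = mk_functor (gpd C) (FO H)
     (\<lambda>(a, W, b). (FO H a,
        \<Union>w\<in>W. zz_class D (FO H a) (map (map_sum (FA H) (FA H)) w) (FO H b),
        FO H b))"

text \<open>The unique extension along \<^const>\<open>gpd_unit\<close> of a functor that inverts all arrows.\<close>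

definition gpd_extension ::
  "('o, 'm, 'z) cat_scheme \<Rightarrow> ('p, 'n, 'y) cat_scheme \<Rightarrow> ('o, 'm, 'p, 'n) functr
     \<Rightarrow> ('o, ('o, 'm) gpd_arrow, 'p, 'n) functr" where
  "gpd_extension C D \<Phi> =
     (THE \<Psi>. is_functor (gpd C) D \<Psi> \<and> functor_comp C \<Psi> (gpd_unit C) = \<Phi>)"


section \<open>Loop-freeness\<close>

text \<open>
  Intended for a cartesian natural transformation \<open>\<pi> : S \<Rightarrow> T\<close> of functors \<open>C \<rightarrow> Set\<close>; cartesianness
  makes the fiber functor invert all arrows, so that its extension exists. It is not repeated
  as a conjunct because it holds for the transformation of any set-model.
\<close>

definition nt_loop_free ::
  "('o, 'm, 'z) cat_scheme \<Rightarrow> ('o, 'm, 'u::grothendieck_universe, 'u setmap) functr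
     \<Rightarrow> ('o, 'm, 'u, 'u setmap) functr \<Rightarrow> ('o \<Rightarrow> 'u setmap) \<Rightarrow> bool" where
  "nt_loop_free C S T \<pi> \<longleftrightarrow>
     (\<forall>u. automorphism (gpd (elements_cat C T)) u \<longrightarrow>
        (let \<Psi> = gpd_extension (elements_cat C T) set_cat (fiber_functor C S T \<pi>)
         in FA \<Psi> u = Idn set_cat (FO \<Psi> (Dom (gpd (elements_cat C T)) u))))"

definition loop_free ::
  "('o, 'm) ctx_cat \<Rightarrow> ('o, 'm, 'u::grothendieck_universe, 'u setmap) functr \<Rightarrow> bool" where
  "loop_free A F \<longleftrightarrow> nt_loop_free (disp_cat A) (model_src A F) (model_tgt A F) (model_proj A F)"


section \<open>Connected components and cartesian squares in Cat\<close>

definition component :: "('o, 'm, 'z) cat_scheme \<Rightarrow> 'o \<Rightarrow> 'o set" where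
  "component C a = ({(Dom C f, Cod C f) | f. f \<in> Ar C} \<union> {(Cod C f, Dom C f) | f. f \<in> Ar C})\<^sup>* `` {a}"

definition discrete_cat :: "'a set \<Rightarrow> ('a, 'a) cat" where
  "discrete_cat X =
     \<lparr>Ob = X, Ar = X, Dom = (\<lambda>x. x), Cod = (\<lambda>x. x), Idn = (\<lambda>x. x), Comp = (\<lambda>y x. x)\<rparr>"

definition pi0 :: "('o, 'm, 'z) cat_scheme \<Rightarrow> ('o set, 'o set) cat" where
  "pi0 C = discrete_cat (component C ` Ob C)"

definition pi0_quot :: "('o, 'm, 'z) cat_scheme \<Rightarrow> ('o, 'm, 'o set, 'o set) functr" where
  "pi0_quot C = mk_functor C (component C) (\<lambda>f. component C (Dom C f))"

text \<open>The union is over the components of the images of the objects of \<open>K\<close>, which all coincide.\<close>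

definition pi0_map ::
  "('o, 'm, 'z) cat_scheme \<Rightarrow> ('p, 'n, 'y) cat_scheme \<Rightarrow> ('o, 'm, 'p, 'n) functr
     \<Rightarrow> ('o set, 'o set, 'p set, 'p set) functr" where
  "pi0_map C D H = mk_functor (pi0 C)
     (\<lambda>K. \<Union>a\<in>K. component D (FO H a)) (\<lambda>K. \<Union>a\<in>K. component D (FO H a))"

text \<open>
  \<open>cartesian_in_Cat U P X Y Z t l r b\<close>: the square of functors with top \<open>t : P \<rightarrow> X\<close>,
  left side \<open>l : P \<rightarrow> Y\<close>, right side \<open>r : X \<rightarrow> Z\<close> and bottom \<open>b : Y \<rightarrow> Z\<close> commutes and is a
  pullback. The universal property is tested on all small categories with objects and
  arrows in the universe, i.e. on all small categories up to isomorphism.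
\<close>

definition cartesian_in_Cat ::
  "'u::grothendieck_universe itself
     \<Rightarrow> ('o1, 'm1, 'z1) cat_scheme \<Rightarrow> ('o2, 'm2, 'z2) cat_scheme
     \<Rightarrow> ('o3, 'm3, 'z3) cat_scheme \<Rightarrow> ('o4, 'm4, 'z4) cat_scheme
     \<Rightarrow> ('o1, 'm1, 'o2, 'm2) functr \<Rightarrow> ('o1, 'm1, 'o3, 'm3) functr
     \<Rightarrow> ('o2, 'm2, 'o4, 'm4) functr \<Rightarrow> ('o3, 'm3, 'o4, 'm4) functr \<Rightarrow> bool" where
  "cartesian_in_Cat U P X Y Z t l r b \<longleftrightarrow>
     category P \<and> category X \<and> category Y \<and> category Z \<and>
     is_functor P X t \<and> is_functor P Y l \<and> is_functor X Z r \<and> is_functor Y Z b \<and>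
     functor_comp P r t = functor_comp P b l \<and>
     (\<forall>(E :: ('u, 'u) cat) u v.
        category E \<and> small_set U (Ob E) \<and> small_set U (Ar E) \<and>
        is_functor E X u \<and> is_functor E Y v \<and> functor_comp E r u = functor_comp E b v \<longrightarrow>
        (\<exists>!w. is_functor E P w \<and> functor_comp E t w = u \<and> functor_comp E l w = v))"


section \<open>The two squares of a natural transformation of set-valued functors\<close>

definition pi0_square_cartesian ::
  "('o, 'm, 'z) cat_scheme \<Rightarrow> ('o, 'm, 'u::grothendieck_universe, 'u setmap) functr
     \<Rightarrow> ('o, 'm, 'u, 'u setmap) functr \<Rightarrow> ('o \<Rightarrow> 'u setmap) \<Rightarrow> bool" where
  "pi0_square_cartesian C S T \<pi> \<longleftrightarrow>
     (let GS = gpd (elements_cat C S); GT = gpd (elements_cat C T);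
          h = gpd_map (elements_cat C S) (elements_cat C T) (elements_map C S \<pi>)
      in cartesian_in_Cat TYPE('u) GS (pi0 GS) GT (pi0 GT)
           (pi0_quot GS) h (pi0_map GS GT h) (pi0_quot GT))"

definition colim_square_cartesian ::
  "('o, 'm, 'z) cat_scheme \<Rightarrow> ('o, 'm, 'u::grothendieck_universe, 'u setmap) functr
     \<Rightarrow> ('o, 'm, 'u, 'u setmap) functr \<Rightarrow> ('o \<Rightarrow> 'u setmap) \<Rightarrow> bool" where
  "colim_square_cartesian C S T \<pi> \<longleftrightarrow>
     (let \<Delta>S = const_functor C set_cat (colim C S); \<Delta>T = const_functor C set_cat (colim C T)
      in pullback_square (functor_cat C set_cat)
           (S, colim_inj C S, \<Delta>S)
           (S, \<pi>, T)
           (\<Delta>S, \<lambda>_\<in>Ob C. colim_map C S T \<pi>, \<Delta>T)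
           (T, colim_inj C T, \<Delta>T))"

end

theory Submission
  imports Defs
begin

text \<open>
  Why the theorem holds. Let \<open>\<pi> : S \<Rightarrow> T\<close> be the cartesian transformation of the model. Each of the
  conditions in the statement is shown to be equivalent to one condition, called \<open>separated\<close> below:
  two points of a fiber of \<open>\<pi>\<close> are equal as soon as they lie in the same connected component of the
  category of elements of \<open>S\<close>.
  
  The tool for the three conditions on \<open>\<pi>\<close> is covering theory for zigzags. As \<open>\<pi>\<close> is cartesian, a
  zigzag in the elements of \<open>T\<close> has exactly one lift through each point over its source, and
  equivalent zigzags have equivalent lifts (\<open>lift_zigzag\<close>, \<open>lift_unique\<close>, \<open>lift_rel\<close>). The endpoint of
  the lift is the action of the zigzag on the fiber, and this action is the extension of the fiber
  functor to the groupoid completion (\<open>gpd_extension_eq\<close>). A loop acts trivially exactly if its lifts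
  are closed, which gives loop-freeness. For the squares over the components and over the colimits,
  path lifting yields existence of the required point in the corner of the pullback, and uniqueness
  is separation (\<open>cartesian_pi0I\<close>, \<open>separated_ex1\<close>). Conversely, uniqueness in the universal property,
  tested on a one-object category and on the functor of pairs of points that the square does not
  distinguish, gives separation. Colimits of sets enter only through two facts: two elements become
  equal in the colimit exactly if they are connected, and every element of the colimit comes from
  the diagram.
  
  It remains to compare separation with strictifiability. In the contextual category of families a
  point of a context of positive length is a pair of a point of the base and a label, and distinguished
  squares preserve the label; so a strictifiable model is separated (\<open>strictifiable_separated\<close>). In the
  other direction, label a point of a separated model by its class in the colimit of \<open>S\<close>. The set of
  labels over a point of the base is the fiber of the map of colimits over the class of that base
  point. It depends on nothing but that class, so it is unchanged, as a set, by reindexing along a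
  distinguished square, and recursion on the length of contexts turns the model into a strict
  morphism to families (\<open>strictify\<close>, \<open>realize_bij\<close>, \<open>strict_dsq\<close>).
\<close>

section \<open>Sets and pairs in the universe\<close>

lemma elems_mk_set: "S \<in> range elems \<Longrightarrow> elems (mk_set S) = S"
  unfolding mk_set_def by (metis (mono_tags, lifting) elems_inject rangeE theI)

lemma range_elems_pair: "{x, y} \<in> range elems"
  by (metis elems_pair rangeI)

lemma range_elems_singleton: "{x} \<in> range elems"
  using range_elems_pair[of x x] by simp

lemma range_elems_subset:
  assumes "S \<subseteq> elems x"
  shows "S \<in> range elems"
proof -
  obtain z where z: "elems ` elems z = Pow (elems x)" by (rule exE[OF elems_Pow])
  from assms have "S \<in> elems ` elems z" unfolding z by (rule PowI)
  then show ?thesis by (rule rev_subsetD) (rule image_mono[OF subset_UNIV])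
qed

text \<open>
  Replacement: by \<open>mk_set\<close> a family of encoded sets is turned into a family of inhabitants of the
  universe, whose union exists by assumption on the universe.
\<close>
lemma range_elems_UN:
  fixes x :: "'a::grothendieck_universe" and f :: "'a \<Rightarrow> 'a set"
  assumes "\<And>i. i \<in> elems x \<Longrightarrow> f i \<in> range elems"
  shows "(\<Union>i\<in>elems x. f i) \<in> range elems"
proof -
  obtain z where "elems z = (\<Union>i\<in>elems x. elems (mk_set (f i)))" using elems_UN[where x=x and f="\<lambda>i. mk_set (f i)"] by blast
  with assms have "elems z = (\<Union>i\<in>elems x. f i)" by (simp add: elems_mk_set)
  then show ?thesis by blast
qed

lemma range_elems_image:
  fixes x :: "'a::grothendieck_universe" and g :: "'a \<Rightarrow> 'a"
  shows "g ` elems x \<in> range elems"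
proof -
  have "(\<Union>i\<in>elems x. {g i}) \<in> range elems"
    by (rule range_elems_UN) (rule range_elems_singleton)
  then show ?thesis by (simp add: UNION_singleton_eq_range)
qed

lemma mk_set_inject:
  "S \<in> range elems \<Longrightarrow> S' \<in> range elems \<Longrightarrow> mk_set S = mk_set S' \<longleftrightarrow> S = S'"
  by (metis elems_mk_set)

lemma vpair_inject [simp]: "vpair x y = vpair x' y' \<longleftrightarrow> x = x' \<and> y = y'"
proof -
  have pp: "mk_set {x, y} = mk_set {x', y'} \<longleftrightarrow> x = x' \<and> y = y' \<or> x = y' \<and> y = x'"
    for x y x' y' :: 'a
    unfolding mk_set_inject[OF range_elems_pair range_elems_pair] by (rule doubleton_eq_iff)
  have ss: "mk_set {x} = mk_set {x'} \<longleftrightarrow> x = x'" for x x' :: 'a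
    using pp[of x x x' x'] by simp
  show ?thesis
    unfolding vpair_def using pp[of x x] pp[of _ _ x' x'] by (auto simp: pp ss)
qed

lemma vfst_vpair [simp]: "vfst (vpair x y) = x"
  unfolding vfst_def by auto

lemma vsnd_vpair [simp]: "vsnd (vpair x y) = y"
  unfolding vsnd_def by auto

lemma elems_vcoprod: "elems (vcoprod A X) = {vpair x y | x y. x \<in> elems A \<and> y \<in> elems (X x)}"
proof -
  have "(\<Union>x\<in>elems A. vpair x ` elems (X x)) \<in> range elems"
    by (rule range_elems_UN) (rule range_elems_image)
  moreover have "(\<Union>x\<in>elems A. vpair x ` elems (X x))
      = {vpair x y | x y. x \<in> elems A \<and> y \<in> elems (X x)}" by auto
  ultimately show ?thesis unfolding vcoprod_def by (simp add: elems_mk_set)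
qed


section \<open>Categories, functors and sets\<close>

lemma categoryD:
  assumes "category C"
  shows "f \<in> Ar C \<Longrightarrow> Dom C f \<in> Ob C" "f \<in> Ar C \<Longrightarrow> Cod C f \<in> Ob C"
    "a \<in> Ob C \<Longrightarrow> Idn C a \<in> Ar C" "a \<in> Ob C \<Longrightarrow> Dom C (Idn C a) = a"
    "a \<in> Ob C \<Longrightarrow> Cod C (Idn C a) = a"
    "f \<in> Ar C \<Longrightarrow> g \<in> Ar C \<Longrightarrow> Cod C f = Dom C g \<Longrightarrow> Comp C g f \<in> Ar C"
    "f \<in> Ar C \<Longrightarrow> g \<in> Ar C \<Longrightarrow> Cod C f = Dom C g \<Longrightarrow> Dom C (Comp C g f) = Dom C f"
    "f \<in> Ar C \<Longrightarrow> g \<in> Ar C \<Longrightarrow> Cod C f = Dom C g \<Longrightarrow> Cod C (Comp C g f) = Cod C g"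
    "f \<in> Ar C \<Longrightarrow> Comp C f (Idn C (Dom C f)) = f"
    "f \<in> Ar C \<Longrightarrow> Comp C (Idn C (Cod C f)) f = f"
    "f \<in> Ar C \<Longrightarrow> g \<in> Ar C \<Longrightarrow> h \<in> Ar C \<Longrightarrow> Cod C f = Dom C g \<Longrightarrow> Cod C g = Dom C h \<Longrightarrow>
       Comp C h (Comp C g f) = Comp C (Comp C h g) f"
  using assms unfolding category_def hom_def by auto

lemma functorD:
  assumes "is_functor C D F"
  shows "a \<in> Ob C \<Longrightarrow> FO F a \<in> Ob D" "f \<in> Ar C \<Longrightarrow> FA F f \<in> Ar D"
    "f \<in> Ar C \<Longrightarrow> Dom D (FA F f) = FO F (Dom C f)"
    "f \<in> Ar C \<Longrightarrow> Cod D (FA F f) = FO F (Cod C f)"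
    "a \<in> Ob C \<Longrightarrow> FA F (Idn C a) = Idn D (FO F a)"
    "f \<in> Ar C \<Longrightarrow> g \<in> Ar C \<Longrightarrow> Cod C f = Dom C g \<Longrightarrow>
        FA F (Comp C g f) = Comp D (FA F g) (FA F f)"
    "FO F \<in> extensional (Ob C)" "FA F \<in> extensional (Ar C)"
  using assms unfolding is_functor_def by (auto simp: PiE_iff)

lemma functor_eqI:
  assumes "is_functor C D F" "is_functor C D' G"
    and "\<And>a. a \<in> Ob C \<Longrightarrow> FO F a = FO G a" "\<And>f. f \<in> Ar C \<Longrightarrow> FA F f = FA G f"
  shows "F = G"
proof -
  have "FO F = FO G" using assms functorD(7) by (metis extensionalityI)
  moreover have "FA F = FA G" using assms functorD(8) by (metis extensionalityI)
  ultimately show ?thesis by simp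
qed

lemma mk_functor_simps [simp]:
  "a \<in> Ob C \<Longrightarrow> FO (mk_functor C fo fa) a = fo a"
  "f \<in> Ar C \<Longrightarrow> FA (mk_functor C fo fa) f = fa f"
  by (simp_all add: mk_functor_def)

lemma mk_functor_eqI:
  assumes "\<And>a. a \<in> Ob C \<Longrightarrow> fo a = fo' a" "\<And>f. f \<in> Ar C \<Longrightarrow> fa f = fa' f"
  shows "mk_functor C fo fa = mk_functor C fo' fa'"
  using assms unfolding mk_functor_def by (auto intro!: restrict_ext)

lemma is_functor_mk_functor:
  assumes "category C"
    and "\<And>a. a \<in> Ob C \<Longrightarrow> fo a \<in> Ob D"
    and "\<And>f. f \<in> Ar C \<Longrightarrow> fa f \<in> Ar D"
    and "\<And>f. f \<in> Ar C \<Longrightarrow> Dom D (fa f) = fo (Dom C f)"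
    and "\<And>f. f \<in> Ar C \<Longrightarrow> Cod D (fa f) = fo (Cod C f)"
    and "\<And>a. a \<in> Ob C \<Longrightarrow> fa (Idn C a) = Idn D (fo a)"
    and "\<And>f g. f \<in> Ar C \<Longrightarrow> g \<in> Ar C \<Longrightarrow> Cod C f = Dom C g \<Longrightarrow>
        fa (Comp C g f) = Comp D (fa g) (fa f)"
  shows "is_functor C D (mk_functor C fo fa)"
  using assms unfolding is_functor_def
  by (auto simp: categoryD mk_functor_def)

lemma functor_comp_simps [simp]:
  "a \<in> Ob C \<Longrightarrow> FO (functor_comp C G F) a = FO G (FO F a)"
  "f \<in> Ar C \<Longrightarrow> FA (functor_comp C G F) f = FA G (FA F f)"
  by (simp_all add: functor_comp_def)

lemma is_functor_comp:
  assumes "category C" "is_functor C D F" "is_functor D E G"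
  shows "is_functor C E (functor_comp C G F)"
  unfolding functor_comp_def
  by (rule is_functor_mk_functor) (use assms in \<open>simp_all add: functorD categoryD\<close>)

lemma functor_comp_assoc:
  assumes "category C" "is_functor C D F"
  shows "functor_comp C (functor_comp D H G) F = functor_comp C H (functor_comp C G F)"
  unfolding functor_comp_def[of C]
  by (rule mk_functor_eqI) (use assms in \<open>simp_all add: functorD\<close>)

lemma set_cat_simps [simp]:
  "Ob set_cat = UNIV" "(A, f, B) \<in> Ar set_cat \<longleftrightarrow> f \<in> elems A \<rightarrow>\<^sub>E elems B"
  "Dom set_cat (A, f, B) = A" "Cod set_cat (A, f, B) = B"
  "Idn set_cat A = (A, \<lambda>x\<in>elems A. x, A)"
  "Comp set_cat (B', g, D) (A, f, B) = (A, compose (elems A) g f, D)"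
  "ap (A, f, B) = f"
  by (simp_all add: set_cat_def ap_def)

lemma set_arrow_ap: "h \<in> Ar set_cat \<Longrightarrow> x \<in> elems (Dom set_cat h) \<Longrightarrow> ap h x \<in> elems (Cod set_cat h)"
  by (cases h) auto

lemma set_arrow_eqI:
  assumes "h \<in> Ar set_cat" "k \<in> Ar set_cat" "Dom set_cat h = Dom set_cat k"
    "Cod set_cat h = Cod set_cat k" "\<And>x. x \<in> elems (Dom set_cat h) \<Longrightarrow> ap h x = ap k x"
  shows "h = k"
proof -
  obtain A f B A' f' B' where *: "h = (A, f, B)" "k = (A', f', B')" by (metis prod_cases3)
  with assms have "f = f'" by (simp, intro PiE_ext[of f "elems A'" "\<lambda>_. elems B'" f']) auto
  with * assms show ?thesis by simp
qed

lemma ap_comp: "x \<in> elems (Dom set_cat f) \<Longrightarrow> ap (Comp set_cat g f) x = ap g (ap f x)"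
  by (cases f; cases g) (simp add: compose_def)

lemma category_set_cat: "category set_cat"
  unfolding category_def hom_def
  by (auto simp: compose_def fun_eq_iff PiE_iff extensional_def)

lemma set_functorD:
  assumes "is_functor C set_cat H" "category C"
  shows "f \<in> Ar C \<Longrightarrow> x \<in> elems (FO H (Dom C f)) \<Longrightarrow> ap (FA H f) x \<in> elems (FO H (Cod C f))"
    "a \<in> Ob C \<Longrightarrow> x \<in> elems (FO H a) \<Longrightarrow> ap (FA H (Idn C a)) x = x"
    "f \<in> Ar C \<Longrightarrow> g \<in> Ar C \<Longrightarrow> Cod C f = Dom C g \<Longrightarrow> x \<in> elems (FO H (Dom C f)) \<Longrightarrow>
       ap (FA H (Comp C g f)) x = ap (FA H g) (ap (FA H f) x)"
  using assms functorD[OF assms(1)] set_arrow_ap[of "FA H f" x] by (auto simp: ap_comp)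

lemma set_nat_transD:
  assumes "nat_trans C set_cat H K \<eta>"
  shows "a \<in> Ob C \<Longrightarrow> \<eta> a \<in> Ar set_cat" "a \<in> Ob C \<Longrightarrow> Dom set_cat (\<eta> a) = FO H a"
    "a \<in> Ob C \<Longrightarrow> Cod set_cat (\<eta> a) = FO K a"
    "a \<in> Ob C \<Longrightarrow> x \<in> elems (FO H a) \<Longrightarrow> ap (\<eta> a) x \<in> elems (FO K a)"
    "category C \<Longrightarrow> is_functor C set_cat H \<Longrightarrow> f \<in> Ar C \<Longrightarrow> x \<in> elems (FO H (Dom C f)) \<Longrightarrow>
       ap (\<eta> (Cod C f)) (ap (FA H f) x) = ap (FA K f) (ap (\<eta> (Dom C f)) x)"
    "\<eta> \<in> extensional (Ob C)"
proof -
  have *: "a \<in> Ob C \<Longrightarrow> \<eta> a \<in> hom set_cat (FO H a) (FO K a)" for a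
    using assms unfolding nat_trans_def by blast
  show "a \<in> Ob C \<Longrightarrow> \<eta> a \<in> Ar set_cat" "a \<in> Ob C \<Longrightarrow> Dom set_cat (\<eta> a) = FO H a"
    "a \<in> Ob C \<Longrightarrow> Cod set_cat (\<eta> a) = FO K a" "\<eta> \<in> extensional (Ob C)"
    using * assms unfolding hom_def nat_trans_def by auto
  show "a \<in> Ob C \<Longrightarrow> x \<in> elems (FO H a) \<Longrightarrow> ap (\<eta> a) x \<in> elems (FO K a)"
    using * set_arrow_ap unfolding hom_def by fastforce
  assume "category C" "is_functor C set_cat H" "f \<in> Ar C" "x \<in> elems (FO H (Dom C f))"
  note a = this
  have eq: "Comp set_cat (FA K f) (\<eta> (Dom C f)) = Comp set_cat (\<eta> (Cod C f)) (FA H f)"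
    using assms a unfolding nat_trans_def by blast
  have "ap (Comp set_cat (FA K f) (\<eta> (Dom C f))) x = ap (FA K f) (ap (\<eta> (Dom C f)) x)"
    by (rule ap_comp) (use a *[of "Dom C f"] in \<open>simp add: hom_def categoryD\<close>)
  moreover have "ap (Comp set_cat (\<eta> (Cod C f)) (FA H f)) x = ap (\<eta> (Cod C f)) (ap (FA H f) x)"
    by (rule ap_comp) (use a in \<open>simp add: functorD\<close>)
  ultimately show "ap (\<eta> (Cod C f)) (ap (FA H f) x) = ap (FA K f) (ap (\<eta> (Dom C f)) x)"
    using eq by simp
qed

lemma set_nat_transI:
  assumes "category C" "is_functor C set_cat H" "is_functor C set_cat K"
    and "\<eta> \<in> extensional (Ob C)"
    and "\<And>a. a \<in> Ob C \<Longrightarrow> \<eta> a \<in> hom set_cat (FO H a) (FO K a)"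
    and "\<And>f x. f \<in> Ar C \<Longrightarrow> x \<in> elems (FO H (Dom C f)) \<Longrightarrow>
      ap (FA K f) (ap (\<eta> (Dom C f)) x) = ap (\<eta> (Cod C f)) (ap (FA H f) x)"
  shows "nat_trans C set_cat H K \<eta>"
  unfolding nat_trans_def
proof (intro conjI ballI)
  fix f assume f: "f \<in> Ar C"
  note * = assms(5)[unfolded hom_def, simplified]
  have "\<eta> (Dom C f) \<in> Ar set_cat" "\<eta> (Cod C f) \<in> Ar set_cat"
    using * f assms(1) by (auto simp: categoryD)
  with f assms(1-3) * show "Comp set_cat (FA K f) (\<eta> (Dom C f)) = Comp set_cat (\<eta> (Cod C f)) (FA H f)"
    by (intro set_arrow_eqI)
      (simp_all add: categoryD[OF category_set_cat] categoryD[OF assms(1)] functorD ap_comp assms(6))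
qed (use assms in auto)

text \<open>The universal property of a pullback of sets, tested on a one-element set, is the
  elementwise description of the pullback.\<close>

lemma set_pullbackD:
  assumes "pullback_square set_cat t l r b"
    and "u \<in> elems (Dom set_cat r)" "v \<in> elems (Dom set_cat b)" "ap r u = ap b v"
  shows "\<exists>!w. w \<in> elems (Dom set_cat t) \<and> ap t w = u \<and> ap l w = v"
proof -
  obtain p :: 'a where p: "elems p = {undefined}" using elems_pair[of undefined undefined] by auto
  define pt where "pt B x = (p, \<lambda>_\<in>elems p. x, B)" for B x :: 'a
  have pt: "pt B x \<in> Ar set_cat \<longleftrightarrow> x \<in> elems B" "Dom set_cat (pt B x) = p"
    "Cod set_cat (pt B x) = B" "ap (pt B x) undefined = x" for B x
    by (auto simp: pt_def p)
  have comp_pt: "Comp set_cat h (pt B x) = pt (Cod set_cat h) (ap h x)" for h B x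
    by (cases h) (auto simp: pt_def p compose_def)
  have pt_inj: "pt B x = pt B y \<longleftrightarrow> x = y" for B x y
    by (metis pt(4))
  have pt_ex: "\<exists>x\<in>elems B. h = pt B x" if "h \<in> hom set_cat p B" for h B
  proof
    show "ap h undefined \<in> elems B"
      using that set_arrow_ap[of h undefined] p by (auto simp: hom_def)
    then show "h = pt B (ap h undefined)"
      using that p by (intro set_arrow_eqI) (auto simp: hom_def pt pt_def)
  qed
  have sq: "Cod set_cat r = Cod set_cat b" "Cod set_cat t = Dom set_cat r"
    "Cod set_cat l = Dom set_cat b"
    using assms(1) unfolding pullback_square_def by auto
  have univ: "\<And>u v. u \<in> Ar set_cat \<Longrightarrow> v \<in> Ar set_cat \<Longrightarrow> Dom set_cat u = Dom set_cat v \<Longrightarrow>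
      Cod set_cat u = Dom set_cat r \<Longrightarrow> Cod set_cat v = Dom set_cat b \<Longrightarrow>
      Comp set_cat r u = Comp set_cat b v \<Longrightarrow>
      \<exists>!w. w \<in> hom set_cat (Dom set_cat u) (Dom set_cat t) \<and> Comp set_cat t w = u
        \<and> Comp set_cat l w = v"
    using assms(1) unfolding pullback_square_def by blast
  have "\<exists>!w. w \<in> hom set_cat (Dom set_cat (pt (Dom set_cat r) u)) (Dom set_cat t)
      \<and> Comp set_cat t w = pt (Dom set_cat r) u \<and> Comp set_cat l w = pt (Dom set_cat b) v"
    by (rule univ) (use assms(2-4) sq in \<open>simp_all add: pt comp_pt\<close>)
  then have "\<exists>!w. w \<in> hom set_cat p (Dom set_cat t)
      \<and> Comp set_cat t w = pt (Dom set_cat r) u \<and> Comp set_cat l w = pt (Dom set_cat b) v"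
    by (simp only: pt)
  then obtain w where w: "w \<in> hom set_cat p (Dom set_cat t)"
      "Comp set_cat t w = pt (Dom set_cat r) u" "Comp set_cat l w = pt (Dom set_cat b) v"
    and uniq: "\<And>w'. w' \<in> hom set_cat p (Dom set_cat t) \<Longrightarrow>
      Comp set_cat t w' = pt (Dom set_cat r) u \<Longrightarrow> Comp set_cat l w' = pt (Dom set_cat b) v
      \<Longrightarrow> w' = w" by metis
  from pt_ex[OF w(1)] obtain x where x: "x \<in> elems (Dom set_cat t)" "w = pt (Dom set_cat t) x" by blast
  show ?thesis
  proof (intro ex1I conjI; (elim conjE)?)
    show "x \<in> elems (Dom set_cat t)" by fact
    show "ap t x = u" "ap l x = v" using w x by (simp_all add: comp_pt pt_inj sq)
    fix y assume "y \<in> elems (Dom set_cat t)" "ap t y = u" "ap l y = v"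
    then show "y = x" using uniq[of "pt (Dom set_cat t) y"] x
      by (simp add: comp_pt pt_inj sq hom_def pt)
  qed
qed


section \<open>Zigzags and the groupoid completion\<close>

lemma Plus_iff [simp]: "Inl f \<in> A <+> B \<longleftrightarrow> f \<in> A" "Inr g \<in> A <+> B \<longleftrightarrow> g \<in> B"
  by auto

lemma zigzag_ends:
  assumes "category C" "zigzag C a w b"
  shows "a \<in> Ob C" "b \<in> Ob C"
proof -
  have "a \<in> Ob C \<and> b \<in> Ob C"
    using assms(2)
  proof (induction w arbitrary: a)
    case (Cons l w)
    then show ?case using assms(1) by (cases l) (auto simp: categoryD)
  qed simp
  then show "a \<in> Ob C" "b \<in> Ob C" by auto
qed

lemma zigzag_append:
  assumes "category C"
  shows "zigzag C a (u @ v) b \<longleftrightarrow> (\<exists>c. zigzag C a u c \<and> zigzag C c v b)"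
proof (induction u arbitrary: a)
  case Nil
  then show ?case using zigzag_ends[OF assms] by auto
qed auto

lemma zigzag_appendI:
  "category C \<Longrightarrow> zigzag C a u c \<Longrightarrow> zigzag C c v b \<Longrightarrow> zigzag C a (u @ v) b"
  using zigzag_append[of C a u v b] by blast

definition zz_rel :: "('o, 'm, 'z) cat_scheme \<Rightarrow> 'o \<Rightarrow> 'o \<Rightarrow> (('m + 'm) list \<times> ('m + 'm) list) set"
  where "zz_rel C a b = (zz_step C a b \<union> (zz_step C a b)\<inverse>)\<^sup>*"

lemma zz_rel_refl [simp]: "(w, w) \<in> zz_rel C a b"
  by (simp add: zz_rel_def)

lemma zz_rel_sym: "(w, w') \<in> zz_rel C a b \<Longrightarrow> (w', w) \<in> zz_rel C a b"
  unfolding zz_rel_def by (rule symD[OF sym_rtrancl[OF sym_Un_converse]])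

lemma zz_rel_trans:
  "(w, w') \<in> zz_rel C a b \<Longrightarrow> (w', w'') \<in> zz_rel C a b \<Longrightarrow> (w, w'') \<in> zz_rel C a b"
  unfolding zz_rel_def by (rule rtrancl_trans)

lemma zz_rel_step: "(w, w') \<in> zz_step C a b \<Longrightarrow> (w, w') \<in> zz_rel C a b"
  unfolding zz_rel_def by blast

lemma zz_rel_invariant:
  assumes "(w, w') \<in> zz_rel C a b"
    and "\<And>u v. (u, v) \<in> zz_step C a b \<Longrightarrow> Q u = Q v"
  shows "Q w = Q w'"
  using assms(1) unfolding zz_rel_def
proof (induction rule: rtrancl_induct)
  case (step y z)
  then show ?case using assms(2) by (metis UnE converseD)
qed simp

text \<open>
  The relation between the words reached so far and \<open>w\<close> is kept in the assumption: for lifted words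
  the endpoint has to be fixed in advance, and only words equivalent to \<open>w\<close> are known to lift to
  that endpoint.
\<close>
lemma zz_rel_map:
  assumes "(w, w') \<in> zz_rel C a b"
    and "\<And>u v. (w, u) \<in> zz_rel C a b \<Longrightarrow> (u, v) \<in> zz_step C a b \<Longrightarrow> (f u, f v) \<in> zz_rel D c d"
  shows "(f w, f w') \<in> zz_rel D c d"
  using assms(1)[unfolded zz_rel_def]
proof (induction rule: rtrancl_induct)
  case (step y z)
  have y: "(w, y) \<in> zz_rel C a b" using step(1) by (simp add: zz_rel_def)
  then have z: "(w, z) \<in> zz_rel C a b" using step(2) zz_rel_step zz_rel_sym zz_rel_trans
    by (metis UnE converseD)
  have "(f y, f z) \<in> zz_rel D c d"
    using step(2) assms(2)[OF y] assms(2)[OF z] zz_rel_sym by (metis UnE converseD)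
  with step.IH show ?case by (rule zz_rel_trans)
qed simp

lemma zz_rel_zigzag: "(w, w') \<in> zz_rel C a b \<Longrightarrow> zigzag C a w b \<longleftrightarrow> zigzag C a w' b"
  by (erule zz_rel_invariant) (auto simp: zz_step_def)

lemma zz_class_eq_Image: "zz_class C a w b = zz_rel C a b `` {w}"
  by (simp add: zz_class_def zz_rel_def)

lemma zz_class_eq_iff: "zz_class C a w b = zz_class C a w' b \<longleftrightarrow> (w, w') \<in> zz_rel C a b"
  unfolding zz_class_eq_Image by (auto intro: zz_rel_trans zz_rel_sym)

lemma zz_stepI:
  "zz_reduces C x y \<Longrightarrow> zigzag C a (u @ x @ v) b \<Longrightarrow> zigzag C a (u @ y @ v) b \<Longrightarrow>
    (u @ x @ v, u @ y @ v) \<in> zz_step C a b"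
  unfolding zz_step_def by blast

lemma zz_stepE:
  assumes "(w, w') \<in> zz_step C a b"
  obtains u x y v where "w = u @ x @ v" "w' = u @ y @ v" "zz_reduces C x y"
    "zigzag C a (u @ x @ v) b" "zigzag C a (u @ y @ v) b"
  using assms unfolding zz_step_def by blast

lemma zz_rel_append_left:
  assumes "category C" "zigzag C a u c" "(v, v') \<in> zz_rel C c b"
  shows "(u @ v, u @ v') \<in> zz_rel C a b"
  using assms(3)
proof (rule zz_rel_map)
  fix v v' assume "(v, v') \<in> zz_step C c b"
  then obtain p x y q where *: "v = p @ x @ q" "v' = p @ y @ q" "zz_reduces C x y"
    "zigzag C c (p @ x @ q) b" "zigzag C c (p @ y @ q) b" by (rule zz_stepE)
  have "((u @ p) @ x @ q, (u @ p) @ y @ q) \<in> zz_step C a b"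
    by (rule zz_stepI) (use * assms in \<open>auto intro: zigzag_appendI\<close>)
  then show "(u @ v, u @ v') \<in> zz_rel C a b" using * by (simp add: zz_rel_step)
qed

lemma zz_rel_append_right:
  assumes "category C" "zigzag C c v b" "(u, u') \<in> zz_rel C a c"
  shows "(u @ v, u' @ v) \<in> zz_rel C a b"
  using assms(3)
proof (rule zz_rel_map)
  fix u u' assume "(u, u') \<in> zz_step C a c"
  then obtain p x y q where *: "u = p @ x @ q" "u' = p @ y @ q" "zz_reduces C x y"
    "zigzag C a (p @ x @ q) c" "zigzag C a (p @ y @ q) c" by (rule zz_stepE)
  have "zigzag C a ((p @ x @ q) @ v) b" "zigzag C a ((p @ y @ q) @ v) b"
    using * assms by (blast intro: zigzag_appendI)+
  then have "(p @ x @ (q @ v), p @ y @ (q @ v)) \<in> zz_step C a b"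
    by (intro zz_stepI) (use * in auto)
  then show "(u @ v, u' @ v) \<in> zz_rel C a b" using * by (simp add: zz_rel_step)
qed

definition zz_inv :: "('m + 'm) list \<Rightarrow> ('m + 'm) list" where
  "zz_inv w = rev (map (case_sum Inr Inl) w)"

lemma zz_inv_simps [simp]:
  "zz_inv [] = []" "zz_inv (Inl f # w) = zz_inv w @ [Inr f]" "zz_inv (Inr f # w) = zz_inv w @ [Inl f]"
  by (simp_all add: zz_inv_def)

lemma zigzag_inv:
  assumes "category C" "zigzag C a w b"
  shows "zigzag C b (zz_inv w) a"
  using assms(2)
proof (induction w arbitrary: a)
  case (Cons l w)
  then show ?case using assms(1)
    by (cases l) (auto intro!: zigzag_appendI simp: categoryD)
qed simp

lemma zz_inv_inv [simp]: "zz_inv (zz_inv w) = w"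
proof -
  have "(case_sum Inr Inl \<circ> case_sum Inr Inl) = (id :: 'a + 'a \<Rightarrow> 'a + 'a)"
    by (auto simp: fun_eq_iff split: sum.split)
  then show ?thesis by (simp add: zz_inv_def rev_map)
qed

text \<open>
  The inner part of the word cancels by induction, which brings the outer two letters together; this
  is why the groupoid completion is a groupoid.
\<close>
lemma zz_rel_inv:
  assumes "category C" "zigzag C a w b"
  shows "(w @ zz_inv w, []) \<in> zz_rel C a a"
  using assms(2)
proof (induction w arbitrary: a)
  case (Cons l w)
  define c where "c = letter_tgt C l"
  define l' where "l' = case_sum Inr Inl l"
  have l: "zigzag C a [l] c" "zigzag C c w b" "zigzag C c [l'] a" "zz_inv (l # w) = zz_inv w @ [l']"
    using Cons.prems assms(1) zigzag_ends[OF assms(1), of c w b]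
    by (cases l; auto simp: c_def l'_def categoryD)+
  have "([l] @ (w @ zz_inv w) @ [l'], [l] @ [] @ [l']) \<in> zz_rel C a a"
    by (rule zz_rel_append_left[OF assms(1) l(1) zz_rel_append_right[OF assms(1) l(3) Cons.IH[OF l(2)]]])
  moreover have "([] @ [l, l'] @ [], [] @ [] @ []) \<in> zz_step C a a"
  proof (rule zz_stepI)
    show "zz_reduces C [l, l'] []"
      using Cons.prems by (cases l) (auto simp: l'_def intro: zz_reduces.intros)
  qed (use zigzag_appendI[OF assms(1) l(1,3)] zigzag_ends[OF assms(1) l(1)] in auto)
  ultimately show ?case using l(4) by (auto intro: zz_rel_trans zz_rel_step)
qed simp

definition gpd_arr :: "('o, 'm, 'z) cat_scheme \<Rightarrow> 'o \<Rightarrow> ('m + 'm) list \<Rightarrow> 'o \<Rightarrow> ('o, 'm) gpd_arrow"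
  where "gpd_arr C a w b = (a, zz_class C a w b, b)"

lemma gpd_arr_eq_iff:
  "gpd_arr C a w b = gpd_arr C a' w' b' \<longleftrightarrow> a = a' \<and> b = b' \<and> (w, w') \<in> zz_rel C a b"
  by (cases "a = a' \<and> b = b'") (auto simp only: gpd_arr_def zz_class_eq_iff prod.inject)

lemma gpd_simps [simp]:
  "Ob (gpd C) = Ob C" "Dom (gpd C) (gpd_arr C a w b) = a" "Cod (gpd C) (gpd_arr C a w b) = b"
  "Idn (gpd C) a = gpd_arr C a [] a"
  by (simp_all add: gpd_def gpd_arr_def)

lemma gpd_arr_in [simp]: "zigzag C a w b \<Longrightarrow> gpd_arr C a w b \<in> Ar (gpd C)"
  by (auto simp: gpd_def gpd_arr_def)

lemma gpd_arE:
  assumes "e \<in> Ar (gpd C)"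
  obtains a w b where "e = gpd_arr C a w b" "zigzag C a w b"
  using assms by (auto simp: gpd_def gpd_arr_def)

text \<open>
  Composition and functoriality of the groupoid completion are defined by a union over all
  representatives; a function that respects equivalence makes all members of the union equal.
\<close>
lemma UN_zz_class:
  assumes "\<And>w'. (w, w') \<in> zz_rel C a b \<Longrightarrow> (f w, f w') \<in> zz_rel D c d"
  shows "(\<Union>w'\<in>zz_class C a w b. zz_class D c (f w') d) = zz_class D c (f w) d"
proof -
  have "zz_class D c (f w') d = zz_class D c (f w) d" if "w' \<in> zz_class C a w b" for w'
    using assms that by (auto simp: zz_class_eq_Image[of C] zz_class_eq_iff zz_rel_sym)
  moreover have "w \<in> zz_class C a w b" by (simp add: zz_class_eq_Image)
  ultimately show ?thesis by (metis (no_types, lifting) SUP_eq_const empty_iff)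
qed

lemma gpd_comp [simp]:
  assumes "category C" "zigzag C a w b" "zigzag C b v c"
  shows "Comp (gpd C) (gpd_arr C b v c) (gpd_arr C a w b) = gpd_arr C a (w @ v) c"
proof -
  have "(\<Union>v'\<in>zz_class C b v c. zz_class C a (w' @ v') c) = zz_class C a (w' @ v) c"
    if "(w, w') \<in> zz_rel C a b" for w'
  proof (rule UN_zz_class)
    have "zigzag C a w' b" using zz_rel_zigzag[OF that] assms(2) by simp
    then show "(w' @ v, w' @ v') \<in> zz_rel C a c" if "(v, v') \<in> zz_rel C b c" for v'
      using that assms(1) zz_rel_append_left by metis
  qed
  then have "(\<Union>w'\<in>zz_class C a w b. \<Union>v'\<in>zz_class C b v c. zz_class C a (w' @ v') c)
      = (\<Union>w'\<in>zz_class C a w b. zz_class C a (w' @ v) c)"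
    by (auto simp: zz_class_eq_Image[of C a w b])
  also have "\<dots> = zz_class C a (w @ v) c"
    by (rule UN_zz_class) (rule zz_rel_append_right[OF assms(1,3)])
  finally show ?thesis by (simp add: gpd_def gpd_arr_def)
qed

lemma category_gpd:
  assumes "category C"
  shows "category (gpd C)"
  unfolding category_def hom_def
proof (intro conjI ballI impI)
  fix f assume "f \<in> Ar (gpd C)"
  then obtain a w b where f: "f = gpd_arr C a w b" "zigzag C a w b" by (rule gpd_arE)
  note ends = zigzag_ends[OF assms f(2)]
  show "Dom (gpd C) f \<in> Ob (gpd C)" "Cod (gpd C) f \<in> Ob (gpd C)" using f ends by auto
  show "Comp (gpd C) f (Idn (gpd C) (Dom (gpd C) f)) = f"
    "Comp (gpd C) (Idn (gpd C) (Cod (gpd C) f)) f = f"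
    using f ends assms by auto
  fix g assume "g \<in> Ar (gpd C)" "Cod (gpd C) f = Dom (gpd C) g"
  then obtain v c where g: "g = gpd_arr C b v c" "zigzag C b v c" using f by (auto elim: gpd_arE)
  show "Comp (gpd C) g f \<in> {h \<in> Ar (gpd C). Dom (gpd C) h = Dom (gpd C) f \<and> Cod (gpd C) h = Cod (gpd C) g}"
    using f g assms by (simp add: zigzag_appendI[OF assms f(2) g(2)])
  fix h assume "h \<in> Ar (gpd C)" "Cod (gpd C) g = Dom (gpd C) h"
  then obtain u d where h: "h = gpd_arr C c u d" "zigzag C c u d" using g by (auto elim: gpd_arE)
  show "Comp (gpd C) h (Comp (gpd C) g f) = Comp (gpd C) (Comp (gpd C) h g) f"
    using f g h assms by (simp add: zigzag_appendI)
qed auto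

lemma iso_arrow_gpd:
  assumes "category C" "f \<in> Ar (gpd C)"
  shows "iso_arrow (gpd C) f"
proof -
  obtain a w b where f: "f = gpd_arr C a w b" "zigzag C a w b" using assms(2) by (rule gpd_arE)
  have inv: "zigzag C b (zz_inv w) a" using assms(1) f(2) by (rule zigzag_inv)
  show ?thesis unfolding iso_arrow_def
  proof (intro conjI bexI)
    show "gpd_arr C b (zz_inv w) a \<in> hom (gpd C) (Cod (gpd C) f) (Dom (gpd C) f)"
      using f inv by (simp add: hom_def)
  qed (use f inv assms zz_rel_inv[OF assms(1) f(2)] zz_rel_inv[OF assms(1) inv]
    in \<open>auto simp: gpd_arr_eq_iff\<close>)
qed

text \<open>Every arrow of the groupoid completion is a composite of images of arrows and their
  inverses, and functors preserve inverses; so a functor out of it is determined by its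
  restriction along the unit.\<close>

lemma gpd_functor_unique:
  assumes C: "category C" and D: "category D"
    and F: "is_functor (gpd C) D F" and G: "is_functor (gpd C) D G"
    and eq: "functor_comp C F (gpd_unit C) = functor_comp C G (gpd_unit C)"
  shows "F = G"
proof (rule functor_eqI[OF F G])
  have ob: "FO F a = FO G a" if "a \<in> Ob C" for a
    using that arg_cong[OF eq, of "\<lambda>H. FO H a"] by (simp add: gpd_unit_def)
  then show "FO F a = FO G a" if "a \<in> Ob (gpd C)" for a using that by simp
  have unit: "FA F (gpd_arr C (Dom C f) [Inl f] (Cod C f)) = FA G (gpd_arr C (Dom C f) [Inl f] (Cod C f))"
    if "f \<in> Ar C" for f
    using that arg_cong[OF eq, of "\<lambda>H. FA H f"] by (simp add: gpd_unit_def gpd_arr_def)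
  have inv_eq: "FA F (gpd_arr C (Cod C f) [Inr f] (Dom C f)) = FA G (gpd_arr C (Cod C f) [Inr f] (Dom C f))"
    if f: "f \<in> Ar C" for f
  proof -
    define a b where "a = Dom C f" and "b = Cod C f"
    define m n where "m = gpd_arr C a [Inl f] b" and "n = gpd_arr C b [Inr f] a"
    have z: "zigzag C a [Inl f] b" "zigzag C b [Inr f] a"
      using f C by (auto simp: a_def b_def categoryD)
    note ends = zigzag_ends[OF C z(1)]
    have mn: "m \<in> Ar (gpd C)" "n \<in> Ar (gpd C)" "Dom (gpd C) m = a" "Cod (gpd C) m = b"
      "Dom (gpd C) n = b" "Cod (gpd C) n = a" by (simp_all add: m_def n_def gpd_arr_in[OF z(1)] gpd_arr_in[OF z(2)])
    have "Comp (gpd C) n m = Idn (gpd C) a" "Comp (gpd C) m n = Idn (gpd C) b"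
      unfolding m_def n_def gpd_comp[OF C z] gpd_comp[OF C z(2,1)] gpd_simps gpd_arr_eq_iff
      using zz_rel_inv[OF C z(1)] zz_rel_inv[OF C z(2)] by simp_all
    then have F': "Comp D (FA F m) (FA F n) = Idn D (FO F b)"
      and G': "Comp D (FA G n) (FA G m) = Idn D (FO G a)"
      using functorD(5,6)[OF F] functorD(5,6)[OF G] mn ends by (metis gpd_simps(1))+
    have *: "FA G m = FA F m" using unit[OF f] by (simp add: m_def a_def b_def)
    have ar: "FA F n \<in> Ar D" "FA F m \<in> Ar D" "FA G n \<in> Ar D"
      "Dom D (FA F n) = FO F b" "Cod D (FA F n) = FO F a" "Dom D (FA F m) = FO F a"
      "Cod D (FA F m) = FO F b" "Dom D (FA G n) = FO F b" "Cod D (FA G n) = FO F a"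
      using mn functorD[OF F] functorD[OF G] ob ends by simp_all
    have "FA F n = Comp D (Comp D (FA G n) (FA F m)) (FA F n)"
      using G' * ar ob[OF ends(1)] categoryD(10)[OF D ar(1)] by simp
    also have "\<dots> = Comp D (FA G n) (Comp D (FA F m) (FA F n))"
      using categoryD(11)[OF D ar(1) ar(2) ar(3)] ar by simp
    also have "\<dots> = FA G n"
      using F' ar categoryD(9)[OF D ar(3)] by simp
    finally show ?thesis by (simp add: n_def a_def b_def)
  qed
  have word: "FA F (gpd_arr C a w b) = FA G (gpd_arr C a w b)" if "zigzag C a w b" for a w b
    using that
  proof (induction w arbitrary: a)
    case Nil
    then show ?case using functorD(5)[OF F, of a] functorD(5)[OF G, of a] ob[of a] by auto
  next
    case (Cons l w)
    define c where "c = letter_tgt C l"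
    have z: "zigzag C a [l] c" "zigzag C c w b"
      using Cons.prems zigzag_ends[OF C, of c w b] by (auto simp: c_def)
    have l: "FA F (gpd_arr C a [l] c) = FA G (gpd_arr C a [l] c)"
      using z(1) unit inv_eq by (cases l) (auto simp: c_def)
    have split: "gpd_arr C a (l # w) b = Comp (gpd C) (gpd_arr C c w b) (gpd_arr C a [l] c)"
      unfolding gpd_comp[OF C z] by simp
    have "FA F (gpd_arr C a (l # w) b) = Comp D (FA F (gpd_arr C c w b)) (FA F (gpd_arr C a [l] c))"
      unfolding split by (rule functorD(6)[OF F]) (simp_all add: gpd_arr_in[OF z(1)] gpd_arr_in[OF z(2)])
    moreover have "FA G (gpd_arr C a (l # w) b) = Comp D (FA G (gpd_arr C c w b)) (FA G (gpd_arr C a [l] c))"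
      unfolding split by (rule functorD(6)[OF G]) (simp_all add: gpd_arr_in[OF z(1)] gpd_arr_in[OF z(2)])
    ultimately show ?case using l Cons.IH[OF z(2)] by simp
  qed
  show "FA F f = FA G f" if "f \<in> Ar (gpd C)" for f
    using that by (rule gpd_arE) (use word in simp)
qed

lemma zigzag_map:
  assumes "is_functor C D H" "zigzag C a w b"
  shows "zigzag D (FO H a) (map (map_sum (FA H) (FA H)) w) (FO H b)"
  using assms(2)
proof (induction w arbitrary: a)
  case (Cons l w)
  then have "l \<in> Ar C <+> Ar C" "a = letter_src C l"
    "zigzag D (FO H (letter_tgt C l)) (map (map_sum (FA H) (FA H)) w) (FO H b)" by simp_all
  then show ?case by (cases l) (auto simp: functorD[OF assms(1)])
qed (simp add: functorD[OF assms(1)])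

lemma zz_reduces_map:
  assumes "category C" "is_functor C D H" "zz_reduces C x y"
  shows "zz_reduces D (map (map_sum (FA H) (FA H)) x) (map (map_sum (FA H) (FA H)) y)"
  using assms(3)
  by cases (auto simp: functorD[OF assms(2)] intro!: zz_reduces.intros)

lemma zz_rel_map_functor:
  assumes "category C" "is_functor C D H" "(w, w') \<in> zz_rel C a b"
  defines "h \<equiv> map (map_sum (FA H) (FA H))"
  shows "(h w, h w') \<in> zz_rel D (FO H a) (FO H b)"
  using assms(3)
proof (rule zz_rel_map)
  fix u v assume "(u, v) \<in> zz_step C a b"
  then obtain p x y q where *: "u = p @ x @ q" "v = p @ y @ q" "zz_reduces C x y"
    "zigzag C a (p @ x @ q) b" "zigzag C a (p @ y @ q) b" by (rule zz_stepE)
  have "(h p @ h x @ h q, h p @ h y @ h q) \<in> zz_step D (FO H a) (FO H b)"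
    using * zz_reduces_map[OF assms(1,2)] zigzag_map[OF assms(2)]
    by (intro zz_stepI) (metis h_def map_append)+
  then show "(h u, h v) \<in> zz_rel D (FO H a) (FO H b)"
    using * by (simp add: h_def zz_rel_step)
qed

lemma gpd_map_arr:
  assumes "category C" "is_functor C D H" "zigzag C a w b"
  shows "FA (gpd_map C D H) (gpd_arr C a w b)
    = gpd_arr D (FO H a) (map (map_sum (FA H) (FA H)) w) (FO H b)"
proof -
  have "FA (gpd_map C D H) (gpd_arr C a w b) = (FO H a,
      \<Union>w'\<in>zz_class C a w b. zz_class D (FO H a) (map (map_sum (FA H) (FA H)) w') (FO H b), FO H b)"
    unfolding gpd_map_def using assms(3) by (simp add: gpd_arr_def[of C] gpd_arr_in[unfolded gpd_arr_def])
  also have "\<dots> = gpd_arr D (FO H a) (map (map_sum (FA H) (FA H)) w) (FO H b)"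
    unfolding gpd_arr_def by (subst UN_zz_class[OF zz_rel_map_functor[OF assms(1,2)]]) simp_all
  finally show ?thesis .
qed

lemma gpd_map_ob [simp]: "a \<in> Ob C \<Longrightarrow> FO (gpd_map C D H) a = FO H a"
  by (simp add: gpd_map_def)

lemma is_functor_gpd_map:
  assumes C: "category C" and D: "category D" and H: "is_functor C D H"
  shows "is_functor (gpd C) (gpd D) (gpd_map C D H)"
proof -
  note z = zigzag_map[OF H] and g = gpd_map_arr[OF C H]
  show ?thesis
    unfolding is_functor_def
  proof (intro conjI ballI impI)
    show "FO (gpd_map C D H) \<in> Ob (gpd C) \<rightarrow>\<^sub>E Ob (gpd D)"
      by (auto simp: PiE_iff functorD[OF H]) (simp add: gpd_map_def mk_functor_def)
    show "FA (gpd_map C D H) \<in> Ar (gpd C) \<rightarrow>\<^sub>E Ar (gpd D)"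
      by (auto simp: PiE_iff g z elim!: gpd_arE) (simp add: gpd_map_def mk_functor_def)
    fix a assume "a \<in> Ob (gpd C)"
    then show "FA (gpd_map C D H) (Idn (gpd C) a) = Idn (gpd D) (FO (gpd_map C D H) a)"
      by (simp add: g)
  next
    fix f assume "f \<in> Ar (gpd C)"
    then obtain a w b where f: "f = gpd_arr C a w b" "zigzag C a w b" by (rule gpd_arE)
    then show "Dom (gpd D) (FA (gpd_map C D H) f) = FO (gpd_map C D H) (Dom (gpd C) f)"
      "Cod (gpd D) (FA (gpd_map C D H) f) = FO (gpd_map C D H) (Cod (gpd C) f)"
      using zigzag_ends[OF C f(2)] by (simp_all add: g)
    fix h assume "h \<in> Ar (gpd C)" "Cod (gpd C) f = Dom (gpd C) h"
    then obtain v c where "h = gpd_arr C b v c" "zigzag C b v c" using f by (auto elim: gpd_arE)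
    then show "FA (gpd_map C D H) (Comp (gpd C) h f)
        = Comp (gpd D) (FA (gpd_map C D H) h) (FA (gpd_map C D H) f)"
      using f C D z by (simp add: g zigzag_appendI)
  qed
qed


section \<open>Lifting zigzags along a cartesian transformation\<close>

lemma elements_simps [simp]:
  "(c, x) \<in> Ob (elements_cat C H) \<longleftrightarrow> c \<in> Ob C \<and> x \<in> elems (FO H c)"
  "(f, x) \<in> Ar (elements_cat C H) \<longleftrightarrow> f \<in> Ar C \<and> x \<in> elems (FO H (Dom C f))"
  "Dom (elements_cat C H) (f, x) = (Dom C f, x)"
  "Cod (elements_cat C H) (f, x) = (Cod C f, ap (FA H f) x)"
  "Idn (elements_cat C H) (c, x) = (Idn C c, x)"
  "Comp (elements_cat C H) (g, y) (f, x) = (Comp C g f, x)"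
  by (simp_all add: elements_cat_def)

lemma category_elements:
  assumes "category C" "is_functor C set_cat H"
  shows "category (elements_cat C H)"
  unfolding category_def hom_def
  by (auto simp: categoryD[OF assms(1)] set_functorD[OF assms(2,1)])

text \<open>
  A natural transformation of set-valued functors whose naturality squares are pullbacks, with
  the pullback property stated on elements. This is the part of the data of a set-model that the
  loop conditions depend on.
\<close>

locale cartesian_transformation =
  fixes C :: "('o, 'm, 'z) cat_scheme"
    and S T :: "('o, 'm, 'u::grothendieck_universe, 'u setmap) functr"
    and \<pi> :: "'o \<Rightarrow> 'u setmap"
  assumes C: "category C"
    and S: "is_functor C set_cat S"
    and T: "is_functor C set_cat T"
    and \<pi>: "nat_trans C set_cat S T \<pi>"
    and cartesian: "\<And>f x y. f \<in> Ar C \<Longrightarrow> x \<in> elems (FO T (Dom C f)) \<Longrightarrow> y \<in> elems (FO S (Cod C f)) \<Longrightarrow>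
      ap (\<pi> (Cod C f)) y = ap (FA T f) x \<Longrightarrow>
      \<exists>!z. z \<in> elems (FO S (Dom C f)) \<and> ap (\<pi> (Dom C f)) z = x \<and> ap (FA S f) z = y"
begin

abbreviation "ES \<equiv> elements_cat C S"
abbreviation "ET \<equiv> elements_cat C T"
abbreviation "fib \<equiv> \<lambda>a. elems (fiber S \<pi> a)"
abbreviation "proj \<equiv> FA (elements_map C S \<pi>)"

lemmas ES = category_elements[OF C S]
lemmas ET = category_elements[OF C T]
lemmas C' = categoryD[OF C]
lemmas S' = set_functorD[OF S C]
lemmas \<pi>_in = set_nat_transD(4)[OF \<pi>]
lemmas \<pi>_natural = set_nat_transD(5)[OF \<pi> C S]

lemma fib [simp]: "y \<in> fib (c, x) \<longleftrightarrow> y \<in> elems (FO S c) \<and> ap (\<pi> c) y = x"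
  unfolding fiber_def by (simp add: elems_mk_set range_elems_subset[of _ "FO S c"])

lemma elements_map_simps [simp]:
  "c \<in> Ob C \<Longrightarrow> y \<in> elems (FO S c) \<Longrightarrow> FO (elements_map C S \<pi>) (c, y) = (c, ap (\<pi> c) y)"
  "f \<in> Ar C \<Longrightarrow> y \<in> elems (FO S (Dom C f)) \<Longrightarrow> proj (f, y) = (f, ap (\<pi> (Dom C f)) y)"
  by (simp_all add: elements_map_def)

lemma is_functor_elements_map: "is_functor ES ET (elements_map C S \<pi>)"
  unfolding elements_map_def
  by (rule is_functor_mk_functor[OF ES]) (auto simp: \<pi>_in \<pi>_natural C')

text \<open>
  The letters of a zigzag in the elements of \<open>T\<close> act on the fibers: a forward letter through \<open>S\<close>, a
  backward letter through the inverse of the bijection of fibers given by cartesianness. Recording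
  the points that are passed turns a zigzag below into a zigzag in the elements of \<open>S\<close> above it.
\<close>
fun lift_tgt :: "'u \<Rightarrow> ('m \<times> 'u) + ('m \<times> 'u) \<Rightarrow> 'u" where
  "lift_tgt y (Inl (f, x)) = ap (FA S f) y"
| "lift_tgt y (Inr (f, x)) =
    (THE z. z \<in> elems (FO S (Dom C f)) \<and> ap (\<pi> (Dom C f)) z = x \<and> ap (FA S f) z = y)"

fun lift_letter :: "'u \<Rightarrow> ('m \<times> 'u) + ('m \<times> 'u) \<Rightarrow> ('m \<times> 'u) + ('m \<times> 'u)" where
  "lift_letter y (Inl (f, x)) = Inl (f, y)"
| "lift_letter y (Inr (f, x)) = Inr (f, lift_tgt y (Inr (f, x)))"

fun lift :: "'u \<Rightarrow> (('m \<times> 'u) + ('m \<times> 'u)) list \<Rightarrow> (('m \<times> 'u) + ('m \<times> 'u)) list" where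
  "lift y [] = []"
| "lift y (l # w) = lift_letter y l # lift (lift_tgt y l) w"

fun transport :: "'u \<Rightarrow> (('m \<times> 'u) + ('m \<times> 'u)) list \<Rightarrow> 'u" where
  "transport y [] = y"
| "transport y (l # w) = transport (lift_tgt y l) w"

lemma lift_append [simp]: "lift y (u @ v) = lift y u @ lift (transport y u) v"
  by (induction u arbitrary: y) auto

lemma transport_append [simp]: "transport y (u @ v) = transport (transport y u) v"
  by (induction u arbitrary: y) auto

lemma lift_tgt_Inr:
  assumes "f \<in> Ar C" "x \<in> elems (FO T (Dom C f))" "y \<in> elems (FO S (Cod C f))"
    "ap (\<pi> (Cod C f)) y = ap (FA T f) x"
  shows "lift_tgt y (Inr (f, x)) \<in> elems (FO S (Dom C f))"
    "ap (\<pi> (Dom C f)) (lift_tgt y (Inr (f, x))) = x" "ap (FA S f) (lift_tgt y (Inr (f, x))) = y"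
  using theI'[OF cartesian[OF assms]] by simp_all

lemma lift_tgt_Inr_eq:
  assumes "f \<in> Ar C" "z \<in> elems (FO S (Dom C f))"
  shows "lift_tgt (ap (FA S f) z) (Inr (f, ap (\<pi> (Dom C f)) z)) = z"
proof -
  have "\<exists>!z'. z' \<in> elems (FO S (Dom C f)) \<and> ap (\<pi> (Dom C f)) z' = ap (\<pi> (Dom C f)) z
      \<and> ap (FA S f) z' = ap (FA S f) z"
    by (rule cartesian) (use assms in \<open>auto simp: S' \<pi>_in \<pi>_natural C'\<close>)
  then show ?thesis using assms by (auto intro: the1_equality)
qed

lemma lift_letter:
  assumes "l \<in> Ar ET <+> Ar ET" "y \<in> fib (letter_src ET l)"
  shows "lift_tgt y l \<in> fib (letter_tgt ET l)" "lift_letter y l \<in> Ar ES <+> Ar ES"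
    "letter_src ES (lift_letter y l) = (fst (letter_src ET l), y)"
    "letter_tgt ES (lift_letter y l) = (fst (letter_tgt ET l), lift_tgt y l)"
    "map_sum proj proj (lift_letter y l) = l"
proof -
  consider f x where "l = Inl (f, x)" | f x where "l = Inr (f, x)"
    by (metis prod.exhaust sum.exhaust)
  then have "lift_tgt y l \<in> fib (letter_tgt ET l) \<and> lift_letter y l \<in> Ar ES <+> Ar ES \<and>
    letter_src ES (lift_letter y l) = (fst (letter_src ET l), y) \<and>
    letter_tgt ES (lift_letter y l) = (fst (letter_tgt ET l), lift_tgt y l) \<and>
    map_sum proj proj (lift_letter y l) = l"
  proof cases
    case 1
    then show ?thesis using assms by (auto simp: S' \<pi>_natural)
  next
    case 2
    then show ?thesis using assms lift_tgt_Inr[of f x y] by (simp del: lift_tgt.simps)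
  qed
  then show "lift_tgt y l \<in> fib (letter_tgt ET l)" "lift_letter y l \<in> Ar ES <+> Ar ES"
    "letter_src ES (lift_letter y l) = (fst (letter_src ET l), y)"
    "letter_tgt ES (lift_letter y l) = (fst (letter_tgt ET l), lift_tgt y l)"
    "map_sum proj proj (lift_letter y l) = l" by blast+
qed

text \<open>
  A letter upstairs is recovered from its projection and its source, since the squares are
  pullbacks. Consequently every zigzag upstairs is the lift of its projection.
\<close>
lemma lift_letter_unique:
  assumes "l \<in> Ar ES <+> Ar ES" "letter_src ES l = (c, y)"
  shows "lift_letter y (map_sum proj proj l) = l"
    "lift_tgt y (map_sum proj proj l) = snd (letter_tgt ES l)"
proof -
  consider f x where "l = Inl (f, x)" | f x where "l = Inr (f, x)"
    by (metis prod.exhaust sum.exhaust)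
  then have "lift_letter y (map_sum proj proj l) = l \<and>
    lift_tgt y (map_sum proj proj l) = snd (letter_tgt ES l)"
    using assms by cases (auto simp: lift_tgt_Inr_eq simp del: lift_tgt.simps(2))
  then show "lift_letter y (map_sum proj proj l) = l"
    "lift_tgt y (map_sum proj proj l) = snd (letter_tgt ES l)" by blast+
qed

lemma lift_zigzag:
  assumes "zigzag ET a w b" "y \<in> fib a"
  shows "zigzag ES (fst a, y) (lift y w) (fst b, transport y w)" "transport y w \<in> fib b"
    "map (map_sum proj proj) (lift y w) = w"
proof -
  have "zigzag ES (fst a, y) (lift y w) (fst b, transport y w) \<and> transport y w \<in> fib b
    \<and> map (map_sum proj proj) (lift y w) = w"
    using assms
  proof (induction w arbitrary: a y)
    case Nil
    then show ?case by (cases a) auto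
  next
    case (Cons l w)
    then have l: "l \<in> Ar ET <+> Ar ET" "letter_src ET l = a" "zigzag ET (letter_tgt ET l) w b" by auto
    with Cons.prems have y: "y \<in> fib (letter_src ET l)" by simp
    show ?case using lift_letter[OF l(1) y] Cons.IH[OF l(3), of "lift_tgt y l"] l by simp
  qed
  then show "zigzag ES (fst a, y) (lift y w) (fst b, transport y w)" "transport y w \<in> fib b"
    "map (map_sum proj proj) (lift y w) = w" by blast+
qed

lemma lift_unique:
  assumes "zigzag ES p w q"
  shows "lift (snd p) (map (map_sum proj proj) w) = w"
    "transport (snd p) (map (map_sum proj proj) w) = snd q"
proof -
  have "lift (snd p) (map (map_sum proj proj) w) = w \<and>
    transport (snd p) (map (map_sum proj proj) w) = snd q"
    using assms
  proof (induction w arbitrary: p)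
    case (Cons l w)
    then have "l \<in> Ar ES <+> Ar ES" "letter_src ES l = (fst p, snd p)" by auto
    from lift_letter_unique[OF this] Cons show ?case by simp
  qed simp
  then show "lift (snd p) (map (map_sum proj proj) w) = w"
    "transport (snd p) (map (map_sum proj proj) w) = snd q" by blast+
qed

text \<open>
  Each defining relation of the groupoid completion holds for the action on fibers: functoriality
  of \<open>S\<close> for identities and composites, and for cancellations that backward letters act by the
  inverses of forward letters.
\<close>
lemma lift_reduces:
  assumes "zz_reduces ET v w" "zigzag ET a v b" "zigzag ET a w b" "y \<in> fib a"
  shows "zz_reduces ES (lift y v) (lift y w)" "transport y v = transport y w"
proof -
  have "zz_reduces ES (lift y v) (lift y w) \<and> transport y v = transport y w"
    using assms(1)
  proof cases
    case (zz_id p)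
    then obtain c x where "p = (c, x)" "c \<in> Ob C" by (cases p) auto
    then show ?thesis using assms zz_id zz_reduces.zz_id[of "(c, y)" ES] by (auto simp: S' C')
  next
    case (zz_comp e e')
    then obtain f x g x' where *: "e = (f, x)" "e' = (g, x')" by (metis prod.exhaust)
    then show ?thesis using assms zz_comp zz_reduces.zz_comp[of "(f, y)" ES "(g, ap (FA S f) y)"]
      by (auto simp: S' C')
  next
    case (zz_cancel_right e)
    then obtain f x where *: "e = (f, x)" by (metis prod.exhaust)
    then have "f \<in> Ar C" "y \<in> elems (FO S (Dom C f))" "x = ap (\<pi> (Dom C f)) y"
      using assms zz_cancel_right by auto
    then show ?thesis using zz_cancel_right * zz_reduces.zz_cancel_right[of "(f, y)" ES]
      by (auto simp: lift_tgt_Inr_eq simp del: lift_tgt.simps(2))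
  next
    case (zz_cancel_left e)
    then obtain f x where *: "e = (f, x)" by (metis prod.exhaust)
    then have "f \<in> Ar C" "x \<in> elems (FO T (Dom C f))" "y \<in> elems (FO S (Cod C f))"
      "ap (\<pi> (Cod C f)) y = ap (FA T f) x"
      using assms zz_cancel_left by auto
    from lift_tgt_Inr[OF this] show ?thesis
      using zz_cancel_left * zz_reduces.zz_cancel_left[of "(f, lift_tgt y (Inr (f, x)))" ES] \<open>f \<in> Ar C\<close>
      by (auto simp del: lift_tgt.simps(2))
  qed
  then show "zz_reduces ES (lift y v) (lift y w)" "transport y v = transport y w" by blast+
qed

text \<open>
  A rewriting step happens in the middle of a word, so the endpoints of the rewritten part have to
  be identified: they agree because a word and a source determine the target.
\<close>
lemma lift_step:
  assumes "(v, w) \<in> zz_step ET a b" "y \<in> fib a"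
  shows "(lift y v, lift y w) \<in> zz_step ES (fst a, y) (fst b, transport y v)"
    "transport y v = transport y w"
proof -
  obtain p x x' q where *: "v = p @ x @ q" "w = p @ x' @ q" "zz_reduces ET x x'"
    "zigzag ET a (p @ x @ q) b" "zigzag ET a (p @ x' @ q) b"
    using assms(1) by (rule zz_stepE)
  from *(4) obtain c d where c: "zigzag ET a p c" "zigzag ET c x d" "zigzag ET d q b"
    unfolding zigzag_append[OF ET] by blast
  from *(5) obtain c' d' where c': "zigzag ET a p c'" "zigzag ET c' x' d'" "zigzag ET d' q b"
    unfolding zigzag_append[OF ET] by blast
  have det: "c' = c" if "zigzag ET a p c" "zigzag ET a p c'" for a c c'
    using that by (induction p arbitrary: a) auto
  have "c' = c" using det c c' by blast
  have "d' = d" using *(3) c(2) c'(2) unfolding \<open>c' = c\<close> by cases (auto simp: categoryD[OF ET])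
  have y: "transport y p \<in> fib c" using lift_zigzag[OF c(1) assms(2)] by blast
  note red = lift_reduces[OF *(3) c(2) c'(2)[unfolded \<open>c' = c\<close> \<open>d' = d\<close>] y]
  show tr: "transport y v = transport y w" using * red by simp
  have "zigzag ES (fst a, y) (lift y v) (fst b, transport y v)"
    "zigzag ES (fst a, y) (lift y w) (fst b, transport y v)"
    using lift_zigzag[OF *(4) assms(2)] lift_zigzag[OF *(5) assms(2)] * tr by auto
  then show "(lift y v, lift y w) \<in> zz_step ES (fst a, y) (fst b, transport y v)"
    using * red zz_stepI[of ES "lift (transport y p) x" "lift (transport y p) x'" _ "lift y p"] by simp
qed

lemma transport_rel:
  assumes "(v, w) \<in> zz_rel ET a b" "y \<in> fib a"
  shows "transport y v = transport y w"
  using assms(1) by (rule zz_rel_invariant) (use assms(2) lift_step(2) in blast)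

lemma lift_rel:
  assumes "(v, w) \<in> zz_rel ET a b" "y \<in> fib a"
  shows "(lift y v, lift y w) \<in> zz_rel ES (fst a, y) (fst b, transport y v)"
  using assms(1)
proof (rule zz_rel_map)
  fix u u' assume "(v, u) \<in> zz_rel ET a b" "(u, u') \<in> zz_step ET a b"
  then show "(lift y u, lift y u') \<in> zz_rel ES (fst a, y) (fst b, transport y v)"
    using lift_step(1)[of u u' a b y] transport_rel[of v u a b y] assms(2) by (simp add: zz_rel_step)
qed


section \<open>Loop-freeness and separation of fibers\<close>

text \<open>
  Two points of the same fiber that are connected by a zigzag upstairs are equal. Equivalently, a
  point of \<open>S\<close> over a given object is determined by its image in \<open>T\<close> and its connected component.
  All the conditions to be compared are reduced to this one.
\<close>
definition separated :: bool where
  "separated \<longleftrightarrow> (\<forall>c y y' w. zigzag ES (c, y) w (c, y') \<and> ap (\<pi> c) y = ap (\<pi> c) y' \<longrightarrow> y = y')"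

text \<open>
  The action on fibers, as a functor on the groupoid completion. By \<open>transport_rel\<close> the choice of the
  representing word does not matter.
\<close>
definition transport_functor ::
  "('o \<times> 'u, ('o \<times> 'u, 'm \<times> 'u) gpd_arrow, 'u, 'u setmap) functr" where
  "transport_functor = mk_functor (gpd ET) (fiber S \<pi>)
     (\<lambda>(a, W, b). (fiber S \<pi> a, \<lambda>y\<in>fib a. transport y (SOME w. w \<in> W), fiber S \<pi> b))"

lemma transport_functor_simps:
  "a \<in> Ob ET \<Longrightarrow> FO transport_functor a = fiber S \<pi> a"
  "zigzag ET a w b \<Longrightarrow>
    FA transport_functor (gpd_arr ET a w b) = (fiber S \<pi> a, \<lambda>y\<in>fib a. transport y w, fiber S \<pi> b)"
proof -
  assume "zigzag ET a w b"
  moreover have "transport y (SOME v. v \<in> zz_class ET a w b) = transport y w" if "y \<in> fib a" for y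
  proof -
    have "(SOME v. v \<in> zz_class ET a w b) \<in> zz_class ET a w b"
      by (rule someI[of _ w]) (simp add: zz_class_eq_Image)
    then show ?thesis using transport_rel[OF _ that] by (simp add: zz_class_eq_Image)
  qed
  ultimately show "FA transport_functor (gpd_arr ET a w b)
      = (fiber S \<pi> a, \<lambda>y\<in>fib a. transport y w, fiber S \<pi> b)"
    using gpd_arr_in[of ET a w b]
    by (auto simp: transport_functor_def gpd_arr_def intro!: restrict_ext)
qed (simp add: transport_functor_def)

lemma is_functor_transport: "is_functor (gpd ET) set_cat transport_functor"
  unfolding is_functor_def
proof (intro conjI ballI impI)
  show "FO transport_functor \<in> Ob (gpd ET) \<rightarrow>\<^sub>E Ob set_cat"
    by (simp add: transport_functor_def mk_functor_def)
  show "FA transport_functor \<in> Ar (gpd ET) \<rightarrow>\<^sub>E Ar set_cat"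
  proof (rule PiE_I)
    fix f assume "f \<in> Ar (gpd ET)"
    then obtain a w b where f: "f = gpd_arr ET a w b" "zigzag ET a w b" by (rule gpd_arE)
    then show "FA transport_functor f \<in> Ar set_cat"
      by (auto simp: transport_functor_simps lift_zigzag)
  qed (simp add: transport_functor_def mk_functor_def)
  fix a assume "a \<in> Ob (gpd ET)"
  then show "FA transport_functor (Idn (gpd ET) a) = Idn set_cat (FO transport_functor a)"
    by (auto simp: transport_functor_simps)
next
  fix f assume "f \<in> Ar (gpd ET)"
  then obtain a w b where f: "f = gpd_arr ET a w b" "zigzag ET a w b" by (rule gpd_arE)
  then show "Dom set_cat (FA transport_functor f) = FO transport_functor (Dom (gpd ET) f)"
    "Cod set_cat (FA transport_functor f) = FO transport_functor (Cod (gpd ET) f)"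
    using zigzag_ends[OF ET f(2)] by (simp_all add: transport_functor_simps)
  fix g assume "g \<in> Ar (gpd ET)" "Cod (gpd ET) f = Dom (gpd ET) g"
  then obtain v c where g: "g = gpd_arr ET b v c" "zigzag ET b v c" using f by (auto elim: gpd_arE)
  show "FA transport_functor (Comp (gpd ET) g f)
      = Comp set_cat (FA transport_functor g) (FA transport_functor f)"
    unfolding f(1) g(1) gpd_comp[OF ET f(2) g(2)]
    using f g zigzag_appendI[OF ET f(2) g(2)]
    by (auto simp: transport_functor_simps compose_def lift_zigzag intro!: restrict_ext)
qed

lemma gpd_extension_eq: "gpd_extension ET set_cat (fiber_functor C S T \<pi>) = transport_functor"
proof -
  have "functor_comp ET transport_functor (gpd_unit ET) = fiber_functor C S T \<pi>"
    unfolding functor_comp_def fiber_functor_def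
  proof (rule mk_functor_eqI)
    fix a assume "a \<in> Ob ET"
    then show "FO transport_functor (FO (gpd_unit ET) a) = fiber S \<pi> a"
      by (simp add: gpd_unit_def transport_functor_simps)
  next
    fix e assume e: "e \<in> Ar ET"
    then have "zigzag ET (Dom ET e) [Inl e] (Cod ET e)" by (simp add: categoryD[OF ET])
    then have "FA transport_functor (FA (gpd_unit ET) e) = (fiber S \<pi> (Dom ET e),
        \<lambda>y\<in>fib (Dom ET e). transport y [Inl e], fiber S \<pi> (Cod ET e))"
      using e by (simp only: gpd_unit_def mk_functor_simps gpd_arr_def[symmetric] transport_functor_simps)
    then show "FA transport_functor (FA (gpd_unit ET) e) = (fiber S \<pi> (Dom ET e),
        \<lambda>y\<in>fib (Dom ET e). ap (FA S (fst e)) y, fiber S \<pi> (Cod ET e))"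
      by (cases e) simp
  qed
  then show ?thesis
    unfolding gpd_extension_def using is_functor_transport
    by (intro the_equality conjI) (auto intro!: gpd_functor_unique[OF ET category_set_cat])
qed

text \<open>
  A zigzag upstairs between two points of one fiber projects to a loop, which transports one point
  to the other; conversely a loop lifts at each point of the fiber to a zigzag from the point to
  its transport. So loops act trivially exactly if connected points of a fiber are equal.
\<close>
lemma nt_loop_free_iff_separated: "nt_loop_free C S T \<pi> \<longleftrightarrow> separated"
proof
  assume lf: "nt_loop_free C S T \<pi>"
  show separated unfolding separated_def
  proof (intro allI impI, elim conjE)
    fix c y y' w assume w: "zigzag ES (c, y) w (c, y')" and eq: "ap (\<pi> c) y = ap (\<pi> c) y'"
    define a where "a = (c, ap (\<pi> c) y)"
    define v where "v = map (map_sum proj proj) w"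
    have ends: "c \<in> Ob C" "y \<in> elems (FO S c)" "y' \<in> elems (FO S c)"
      using zigzag_ends[OF ES w] by auto
    have v: "zigzag ET a v a"
      using zigzag_map[OF is_functor_elements_map w] ends eq by (simp add: a_def v_def)
    have "automorphism (gpd ET) (gpd_arr ET a v a)"
      unfolding automorphism_def using iso_arrow_gpd[OF ET gpd_arr_in[OF v]] by simp
    then have "FA transport_functor (gpd_arr ET a v a) = Idn set_cat (FO transport_functor a)"
      using lf unfolding nt_loop_free_def gpd_extension_eq Let_def by fastforce
    then have "(\<lambda>y\<in>fib a. transport y v) = (\<lambda>y\<in>fib a. y)"
      using v zigzag_ends[OF ET v] by (simp add: transport_functor_simps)
    moreover have "y \<in> fib a" using ends by (simp add: a_def)
    ultimately have "transport y v = y" by (metis restrict_apply')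
    then show "y = y'" using lift_unique(2)[OF w] by (simp add: v_def)
  qed
next
  assume sep: separated
  show "nt_loop_free C S T \<pi>"
    unfolding nt_loop_free_def gpd_extension_eq Let_def
  proof (intro allI impI)
    fix u assume "automorphism (gpd ET) u"
    then have u: "u \<in> Ar (gpd ET)" "Dom (gpd ET) u = Cod (gpd ET) u"
      unfolding automorphism_def iso_arrow_def by auto
    from u(1) obtain a w b where "u = gpd_arr ET a w b" "zigzag ET a w b" by (rule gpd_arE)
    with u(2) have w: "u = gpd_arr ET a w a" "zigzag ET a w a" by auto
    obtain c x where a: "a = (c, x)" by (cases a)
    have "transport y w = y" if "y \<in> fib a" for y
      using lift_zigzag[OF w(2) that] that sep unfolding separated_def a
      by (metis fib fst_conv)
    then show "FA transport_functor u = Idn set_cat (FO transport_functor (Dom (gpd ET) u))"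
      using w zigzag_ends[OF ET w(2)] by (auto simp: transport_functor_simps)
  qed
qed

end


section \<open>Connected components and the square over them\<close>

lemma component_refl [simp]: "a \<in> component C a"
  by (simp add: component_def)

lemma component_eq:
  assumes "b \<in> component C a"
  shows "component C b = component C a"
proof -
  define R where "R = {(Dom C f, Cod C f) |f. f \<in> Ar C} \<union> {(Cod C f, Dom C f) |f. f \<in> Ar C}"
  have "sym R" unfolding R_def sym_def by blast
  then have "sym (R\<^sup>*)" by (rule sym_rtrancl)
  moreover have "(a, b) \<in> R\<^sup>*" using assms by (simp add: component_def R_def)
  ultimately have "(b, a) \<in> R\<^sup>*" by (metis symD)
  with \<open>(a, b) \<in> R\<^sup>*\<close> have "R\<^sup>* `` {b} = R\<^sup>* `` {a}" by (auto intro: rtrancl_trans)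
  then show ?thesis by (simp add: component_def R_def)
qed

lemma component_arrow:
  assumes "f \<in> Ar C"
  shows "component C (Cod C f) = component C (Dom C f)"
  by (rule component_eq) (use assms in \<open>auto simp: component_def\<close>)

lemma component_invariant:
  assumes "b \<in> component C a"
    and "\<And>f. f \<in> Ar C \<Longrightarrow> k (Dom C f) = k (Cod C f)"
  shows "k b = k a"
proof -
  have "(a, b) \<in> ({(Dom C f, Cod C f) |f. f \<in> Ar C} \<union> {(Cod C f, Dom C f) |f. f \<in> Ar C})\<^sup>*"
    using assms(1) by (simp add: component_def)
  then show ?thesis
  proof (induction rule: rtrancl_induct)
    case (step y z)
    then show ?case using assms(2) by auto
  qed simp
qed

lemma component_subset:
  assumes "category C" "a \<in> Ob C"
  shows "component C a \<subseteq> Ob C"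
  using component_invariant[of _ C a "\<lambda>x. x \<in> Ob C"] assms categoryD(1,2)[OF assms(1)] by blast

lemma component_functor:
  assumes "is_functor C D H" "b \<in> component C a"
  shows "component D (FO H b) = component D (FO H a)"
  using assms(2)
proof (rule component_invariant[where k = "\<lambda>x. component D (FO H x)"])
  fix f assume f: "f \<in> Ar C"
  then show "component D (FO H (Dom C f)) = component D (FO H (Cod C f))"
    using component_arrow[of "FA H f" D] functorD(2-4)[OF assms(1) f] by simp
qed

lemma component_gpd:
  assumes C: "category C" and a: "a \<in> Ob C"
  shows "component (gpd C) a = {b. \<exists>w. zigzag C a w b}"
proof (intro equalityI subsetI)
  fix b assume b: "b \<in> component (gpd C) a"
  define k where "k x = (\<exists>w. zigzag C a w x)" for x
  have "k b = k a"
  proof (rule component_invariant[OF b])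
    fix f assume "f \<in> Ar (gpd C)"
    then obtain c w d where "f = gpd_arr C c w d" "zigzag C c w d" by (rule gpd_arE)
    then show "k (Dom (gpd C) f) = k (Cod (gpd C) f)"
      unfolding k_def using zigzag_appendI[OF C] zigzag_inv[OF C] by (simp, metis)
  qed
  moreover have "zigzag C a [] a" using a by simp
  ultimately show "b \<in> {b. \<exists>w. zigzag C a w b}" unfolding k_def by blast
next
  fix b assume "b \<in> {b. \<exists>w. zigzag C a w b}"
  then obtain w where "zigzag C a w b" by blast
  then have "component (gpd C) b = component (gpd C) a"
    using component_arrow[of "gpd_arr C a w b" "gpd C"] by simp
  then show "b \<in> component (gpd C) a" using component_refl by metis
qed

lemma discrete_simps [simp]:
  "Ob (discrete_cat X) = X" "Ar (discrete_cat X) = X" "Dom (discrete_cat X) x = x"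
  "Cod (discrete_cat X) x = x" "Idn (discrete_cat X) x = x" "Comp (discrete_cat X) y x = x"
  by (simp_all add: discrete_cat_def)

lemma category_discrete: "category (discrete_cat X)"
  by (auto simp: category_def hom_def)

lemma pi0_simps [simp]:
  "Ob (pi0 C) = component C ` Ob C" "Ar (pi0 C) = component C ` Ob C" "Dom (pi0 C) x = x"
  "Cod (pi0 C) x = x" "Idn (pi0 C) x = x" "Comp (pi0 C) y x = x"
  by (simp_all add: pi0_def)

lemma category_pi0: "category (pi0 C)"
  unfolding pi0_def by (rule category_discrete)

lemma is_functor_pi0_quot: "category C \<Longrightarrow> is_functor C (pi0 C) (pi0_quot C)"
  unfolding pi0_quot_def
  by (rule is_functor_mk_functor) (simp_all add: categoryD component_arrow)

lemma pi0_map_simps: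
  assumes "is_functor C D H" "a \<in> Ob C"
  shows "FO (pi0_map C D H) (component C a) = component D (FO H a)"
    "FA (pi0_map C D H) (component C a) = component D (FO H a)"
proof -
  have "(\<Union>b\<in>component C a. component D (FO H b)) = (\<Union>b\<in>component C a. component D (FO H a))"
    by (rule SUP_cong) (use component_functor[OF assms(1)] in auto)
  also have "component C a \<noteq> {}" using component_refl by (metis empty_iff)
  then have "(\<Union>b\<in>component C a. component D (FO H a)) = component D (FO H a)" by simp
  finally show "FO (pi0_map C D H) (component C a) = component D (FO H a)"
    "FA (pi0_map C D H) (component C a) = component D (FO H a)"
    using assms(2) by (simp_all add: pi0_map_def)
qed

lemma is_functor_pi0_map:
  assumes "is_functor C D H"
  shows "is_functor (pi0 C) (pi0 D) (pi0_map C D H)"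
proof -
  have "FO (pi0_map C D H) \<in> extensional (Ob (pi0 C))" "FA (pi0_map C D H) \<in> extensional (Ar (pi0 C))"
    unfolding pi0_map_def mk_functor_def by (simp_all del: pi0_simps)
  then show ?thesis unfolding is_functor_def
    by (auto simp: PiE_iff pi0_map_simps[OF assms] functorD[OF assms])
qed

lemma pi0_square_commutes:
  assumes "category C" "is_functor C D H"
  shows "functor_comp C (pi0_map C D H) (pi0_quot C) = functor_comp C (pi0_quot D) H"
  unfolding functor_comp_def
  by (rule mk_functor_eqI)
    (use assms in \<open>simp_all add: pi0_quot_def pi0_map_simps functorD categoryD\<close>)

text \<open>Objects of a pullback are maps from the one-object discrete category, so objects of
  the corner with the same image on both sides are equal.\<close>

lemma cartesian_in_Cat_ob_eq:
  fixes U :: "'u::grothendieck_universe itself"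
  assumes cart: "cartesian_in_Cat U P X Y Z t l r b"
    and p: "p \<in> Ob P" "p' \<in> Ob P" "FO t p = FO t p'" "FO l p = FO l p'"
  shows "p = p'"
proof -
  define e :: 'u where "e = undefined"
  define E where "E = discrete_cat {e}"
  have E: "category E" "Ob E = {e}" "Ar E = {e}" "Dom E e = e"
    by (simp_all add: E_def category_discrete)
  have small: "small_set U (Ob E)" "small_set U (Ar E)"
    unfolding small_set_def E
    by (metis bij_betw_id elems_mk_set range_elems_singleton)+
  have func: "category P" "is_functor P X t" "is_functor P Y l" "is_functor X Z r" "is_functor Y Z b"
    "functor_comp P r t = functor_comp P b l"
    using cart unfolding cartesian_in_Cat_def by auto
  define pt where "pt q = mk_functor E (\<lambda>_. q) (\<lambda>_. Idn P q)" for q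
  have pt: "is_functor E P (pt q)" if "q \<in> Ob P" for q
    unfolding pt_def
    by (rule is_functor_mk_functor)
      (use that func(1) categoryD(10)[OF func(1), of "Idn P q"] in \<open>simp_all add: E(1) categoryD\<close>)
  have t: "functor_comp E t (pt p) = functor_comp E t (pt p')"
    and l: "functor_comp E l (pt p) = functor_comp E l (pt p')"
    unfolding functor_comp_def
    by (rule mk_functor_eqI; use p func in \<open>simp add: pt_def functorD(5)\<close>)+
  have "\<exists>!w. is_functor E P w \<and> functor_comp E t w = functor_comp E t (pt p)
      \<and> functor_comp E l w = functor_comp E l (pt p)"
  proof -
    have "functor_comp E r (functor_comp E t (pt p)) = functor_comp E b (functor_comp E l (pt p))"
      using func(6) functor_comp_assoc[OF E(1) pt[OF p(1)]] by metis
    moreover have "is_functor E X (functor_comp E t (pt p))" "is_functor E Y (functor_comp E l (pt p))"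
      using is_functor_comp[OF E(1) pt[OF p(1)]] func by auto
    moreover have "\<forall>u v. category E \<and> small_set U (Ob E) \<and> small_set U (Ar E) \<and>
        is_functor E X u \<and> is_functor E Y v \<and> functor_comp E r u = functor_comp E b v \<longrightarrow>
        (\<exists>!w. is_functor E P w \<and> functor_comp E t w = u \<and> functor_comp E l w = v)"
      using cart unfolding cartesian_in_Cat_def by blast
    ultimately show ?thesis using E(1) small by blast
  qed
  then have "pt p = pt p'" using pt p(1,2) t l by metis
  then have "FO (pt p) e = FO (pt p') e" by simp
  then show ?thesis by (simp add: pt_def E)
qed

text \<open>
  The functor into the corner is forced. On objects, a point of the prescribed component over the
  prescribed object is found by lifting a path, and it is unique by separation. On arrows it has to
  be the unique lift with the right source; the target is right because both candidates lie over
  the same object in the same component. Functoriality follows from uniqueness of lifts.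
\<close>
lemma cartesian_pi0I:
  fixes U :: "'u::grothendieck_universe itself"
  assumes P: "category P" and Y: "category Y" and h: "is_functor P Y h"
    and lift: "\<And>p k. p \<in> Ob P \<Longrightarrow> k \<in> Ar Y \<Longrightarrow> Dom Y k = FO h p \<Longrightarrow>
      \<exists>!g. g \<in> Ar P \<and> Dom P g = p \<and> FA h g = k"
    and conn: "\<And>a b. a \<in> Ob Y \<Longrightarrow> b \<in> component Y a \<Longrightarrow> \<exists>k. k \<in> hom Y a b"
    and sep: "\<And>p q. p \<in> Ob P \<Longrightarrow> q \<in> component P p \<Longrightarrow> FO h p = FO h q \<Longrightarrow> p = q"
  shows "cartesian_in_Cat U P (pi0 P) Y (pi0 Y) (pi0_quot P) h (pi0_map P Y h) (pi0_quot Y)"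
  unfolding cartesian_in_Cat_def
proof (intro conjI allI impI; (elim conjE)?)
  fix E :: "('u, 'u) cat" and u v
  assume E: "category E" and u: "is_functor E (pi0 P) u" and v: "is_functor E Y v"
    and eq: "functor_comp E (pi0_map P Y h) u = functor_comp E (pi0_quot Y) v"
  note E' = categoryD[OF E] and h' = functorD[OF h] and v' = functorD[OF v] and P' = categoryD[OF P]
  have sep': "p = q" if "p \<in> Ob P" "q \<in> Ob P" "component P p = component P q" "FO h p = FO h q" for p q
    using sep[of p q] that component_refl by metis
  have comp_ob: "\<exists>!p. p \<in> Ob P \<and> component P p = FO u e \<and> FO h p = FO v e" if e: "e \<in> Ob E" for e
  proof -
    from functorD(1)[OF u e] obtain p where p: "p \<in> Ob P" "FO u e = component P p" by auto
    have "component Y (FO h p) = component Y (FO v e)"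
      using arg_cong[OF eq, of "\<lambda>H. FO H e"] e p v'(1)
      by (simp add: pi0_map_simps[OF h] pi0_quot_def)
    then have "FO v e \<in> component Y (FO h p)" by simp
    from conn[OF h'(1)[OF p(1)] this]
    obtain k where k: "k \<in> Ar Y" "Dom Y k = FO h p" "Cod Y k = FO v e"
      by (auto simp: hom_def)
    from lift[OF p(1) k(1,2)] obtain g where g: "g \<in> Ar P" "Dom P g = p" "FA h g = k" by blast
    \<comment> \<open>the lift of a path ending over the prescribed object ends in the fiber and stays in the component\<close>
    have "Cod P g \<in> Ob P \<and> component P (Cod P g) = FO u e \<and> FO h (Cod P g) = FO v e"
      using g k p P' component_arrow[OF g(1)] h'(4)[OF g(1)] by simp
    then show ?thesis using sep' by (metis (no_types, lifting))
  qed
  define wo where "wo e = (THE p. p \<in> Ob P \<and> component P p = FO u e \<and> FO h p = FO v e)" for e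
  have wo: "wo e \<in> Ob P" "component P (wo e) = FO u e" "FO h (wo e) = FO v e" if "e \<in> Ob E" for e
    using theI'[OF comp_ob[OF that]] by (simp_all add: wo_def)
  define wa where "wa f = (THE g. g \<in> Ar P \<and> Dom P g = wo (Dom E f) \<and> FA h g = FA v f)" for f
  have lift_f: "\<exists>!g. g \<in> Ar P \<and> Dom P g = wo (Dom E f) \<and> FA h g = FA v f" if "f \<in> Ar E" for f
    by (rule lift) (use that wo E' v' in simp_all)
  have wa: "wa f \<in> Ar P" "Dom P (wa f) = wo (Dom E f)" "FA h (wa f) = FA v f" if "f \<in> Ar E" for f
    using theI'[OF lift_f[OF that]] by (simp_all add: wa_def)
  have wa_eq: "wa f = g" if "f \<in> Ar E" "g \<in> Ar P" "Dom P g = wo (Dom E f)" "FA h g = FA v f" for f g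
    using lift_f[OF that(1)] wa[OF that(1)] that by blast
  have u_const: "FA u f = FO u (Dom E f)" "FO u (Cod E f) = FO u (Dom E f)" if "f \<in> Ar E" for f
    using functorD(3,4)[OF u that] by simp_all
  have wa_cod: "Cod P (wa f) = wo (Cod E f)" if f: "f \<in> Ar E" for f
  proof (rule sep')
    show "component P (Cod P (wa f)) = component P (wo (Cod E f))"
      using component_arrow[OF wa(1)[OF f]] wa[OF f] wo E' f u_const[OF f] by simp
    show "FO h (Cod P (wa f)) = FO h (wo (Cod E f))"
      using h'(4)[OF wa(1)[OF f]] wa[OF f] v'(4)[OF f] wo E' f by simp
  qed (use f wa wo P' E' in auto)
  define w where "w = mk_functor E wo wa"
  have wf: "is_functor E P w"
    unfolding w_def
  proof (rule is_functor_mk_functor[OF E])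
    fix a assume "a \<in> Ob E"
    then show "wa (Idn E a) = Idn P (wo a)"
      by (intro wa_eq) (use wo E' P' h' v' in simp_all)
  next
    fix f g assume "f \<in> Ar E" "g \<in> Ar E" "Cod E f = Dom E g"
    then show "wa (Comp E g f) = Comp P (wa g) (wa f)"
      by (intro wa_eq) (use wa wa_cod E' P' h' v' in simp_all)
  qed (use wo wa wa_cod in auto)
  show "\<exists>!w. is_functor E P w \<and> functor_comp E (pi0_quot P) w = u \<and> functor_comp E h w = v"
  proof (intro ex1I conjI; (elim conjE)?)
    show "is_functor E P w" by fact
    show "functor_comp E (pi0_quot P) w = u"
      by (rule functor_eqI[OF is_functor_comp[OF E wf is_functor_pi0_quot[OF P]] u])
        (use wo wa E' u_const in \<open>simp_all add: w_def pi0_quot_def\<close>)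
    show "functor_comp E h w = v"
      by (rule functor_eqI[OF is_functor_comp[OF E wf h] v]) (use wo wa in \<open>simp_all add: w_def\<close>)
    fix w' assume w': "is_functor E P w'" "functor_comp E (pi0_quot P) w' = u" "functor_comp E h w' = v"
    have ob: "FO w' e = wo e" if e: "e \<in> Ob E" for e
      using functorD(1)[OF w'(1) e] wo[OF e] e arg_cong[OF w'(2), of "\<lambda>H. FO H e"]
        arg_cong[OF w'(3), of "\<lambda>H. FO H e"]
      by (intro sep') (simp_all add: pi0_quot_def)
    have "FA w' f = wa f" if f: "f \<in> Ar E" for f
      using functorD(2,3)[OF w'(1) f] ob E' f arg_cong[OF w'(3), of "\<lambda>H. FA H f"]
      by (intro wa_eq[symmetric]) simp_all
    with ob show "w' = w" by (intro functor_eqI[OF w'(1) wf]) (simp_all add: w_def)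
  qed
qed (use assms in \<open>simp_all add: category_pi0 is_functor_pi0_quot is_functor_pi0_map pi0_square_commutes\<close>)

context cartesian_transformation
begin

abbreviation "gproj \<equiv> gpd_map ES ET (elements_map C S \<pi>)"

lemmas h_functor = is_functor_gpd_map[OF ES ET is_functor_elements_map]
lemmas h_arr = gpd_map_arr[OF ES is_functor_elements_map]

text \<open>
  Objects with equal projection lie in the same fiber, and components of the groupoid completion
  are zigzag components.
\<close>
lemma separated_iff_component:
  "separated \<longleftrightarrow> (\<forall>p q. p \<in> Ob ES \<and> q \<in> component (gpd ES) p \<and> FO gproj p = FO gproj q \<longrightarrow> p = q)"
proof (intro iffI allI impI; (elim conjE)?)
  fix p q
  assume sep: separated and p: "p \<in> Ob ES" and q: "q \<in> component (gpd ES) p" and eq: "FO gproj p = FO gproj q"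
  from q obtain w where w: "zigzag ES p w q" using component_gpd[OF ES p] by auto
  note ends = zigzag_ends[OF ES w]
  obtain c y c' y' where pq: "p = (c, y)" "q = (c', y')" by (metis prod.exhaust)
  with eq ends have "c = c'" "ap (\<pi> c) y = ap (\<pi> c) y'" by auto
  with sep w pq show "p = q" unfolding separated_def by blast
next
  assume *: "\<forall>p q. p \<in> Ob ES \<and> q \<in> component (gpd ES) p \<and> FO gproj p = FO gproj q \<longrightarrow> p = q"
  show separated unfolding separated_def
  proof (intro allI impI, elim conjE)
    fix c y y' w assume w: "zigzag ES (c, y) w (c, y')" and eq: "ap (\<pi> c) y = ap (\<pi> c) y'"
    note ends = zigzag_ends[OF ES w]
    have "FO gproj (c, y) = FO gproj (c, y')" using ends eq by simp
    moreover have "(c, y') \<in> component (gpd ES) (c, y)" using w component_gpd[OF ES ends(1)] by blast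
    ultimately show "y = y'" using * ends(1) by blast
  qed
qed

text \<open>The unique lifting of zigzags respects their equivalence, so it is a unique lifting of
  arrows of the groupoid completions.\<close>

lemma gpd_lift_unique:
  assumes p: "p \<in> Ob ES" and k: "k \<in> Ar (gpd ET)" "Dom (gpd ET) k = FO gproj p"
  shows "\<exists>!g. g \<in> Ar (gpd ES) \<and> Dom (gpd ES) g = p \<and> FA gproj g = k"
proof -
  obtain a w b where "k = gpd_arr ET a w b" "zigzag ET a w b" using k(1) by (rule gpd_arE)
  with k(2) have w: "k = gpd_arr ET (FO gproj p) w b" "zigzag ET (FO gproj p) w b" by auto
  obtain c y where cy: "p = (c, y)" by (cases p)
  have y: "y \<in> fib (FO gproj p)" and fst: "fst (FO gproj p) = c" using p cy by auto
  note lw = lift_zigzag[OF w(2) y, unfolded fst]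
  have FOb: "FO gproj (fst b, transport y w) = b"
    using zigzag_ends[OF ES lw(1)] lw(2) by (cases b) simp
  show ?thesis
  proof (intro ex1I conjI; (elim conjE)?)
    show "gpd_arr ES p (lift y w) (fst b, transport y w) \<in> Ar (gpd ES)"
      using lw(1) cy by simp
    show "Dom (gpd ES) (gpd_arr ES p (lift y w) (fst b, transport y w)) = p" by simp
    show "FA gproj (gpd_arr ES p (lift y w) (fst b, transport y w)) = k"
      using lw h_arr[OF lw(1)] FOb w(1) cy p zigzag_ends[OF ES lw(1)] by simp
  next
    fix g assume "g \<in> Ar (gpd ES)" "Dom (gpd ES) g = p" and hg: "FA gproj g = k"
    then obtain v q where g: "g = gpd_arr ES p v q" "zigzag ES p v q" by (auto elim: gpd_arE)
    define v' where "v' = map (map_sum proj proj) v"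
    have v: "lift y v' = v" "transport y v' = snd q"
      using lift_unique[OF g(2)] cy by (simp_all add: v'_def)
    have hk: "gpd_arr ET (FO gproj p) v' (FO gproj q) = gpd_arr ET (FO gproj p) w b"
      using hg h_arr[OF g(2)] g w(1) p zigzag_ends[OF ES g(2)] by (simp add: v'_def)
    then have rel: "(v', w) \<in> zz_rel ET (FO gproj p) (FO gproj q)" and b: "b = FO gproj q"
      by (auto simp: gpd_arr_eq_iff)
    have fq: "fst (FO gproj q) = fst q" using zigzag_ends[OF ES g(2)] by (cases q) simp
    have "(v, lift y w) \<in> zz_rel ES p q"
      using lift_rel[OF rel y] v fst fq cy by simp
    moreover have "q = (fst b, transport y w)"
      using transport_rel[OF rel y] v b fq by (simp add: prod_eq_iff)
    ultimately show "g = gpd_arr ES p (lift y w) (fst b, transport y w)"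
      using g(1) by (simp add: gpd_arr_eq_iff)
  qed
qed

lemma pi0_square_iff_separated: "pi0_square_cartesian C S T \<pi> \<longleftrightarrow> separated"
proof
  assume sq: "pi0_square_cartesian C S T \<pi>"
  show separated unfolding separated_iff_component
  proof (intro allI impI, elim conjE)
    fix p q assume p: "p \<in> Ob ES" and q: "q \<in> component (gpd ES) p" and eq: "FO gproj p = FO gproj q"
    have "component (gpd ES) p \<subseteq> Ob ES"
      using component_subset[OF category_gpd[OF ES], of p] p by simp
    with q have q': "q \<in> Ob ES" by blast
    show "p = q"
      by (rule cartesian_in_Cat_ob_eq[OF sq[unfolded pi0_square_cartesian_def Let_def] _ _ _ eq])
        (use p q' component_eq[OF q] in \<open>simp_all add: pi0_quot_def\<close>)
  qed
next
  assume separated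
  then have sep: "\<And>p q. p \<in> Ob ES \<Longrightarrow> q \<in> component (gpd ES) p \<Longrightarrow> FO gproj p = FO gproj q \<Longrightarrow> p = q"
    unfolding separated_iff_component by blast
  show "pi0_square_cartesian C S T \<pi>"
    unfolding pi0_square_cartesian_def Let_def
  proof (intro cartesian_pi0I category_gpd ES ET h_functor)
    fix a b assume a: "a \<in> Ob (gpd ET)" and b: "b \<in> component (gpd ET) a"
    then obtain w where "zigzag ET a w b" using component_gpd[OF ET] by auto
    then show "\<exists>k. k \<in> hom (gpd ET) a b"
      by (intro exI[of _ "gpd_arr ET a w b"]) (simp add: hom_def)
  next
    fix p q assume "p \<in> Ob (gpd ES)" "q \<in> component (gpd ES) p" "FO gproj p = FO gproj q"
    with sep show "p = q" by (simp only: gpd_simps)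
  next
    fix p k assume "p \<in> Ob (gpd ES)" "k \<in> Ar (gpd ET)" "Dom (gpd ET) k = FO gproj p"
    then show "\<exists>!g. g \<in> Ar (gpd ES) \<and> Dom (gpd ES) g = p \<and> FA gproj g = k"
      using gpd_lift_unique by simp
  qed
qed

end


section \<open>Colimits of sets and the square over them\<close>

lemma component_zigzag:
  assumes C: "category C" and a: "a \<in> Ob C"
  shows "component C a = {b. \<exists>w. zigzag C a w b}"
proof (intro equalityI subsetI)
  fix b assume b: "b \<in> component C a"
  define k where "k x = (\<exists>w. zigzag C a w x)" for x
  have "k b = k a"
  proof (rule component_invariant[OF b])
    fix f assume f: "f \<in> Ar C"
    have "zigzag C (Dom C f) [Inl f] (Cod C f)" "zigzag C (Cod C f) [Inr f] (Dom C f)"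
      using f C by (auto simp: categoryD)
    then show "k (Dom C f) = k (Cod C f)"
      unfolding k_def using zigzag_appendI[OF C] by metis
  qed
  moreover have "zigzag C a [] a" using a by simp
  ultimately show "b \<in> {b. \<exists>w. zigzag C a w b}" unfolding k_def by blast
next
  fix b assume "b \<in> {b. \<exists>w. zigzag C a w b}"
  then obtain w where "zigzag C a w b" by blast
  then have "component C b = component C a"
  proof (induction w arbitrary: a)
    case (Cons l w)
    then have "l \<in> Ar C <+> Ar C" "a = letter_src C l" "component C b = component C (letter_tgt C l)"
      by simp_all
    then show ?case by (cases l) (simp_all add: component_arrow)
  qed simp
  then show "b \<in> component C a" using component_refl by metis
qed

lemma is_functor_const: "category J \<Longrightarrow> is_functor J set_cat (const_functor J set_cat M)"
  unfolding const_functor_def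
  by (rule is_functor_mk_functor)
    (simp_all add: categoryD[OF category_set_cat] del: set_cat_simps(5), auto simp: compose_def)

lemma const_functor_simps [simp]:
  "a \<in> Ob J \<Longrightarrow> FO (const_functor J D M) a = M" "f \<in> Ar J \<Longrightarrow> FA (const_functor J D M) f = Idn D M"
  by (simp_all add: const_functor_def)

lemma set_coconeD:
  assumes "category J" "is_functor J set_cat H" "nat_trans J set_cat H (const_functor J set_cat M) \<kappa>"
  shows "j \<in> Ob J \<Longrightarrow> \<kappa> j \<in> hom set_cat (FO H j) M"
    "j \<in> Ob J \<Longrightarrow> x \<in> elems (FO H j) \<Longrightarrow> ap (\<kappa> j) x \<in> elems M"
    "f \<in> Ar J \<Longrightarrow> x \<in> elems (FO H (Dom J f)) \<Longrightarrow>
      ap (\<kappa> (Cod J f)) (ap (FA H f) x) = ap (\<kappa> (Dom J f)) x"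
proof -
  note n = set_nat_transD[OF assms(3)]
  show "j \<in> Ob J \<Longrightarrow> \<kappa> j \<in> hom set_cat (FO H j) M"
    using n(1-3)[of j] by (simp add: hom_def)
  show *: "j \<in> Ob J \<Longrightarrow> x \<in> elems (FO H j) \<Longrightarrow> ap (\<kappa> j) x \<in> elems M" for j
    using n(4)[of j x] by simp
  show "f \<in> Ar J \<Longrightarrow> x \<in> elems (FO H (Dom J f)) \<Longrightarrow>
      ap (\<kappa> (Cod J f)) (ap (FA H f) x) = ap (\<kappa> (Dom J f)) x"
    using n(5)[OF assms(1,2), of f x] *[of "Dom J f"] assms(1) by (simp add: categoryD)
qed

lemma set_coconeI:
  assumes "category J" "is_functor J set_cat H" "\<kappa> \<in> extensional (Ob J)"
    and "\<And>j. j \<in> Ob J \<Longrightarrow> \<kappa> j \<in> hom set_cat (FO H j) M"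
    and "\<And>f x. f \<in> Ar J \<Longrightarrow> x \<in> elems (FO H (Dom J f)) \<Longrightarrow>
      ap (\<kappa> (Cod J f)) (ap (FA H f) x) = ap (\<kappa> (Dom J f)) x"
  shows "nat_trans J set_cat H (const_functor J set_cat M) \<kappa>"
proof (rule set_nat_transI[OF assms(1,2) is_functor_const[OF assms(1)] assms(3)])
  fix f x assume f: "f \<in> Ar J" "x \<in> elems (FO H (Dom J f))"
  then have "ap (\<kappa> (Dom J f)) x \<in> elems M"
    using assms(4)[of "Dom J f"] set_arrow_ap[of "\<kappa> (Dom J f)" x] assms(1)
    by (auto simp: hom_def categoryD)
  with f show "ap (FA (const_functor J set_cat M) f) (ap (\<kappa> (Dom J f)) x) = ap (\<kappa> (Cod J f)) (ap (FA H f) x)"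
    using assms(5)[OF f] by simp
qed (use assms in simp)

lemma cocone_component:
  assumes "category J" "is_functor J set_cat H" "nat_trans J set_cat H (const_functor J set_cat M) \<kappa>"
    and "(d, z) \<in> component (elements_cat J H) (c, y)"
  shows "ap (\<kappa> d) z = ap (\<kappa> c) y"
proof -
  have "(\<lambda>(c, y). ap (\<kappa> c) y) (d, z) = (\<lambda>(c, y). ap (\<kappa> c) y) (c, y)"
    using assms(4)
    by (rule component_invariant) (auto simp: set_coconeD(3)[OF assms(1-3)])
  then show ?thesis by simp
qed

text \<open>The colimit of a small diagram of sets is the set of connected components of its category
  of elements, encoded in the universe through a bijection of the objects with a small set.\<close>

lemma components_colimit:
  fixes H :: "('o, 'm, 'u::grothendieck_universe, 'u setmap) functr"
  assumes J: "category J" and H: "is_functor J set_cat H" and small: "small_set TYPE('u) (Ob J)"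
  shows "\<exists>L \<iota>. universal_cocone J set_cat H L \<iota> \<and>
    (\<forall>c y d z. (c, y) \<in> Ob (elements_cat J H) \<and> (d, z) \<in> Ob (elements_cat J H) \<and>
      ap (\<iota> c) y = ap (\<iota> d) z \<longrightarrow> (d, z) \<in> component (elements_cat J H) (c, y)) \<and>
    (\<forall>l\<in>elems L. \<exists>c y. (c, y) \<in> Ob (elements_cat J H) \<and> l = ap (\<iota> c) y)"
proof -
  let ?E = "elements_cat J H"
  have E: "category ?E" by (rule category_elements[OF J H])
  obtain X :: 'u and f where f: "bij_betw f (elems X) (Ob J)" using small unfolding small_set_def by blast
  define code where "code = inv_into (elems X) f"
  have code: "code c \<in> elems X" "f (code c) = c" if "c \<in> Ob J" for c
    using f that unfolding code_def bij_betw_def by (auto simp: inv_into_into f_inv_into_f)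
  define enc where "enc = (\<lambda>(c, y). vpair (code c) y)"
  define K where "K = vcoprod X (\<lambda>i. FO H (f i))"
  have enc_inj: "inj_on enc (Ob ?E)"
    unfolding inj_on_def by (auto simp: enc_def) (metis code(2))
  have enc_in: "enc ` Ob ?E \<subseteq> elems K"
    by (auto simp: enc_def K_def elems_vcoprod code)
  define cls where "cls p = mk_set (enc ` component ?E p)" for p
  have sub: "component ?E p \<subseteq> Ob ?E" if "p \<in> Ob ?E" for p
    by (rule component_subset[OF E that])
  have cls_elems: "elems (cls p) = enc ` component ?E p" if "p \<in> Ob ?E" for p
    unfolding cls_def
    by (rule elems_mk_set[OF range_elems_subset[of _ K]]) (use sub[OF that] enc_in in blast)
  have cls_eq: "q \<in> component ?E p" if "p \<in> Ob ?E" "q \<in> Ob ?E" "cls p = cls q" for p q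
  proof -
    have "enc ` component ?E p = enc ` component ?E q" using cls_elems that by metis
    then have "component ?E p = component ?E q"
      using inj_on_image_eq_iff[OF enc_inj sub[OF that(1)] sub[OF that(2)]] by blast
    then show ?thesis using component_refl by metis
  qed
  have cls_eqI: "cls q = cls p" if "q \<in> component ?E p" for p q
    using component_eq[OF that] by (simp add: cls_def)
  have small_cls: "cls ` Ob ?E \<in> range elems"
  proof -
    have "cls ` Ob ?E = (\<lambda>z. cls (inv_into (Ob ?E) enc z)) ` (enc ` Ob ?E)"
      using enc_inj by (auto simp: image_image)
    also obtain k where "enc ` Ob ?E = elems k" using range_elems_subset[OF enc_in] by blast
    finally show ?thesis by (simp add: range_elems_image)
  qed
  define L where "L = mk_set (cls ` Ob ?E)"
  have L: "elems L = cls ` Ob ?E" unfolding L_def by (rule elems_mk_set[OF small_cls])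
  define \<iota> where "\<iota> = (\<lambda>c\<in>Ob J. (FO H c, \<lambda>y\<in>elems (FO H c). cls (c, y), L))"
  have \<iota>: "ap (\<iota> c) y = cls (c, y)" if "(c, y) \<in> Ob ?E" for c y
    using that by (simp add: \<iota>_def)
  have \<iota>_hom: "\<iota> c \<in> hom set_cat (FO H c) L" if "c \<in> Ob J" for c
    using that by (auto simp: \<iota>_def hom_def L)
  have "universal_cocone J set_cat H L \<iota>"
    unfolding universal_cocone_def
  proof (intro conjI ballI allI impI)
    show "nat_trans J set_cat H (const_functor J set_cat L) \<iota>"
    proof (rule set_coconeI[OF J H _ \<iota>_hom])
      fix g x assume g: "g \<in> Ar J" "x \<in> elems (FO H (Dom J g))"
      then have e: "(g, x) \<in> Ar ?E" by simp
      have "cls (Cod ?E (g, x)) = cls (Dom ?E (g, x))"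
        using component_arrow[OF e] by (simp add: cls_def)
      then show "ap (\<iota> (Cod J g)) (ap (FA H g) x) = ap (\<iota> (Dom J g)) x"
        using g J H by (simp add: \<iota> categoryD set_functorD)
    qed (unfold \<iota>_def, rule restrict_extensional)
  next
    fix M :: 'u and \<kappa> assume \<kappa>: "nat_trans J set_cat H (const_functor J set_cat M) \<kappa>"
    define rep where "rep l = (SOME p. p \<in> Ob ?E \<and> cls p = l)" for l
    define u where "u = (L, \<lambda>l\<in>elems L. ap (\<kappa> (fst (rep l))) (snd (rep l)), M)"
    have rep: "rep (cls p) \<in> Ob ?E \<and> cls (rep (cls p)) = cls p" if "p \<in> Ob ?E" for p
      unfolding rep_def by (rule someI[of _ p]) (use that in simp)
    have u_cls: "ap u (cls (c, y)) = ap (\<kappa> c) y" if p: "(c, y) \<in> Ob ?E" for c y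
    proof -
      obtain d z where dz: "rep (cls (c, y)) = (d, z)" by (cases "rep (cls (c, y))")
      have "(d, z) \<in> component ?E (c, y)" by (rule cls_eq[OF p]) (use rep[OF p] dz in auto)
      then have "ap (\<kappa> d) z = ap (\<kappa> c) y" by (rule cocone_component[OF J H \<kappa>])
      moreover have "cls (c, y) \<in> elems L" using p L by blast
      ultimately show ?thesis by (simp add: u_def dz)
    qed
    have u: "u \<in> hom set_cat L M"
    proof -
      have "ap u l \<in> elems M" if "l \<in> elems L" for l
        using that L u_cls set_coconeD(2)[OF J H \<kappa>] by auto
      then show ?thesis by (auto simp: u_def hom_def)
    qed
    show "\<exists>!u. u \<in> hom set_cat L M \<and> (\<forall>j\<in>Ob J. Comp set_cat u (\<iota> j) = \<kappa> j)"
    proof (intro ex1I conjI ballI; (elim conjE)?)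
      show "u \<in> hom set_cat L M" by fact
      fix j assume j: "j \<in> Ob J"
      show "Comp set_cat u (\<iota> j) = \<kappa> j"
        using \<iota>_hom[OF j] u set_coconeD(1)[OF J H \<kappa> j] j
        by (intro set_arrow_eqI) (auto simp: hom_def categoryD[OF category_set_cat] ap_comp \<iota> u_cls)
    next
      fix v assume v: "v \<in> hom set_cat L M" and eq: "\<forall>j\<in>Ob J. Comp set_cat v (\<iota> j) = \<kappa> j"
      have "ap v (cls (c, y)) = ap (\<kappa> c) y" if "(c, y) \<in> Ob ?E" for c y
      proof -
        have "ap (Comp set_cat v (\<iota> c)) y = ap v (ap (\<iota> c) y)"
          by (rule ap_comp) (use \<iota>_hom[of c] that in \<open>auto simp: hom_def\<close>)
        then show ?thesis using that eq by (simp add: \<iota>)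
      qed
      then show "v = u" using u v u_cls L
        by (intro set_arrow_eqI) (auto simp: hom_def)
    qed
  qed simp
  moreover have "\<forall>c y d z. (c, y) \<in> Ob ?E \<and> (d, z) \<in> Ob ?E \<and> ap (\<iota> c) y = ap (\<iota> d) z
      \<longrightarrow> (d, z) \<in> component ?E (c, y)"
    using cls_eq \<iota> by metis
  moreover have "\<forall>l\<in>elems L. \<exists>c y. (c, y) \<in> Ob ?E \<and> l = ap (\<iota> c) y"
    unfolding L using \<iota> by (metis imageE surj_pair)
  ultimately show ?thesis by blast
qed

lemma universal_coconeD:
  assumes "universal_cocone J D H L \<iota>"
  shows "nat_trans J D H (const_functor J D L) \<iota>"
    "nat_trans J D H (const_functor J D M) \<kappa> \<Longrightarrow> M \<in> Ob D \<Longrightarrow>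
      \<exists>!u. u \<in> hom D L M \<and> (\<forall>j\<in>Ob J. Comp D u (\<iota> j) = \<kappa> j)"
  using assms unfolding universal_cocone_def by blast+

context
  fixes J :: "('o, 'm, 'z) cat_scheme" and H :: "('o, 'm, 'u::grothendieck_universe, 'u setmap) functr"
  assumes J: "category J" and H: "is_functor J set_cat H" and small: "small_set TYPE('u) (Ob J)"
begin

lemma universal_colim: "universal_cocone J set_cat H (colim J H) (colim_inj J H)"
proof -
  have "\<exists>p. (case p of (L, \<iota>) \<Rightarrow> universal_cocone J set_cat H L \<iota>)"
    using components_colimit[OF J H small] by auto
  from someI_ex[OF this] show ?thesis
    unfolding colim_def colim_inj_def colim_cocone_def split_beta' .
qed

lemmas colim_nat = universal_coconeD(1)[OF universal_colim]
lemmas colim_universal = universal_coconeD(2)[OF universal_colim, unfolded set_cat_simps(1), OF _ UNIV_I]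
lemmas colim_inj = set_coconeD[OF J H colim_nat]

lemma colim_inj_comp:
  assumes "\<And>j. j \<in> Ob J \<Longrightarrow> Comp D u (colim_inj J H j) = \<kappa> j" "D = set_cat"
    and "(c, y) \<in> Ob (elements_cat J H)"
  shows "ap u (ap (colim_inj J H c) y) = ap (\<kappa> c) y"
proof -
  have "ap (Comp set_cat u (colim_inj J H c)) y = ap u (ap (colim_inj J H c) y)"
    by (rule ap_comp) (use colim_inj(1)[of c] assms(3) in \<open>auto simp: hom_def\<close>)
  then show ?thesis using assms by simp
qed

text \<open>
  The colimit has been chosen abstractly. It is compared with the explicit colimit of connected
  components, into which it maps compatibly with the injections.
\<close>
lemma colim_inj_eq_iff:
  assumes "(c, y) \<in> Ob (elements_cat J H)" "(d, z) \<in> Ob (elements_cat J H)"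
  shows "ap (colim_inj J H c) y = ap (colim_inj J H d) z
    \<longleftrightarrow> (d, z) \<in> component (elements_cat J H) (c, y)"
proof
  assume eq: "ap (colim_inj J H c) y = ap (colim_inj J H d) z"
  obtain L \<iota> where L: "universal_cocone J set_cat H L \<iota>"
    "\<And>c y d z. (c, y) \<in> Ob (elements_cat J H) \<Longrightarrow> (d, z) \<in> Ob (elements_cat J H) \<Longrightarrow>
      ap (\<iota> c) y = ap (\<iota> d) z \<Longrightarrow> (d, z) \<in> component (elements_cat J H) (c, y)"
    using components_colimit[OF J H small] by metis
  obtain u where u: "\<And>j. j \<in> Ob J \<Longrightarrow> Comp set_cat u (colim_inj J H j) = \<iota> j"
    using ex1_implies_ex[OF colim_universal[OF universal_coconeD(1)[OF L(1)]]] by blast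
  have "ap (\<iota> c) y = ap (\<iota> d) z"
    using colim_inj_comp[OF u _ assms(1)] colim_inj_comp[OF u _ assms(2)] eq by simp
  then show "(d, z) \<in> component (elements_cat J H) (c, y)" using L(2) assms by blast
qed (rule cocone_component[OF J H colim_nat, symmetric])

text \<open>
  An isomorphism with the explicit colimit of connected components, in which every element is
  represented, transfers that property to the chosen colimit.
\<close>
lemma colim_inj_surj:
  assumes "l \<in> elems (colim J H)"
  obtains c y where "(c, y) \<in> Ob (elements_cat J H)" "l = ap (colim_inj J H c) y"
proof -
  obtain L \<iota> where L: "universal_cocone J set_cat H L \<iota>"
    "\<And>l. l \<in> elems L \<Longrightarrow> \<exists>c y. (c, y) \<in> Ob (elements_cat J H) \<and> l = ap (\<iota> c) y"
    using components_colimit[OF J H small] by metis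
  note L_nat = universal_coconeD(1)[OF L(1)]
  obtain u where u: "u \<in> hom set_cat (colim J H) L"
      "\<And>j. j \<in> Ob J \<Longrightarrow> Comp set_cat u (colim_inj J H j) = \<iota> j"
    using ex1_implies_ex[OF colim_universal[OF L_nat]] by blast
  obtain v where v: "v \<in> hom set_cat L (colim J H)"
      "\<And>j. j \<in> Ob J \<Longrightarrow> Comp set_cat v (\<iota> j) = colim_inj J H j"
    using ex1_implies_ex[OF universal_coconeD(2)[OF L(1) colim_nat, unfolded set_cat_simps(1), OF UNIV_I]]
    by blast
  have vu: "Comp set_cat (Comp set_cat v u) (colim_inj J H j) = colim_inj J H j" if "j \<in> Ob J" for j
    using categoryD(11)[OF category_set_cat, of "colim_inj J H j" u v] u v colim_inj(1)[OF that] that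
    by (simp add: hom_def)
  have id: "Comp set_cat (Idn set_cat (colim J H)) (colim_inj J H j) = colim_inj J H j"
    if "j \<in> Ob J" for j
    using categoryD(10)[OF category_set_cat, of "colim_inj J H j"] colim_inj(1)[OF that]
    by (simp add: hom_def del: set_cat_simps)
  have "Comp set_cat v u \<in> hom set_cat (colim J H) (colim J H)"
    "Idn set_cat (colim J H) \<in> hom set_cat (colim J H) (colim J H)"
    using u(1) v(1) by (simp_all add: hom_def categoryD[OF category_set_cat] del: set_cat_simps(2-6))
  then have "Comp set_cat v u = Idn set_cat (colim J H)"
    using colim_universal[OF colim_nat, unfolded ex1_iff_ex_Uniq] vu id
    by (elim conjE Uniq_D) blast+
  then have "ap v (ap u l) = l"
    using ap_comp[of l u v] u(1) assms by (simp add: hom_def)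
  moreover have "ap u l \<in> elems L" using u(1) assms set_arrow_ap[of u l] by (auto simp: hom_def)
  then obtain c y where cy: "(c, y) \<in> Ob (elements_cat J H)" "ap u l = ap (\<iota> c) y" using L(2) by blast
  moreover have "ap (Comp set_cat v (\<iota> c)) y = ap v (ap (\<iota> c) y)"
    by (rule ap_comp) (use set_coconeD(1)[OF J H L_nat, of c] cy(1) in \<open>auto simp: hom_def\<close>)
  ultimately show ?thesis using that v(2)[of c] by simp
qed

end

lemma colim_map:
  fixes S T :: "('o, 'm, 'u::grothendieck_universe, 'u setmap) functr"
  assumes J: "category J" and S: "is_functor J set_cat S" and T: "is_functor J set_cat T"
    and small: "small_set TYPE('u) (Ob J)" and \<pi>: "nat_trans J set_cat S T \<pi>"
  shows "colim_map J S T \<pi> \<in> hom set_cat (colim J S) (colim J T)"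
    "c \<in> Ob J \<Longrightarrow> y \<in> elems (FO S c) \<Longrightarrow>
      ap (colim_map J S T \<pi>) (ap (colim_inj J S c) y) = ap (colim_inj J T c) (ap (\<pi> c) y)"
proof -
  define \<kappa> where "\<kappa> = (\<lambda>c\<in>Ob J. Comp set_cat (colim_inj J T c) (\<pi> c))"
  note injT = colim_inj[OF J T small] and \<pi>' = set_nat_transD[OF \<pi>]
  have ap\<kappa>: "ap (\<kappa> c) y = ap (colim_inj J T c) (ap (\<pi> c) y)" if "c \<in> Ob J" "y \<in> elems (FO S c)" for c y
    using that by (simp add: \<kappa>_def ap_comp \<pi>')
  have "nat_trans J set_cat S (const_functor J set_cat (colim J T)) \<kappa>"
  proof (rule set_coconeI[OF J S])
    fix j assume j: "j \<in> Ob J"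
    then show "\<kappa> j \<in> hom set_cat (FO S j) (colim J T)"
      using injT(1)[OF j] \<pi>'(1-3)[OF j] by (simp add: \<kappa>_def hom_def categoryD[OF category_set_cat])
  qed (use J S in \<open>simp_all add: \<kappa>_def[THEN arg_cong, of "\<lambda>x. x \<in> _"] ap\<kappa> categoryD set_functorD \<pi>' injT\<close>)
  from colim_universal[OF J S small this]
  have ex: "\<exists>!u. u \<in> hom set_cat (colim J S) (colim J T) \<and>
      (\<forall>j\<in>Ob J. Comp set_cat u (colim_inj J S j) = Comp set_cat (colim_inj J T j) (\<pi> j))"
    by (simp add: \<kappa>_def)
  have *: "colim_map J S T \<pi> \<in> hom set_cat (colim J S) (colim J T) \<and>
      (\<forall>j\<in>Ob J. Comp set_cat (colim_map J S T \<pi>) (colim_inj J S j) = Comp set_cat (colim_inj J T j) (\<pi> j))"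
    unfolding colim_map_def by (rule theI'[OF ex])
  then show "colim_map J S T \<pi> \<in> hom set_cat (colim J S) (colim J T)" by blast
  assume cy: "c \<in> Ob J" "y \<in> elems (FO S c)"
  have "Comp set_cat (colim_map J S T \<pi>) (colim_inj J S j) = \<kappa> j" if "j \<in> Ob J" for j
    using * that by (simp add: \<kappa>_def)
  from colim_inj_comp[OF J S small this refl, of c y] cy
  show "ap (colim_map J S T \<pi>) (ap (colim_inj J S c) y) = ap (colim_inj J T c) (ap (\<pi> c) y)"
    by (simp add: ap\<kappa>)
qed

lemma functor_cat_simps [simp]:
  "(F, \<eta>, G) \<in> Ar (functor_cat J D) \<longleftrightarrow> is_functor J D F \<and> is_functor J D G \<and> nat_trans J D F G \<eta>"
  "Dom (functor_cat J D) (F, \<eta>, G) = F" "Cod (functor_cat J D) (F, \<eta>, G) = G"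
  "Comp (functor_cat J D) (G, \<theta>, K) (F, \<eta>, G') = (F, \<lambda>a\<in>Ob J. Comp D (\<theta> a) (\<eta> a), K)"
  by (simp_all add: functor_cat_def)

lemma nat_trans_eqI:
  assumes "nat_trans J set_cat F G \<eta>" "nat_trans J set_cat F G \<theta>"
    and "\<And>c x. c \<in> Ob J \<Longrightarrow> x \<in> elems (FO F c) \<Longrightarrow> ap (\<eta> c) x = ap (\<theta> c) x"
  shows "\<eta> = \<theta>"
proof (rule extensionalityI)
  note n = set_nat_transD[OF assms(1)] set_nat_transD[OF assms(2)]
  show "\<eta> \<in> extensional (Ob J)" "\<theta> \<in> extensional (Ob J)" by (rule n)+
  show "\<eta> c = \<theta> c" if "c \<in> Ob J" for c
    by (rule set_arrow_eqI) (use n that assms(3) in simp_all)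
qed

lemma nat_trans_comp:
  assumes J: "category J" and F: "is_functor J set_cat F" and G: "is_functor J set_cat G"
    and K: "is_functor J set_cat K"
    and \<eta>: "nat_trans J set_cat F G \<eta>" and \<theta>: "nat_trans J set_cat G K \<theta>"
  shows "nat_trans J set_cat F K (\<lambda>c\<in>Ob J. Comp set_cat (\<theta> c) (\<eta> c))"
proof -
  note n = set_nat_transD[OF \<eta>] and n' = set_nat_transD[OF \<theta>]
  show ?thesis
  proof (rule set_nat_transI[OF J F K])
    fix c assume "c \<in> Ob J"
    then show "(\<lambda>c\<in>Ob J. Comp set_cat (\<theta> c) (\<eta> c)) c \<in> hom set_cat (FO F c) (FO K c)"
      using n n' by (simp add: hom_def categoryD[OF category_set_cat])
  next
    fix f x assume "f \<in> Ar J" "x \<in> elems (FO F (Dom J f))"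
    then show "ap (FA K f) (ap ((\<lambda>c\<in>Ob J. Comp set_cat (\<theta> c) (\<eta> c)) (Dom J f)) x)
        = ap ((\<lambda>c\<in>Ob J. Comp set_cat (\<theta> c) (\<eta> c)) (Cod J f)) (ap (FA F f) x)"
      using J F G n n' by (simp add: categoryD set_functorD ap_comp)
  qed simp
qed


locale small_cartesian_transformation = cartesian_transformation C S T \<pi>
  for C :: "('o, 'm, 'z) cat_scheme"
    and S T :: "('o, 'm, 'u::grothendieck_universe, 'u setmap) functr"
    and \<pi> :: "'o \<Rightarrow> 'u setmap" +
  assumes small: "small_set TYPE('u) (Ob C)"
begin

abbreviation "inS c \<equiv> ap (colim_inj C S c)"
abbreviation "inT c \<equiv> ap (colim_inj C T c)"
abbreviation "colim_proj \<equiv> colim_map C S T \<pi>"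

lemmas inS = colim_inj[OF C S small]
lemmas inT = colim_inj[OF C T small]
lemmas colim_proj = colim_map[OF C S T small \<pi>]

lemma inS_eq_iff:
  "c \<in> Ob C \<Longrightarrow> y \<in> elems (FO S c) \<Longrightarrow> d \<in> Ob C \<Longrightarrow> z \<in> elems (FO S d) \<Longrightarrow>
    inS c y = inS d z \<longleftrightarrow> (\<exists>w. zigzag ES (c, y) w (d, z))"
  using colim_inj_eq_iff[OF C S small, of c y d z] component_zigzag[OF ES, of "(c, y)"] by auto

lemma inT_eq_iff:
  "c \<in> Ob C \<Longrightarrow> x \<in> elems (FO T c) \<Longrightarrow> d \<in> Ob C \<Longrightarrow> x' \<in> elems (FO T d) \<Longrightarrow>
    inT c x = inT d x' \<longleftrightarrow> (\<exists>w. zigzag ET (c, x) w (d, x'))"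
  using colim_inj_eq_iff[OF C T small, of c x d x'] component_zigzag[OF ET, of "(c, x)"] by auto

lemma colim_proj_elems: "l \<in> elems (colim C S) \<Longrightarrow> ap colim_proj l \<in> elems (colim C T)"
  using colim_proj(1) set_arrow_ap[of colim_proj l] by (auto simp: hom_def)

text \<open>
  Elementwise, the square over the colimits is a pullback. For existence, represent the element of
  the colimit by a point somewhere else in the diagram; its projection is connected to the given
  point downstairs, and lifting the connecting zigzag moves the representative into the right
  fiber without changing its class. Uniqueness is separation.
\<close>
lemma separated_ex1:
  assumes separated "c \<in> Ob C" "l \<in> elems (colim C S)" "x \<in> elems (FO T c)" "ap colim_proj l = inT c x"
  shows "\<exists>!y. y \<in> elems (FO S c) \<and> ap (\<pi> c) y = x \<and> inS c y = l"
proof -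
  obtain d z where dz: "d \<in> Ob C" "z \<in> elems (FO S d)" "l = inS d z"
    by (rule colim_inj_surj[OF C S small assms(3)]) (metis that elements_simps(1))
  have "inT d (ap (\<pi> d) z) = inT c x" using assms(5) dz colim_proj(2) by simp
  then obtain w where w: "zigzag ET (d, ap (\<pi> d) z) w (c, x)"
    using inT_eq_iff dz assms \<pi>_in by blast
  have z: "z \<in> fib (d, ap (\<pi> d) z)" using dz by simp
  define y where "y = transport z w"
  have y: "y \<in> elems (FO S c)" "ap (\<pi> c) y = x" "zigzag ES (d, z) (lift z w) (c, y)"
    using lift_zigzag[OF w z] by (simp_all add: y_def)
  then have "inS c y = l" using inS_eq_iff[OF dz(1,2) assms(2) y(1)] dz(3) by metis
  with y show ?thesis
  proof (intro ex1I[of _ y] conjI; (elim conjE)?)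
    fix y' assume y': "y' \<in> elems (FO S c)" "ap (\<pi> c) y' = x" "inS c y' = l"
    then obtain v where "zigzag ES (c, y') v (c, y)"
      using inS_eq_iff[OF assms(2) y'(1) assms(2) y(1)] \<open>inS c y = l\<close> by auto
    then show "y' = y" using assms(1) y y' unfolding separated_def by blast
  qed auto
qed

lemma colim_nat_trans:
  "nat_trans C set_cat S (const_functor C set_cat (colim C S)) (colim_inj C S)"
  "nat_trans C set_cat T (const_functor C set_cat (colim C T)) (colim_inj C T)"
  by (rule colim_nat[OF C S small] colim_nat[OF C T small])+

lemma colim_map_nat_trans:
  "nat_trans C set_cat (const_functor C set_cat (colim C S)) (const_functor C set_cat (colim C T))
    (\<lambda>_\<in>Ob C. colim_proj)"
  by (rule set_nat_transI[OF C is_functor_const[OF C] is_functor_const[OF C]])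
    (use colim_proj(1) in \<open>simp_all add: C' colim_proj_elems\<close>)

text \<open>
  Pairs of points that the two legs of the square starting at \<open>S\<close> do not distinguish.
\<close>
definition kernel_pairs :: "'o \<Rightarrow> 'u set" where
  "kernel_pairs c = {vpair y y' | y y'. y \<in> elems (FO S c) \<and> y' \<in> elems (FO S c) \<and>
    ap (\<pi> c) y = ap (\<pi> c) y' \<and> inS c y = inS c y'}"

lemma kernel_pair_functor:
  obtains K p q where "is_functor C set_cat K" "nat_trans C set_cat K S p" "nat_trans C set_cat K S q"
    "\<And>c. c \<in> Ob C \<Longrightarrow> elems (FO K c) = kernel_pairs c"
    "\<And>c z. c \<in> Ob C \<Longrightarrow> z \<in> kernel_pairs c \<Longrightarrow> ap (p c) z = vfst z \<and> ap (q c) z = vsnd z"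
proof -
  define R where "R = kernel_pairs"
  note R_def = R_def kernel_pairs_def
  have R: "elems (mk_set (R c)) = R c" for c
    by (rule elems_mk_set, rule range_elems_subset[of _ "vcoprod (FO S c) (\<lambda>_. FO S c)"])
      (auto simp: R_def elems_vcoprod)
  define act where "act f z = vpair (ap (FA S f) (vfst z)) (ap (FA S f) (vsnd z))" for f z
  have act: "act f z \<in> R (Cod C f)" if "f \<in> Ar C" "z \<in> R (Dom C f)" for f z
    using that inS(3) by (auto simp: R_def act_def S' \<pi>_natural)
  define K where "K = mk_functor C (\<lambda>c. mk_set (R c))
    (\<lambda>f. (mk_set (R (Dom C f)), \<lambda>z\<in>R (Dom C f). act f z, mk_set (R (Cod C f))))"
  have K: "is_functor C set_cat K" unfolding K_def
  proof (rule is_functor_mk_functor[OF C])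
    fix a assume "a \<in> Ob C"
    then show "(mk_set (R (Dom C (Idn C a))), \<lambda>z\<in>R (Dom C (Idn C a)). act (Idn C a) z,
        mk_set (R (Cod C (Idn C a)))) = Idn set_cat (mk_set (R a))"
      by (auto simp: C' R intro!: restrict_ext) (auto simp: act_def R_def S')
  next
    fix f g assume "f \<in> Ar C" "g \<in> Ar C" "Cod C f = Dom C g"
    then show "(mk_set (R (Dom C (Comp C g f))), \<lambda>z\<in>R (Dom C (Comp C g f)). act (Comp C g f) z,
        mk_set (R (Cod C (Comp C g f))))
      = Comp set_cat (mk_set (R (Dom C g)), \<lambda>z\<in>R (Dom C g). act g z, mk_set (R (Cod C g)))
          (mk_set (R (Dom C f)), \<lambda>z\<in>R (Dom C f). act f z, mk_set (R (Cod C f)))"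
      using act[of f] by (auto simp: C' R compose_def intro!: restrict_ext) (auto simp: act_def R_def S')
  qed (use act in \<open>auto simp: R\<close>)
  define pr where "pr k = (\<lambda>c\<in>Ob C. (mk_set (R c), \<lambda>z\<in>R c. k z, FO S c))" for k :: "'u \<Rightarrow> 'u"
  have nt: "nat_trans C set_cat K S (pr k)"
    if "\<And>c z. z \<in> R c \<Longrightarrow> k z \<in> elems (FO S c)" "\<And>f z. k (act f z) = ap (FA S f) (k z)" for k
  proof (rule set_nat_transI[OF C K S])
    fix f x assume "f \<in> Ar C" "x \<in> elems (FO K (Dom C f))"
    then show "ap (FA S f) (ap (pr k (Dom C f)) x) = ap (pr k (Cod C f)) (ap (FA K f) x)"
      using act[of f x] that(2) by (simp add: pr_def K_def C' R)
  qed (use that in \<open>auto simp: pr_def K_def hom_def R\<close>)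
  show thesis
  proof (rule that[OF K nt nt])
    show "vfst z \<in> elems (FO S c)" "vsnd z \<in> elems (FO S c)" if "z \<in> R c" for c z
      using that by (auto simp: R_def)
  qed (auto simp: act_def K_def pr_def R R_def(1)[symmetric])
qed

text \<open>
  The two projections of the functor of indistinguishable pairs become equal after composition
  with either leg, so by the uniqueness part of the universal property they are equal.
\<close>
lemma colim_square_separated:
  assumes "colim_square_cartesian C S T \<pi>"
  shows separated
  unfolding separated_def
proof (intro allI impI, elim conjE)
  fix c y y' w assume w: "zigzag ES (c, y) w (c, y')" and eq: "ap (\<pi> c) y = ap (\<pi> c) y'"
  have ends: "c \<in> Ob C" "y \<in> elems (FO S c)" "y' \<in> elems (FO S c)"
    using zigzag_ends[OF ES w] by auto
  have in_eq: "inS c y = inS c y'" using inS_eq_iff ends w by blast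
  obtain K p q where K: "is_functor C set_cat K"
    and p: "nat_trans C set_cat K S p" and q: "nat_trans C set_cat K S q"
    and elK: "\<And>c. c \<in> Ob C \<Longrightarrow> elems (FO K c) = kernel_pairs c"
    and pq: "\<And>c z. c \<in> Ob C \<Longrightarrow> z \<in> kernel_pairs c \<Longrightarrow> ap (p c) z = vfst z \<and> ap (q c) z = vsnd z"
    by (rule kernel_pair_functor) (rule that)
  let ?FC = "functor_cat C set_cat" and ?\<Delta>S = "const_functor C set_cat (colim C S)"
    and ?\<Delta>T = "const_functor C set_cat (colim C T)"
  have pq_nat: "\<And>c. c \<in> Ob C \<Longrightarrow> p c \<in> Ar set_cat" "\<And>c. c \<in> Ob C \<Longrightarrow> Dom set_cat (p c) = FO K c"
    "\<And>c. c \<in> Ob C \<Longrightarrow> Cod set_cat (p c) = FO S c" "\<And>c. c \<in> Ob C \<Longrightarrow> q c \<in> Ar set_cat"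
    "\<And>c. c \<in> Ob C \<Longrightarrow> Dom set_cat (q c) = FO K c" "\<And>c. c \<in> Ob C \<Longrightarrow> Cod set_cat (q c) = FO S c"
    using set_nat_transD(1-3)[OF p] set_nat_transD(1-3)[OF q] by auto
  define u where "u r = (\<lambda>c\<in>Ob C. Comp set_cat (colim_inj C S c) (r c))" for r
  define v where "v r = (\<lambda>c\<in>Ob C. Comp set_cat (\<pi> c) (r c))" for r
  have u: "nat_trans C set_cat K ?\<Delta>S (u p)" "nat_trans C set_cat K ?\<Delta>S (u q)"
    unfolding u_def by (rule nat_trans_comp[OF C K S is_functor_const[OF C]] p q colim_nat_trans)+
  have v: "nat_trans C set_cat K T (v p)" "nat_trans C set_cat K T (v q)"
    unfolding v_def by (rule nat_trans_comp[OF C K S T] p q \<pi>)+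
  have pq_eq: "inS c (ap (p c) z) = inS c (ap (q c) z) \<and> ap (\<pi> c) (ap (p c) z) = ap (\<pi> c) (ap (q c) z)"
    if "c \<in> Ob C" "z \<in> elems (FO K c)" for c z
    using that(2) pq[OF that(1)] unfolding elK[OF that(1)] by (auto simp: kernel_pairs_def)
  have u_eq: "u q = u p"
    by (rule nat_trans_eqI[OF u(2,1)]) (simp add: u_def ap_comp pq_nat pq_eq)
  have v_eq: "v q = v p"
    by (rule nat_trans_eqI[OF v(2,1)]) (simp add: v_def ap_comp pq_nat pq_eq)
  have sq: "pullback_square ?FC (S, colim_inj C S, ?\<Delta>S) (S, \<pi>, T)
      (?\<Delta>S, \<lambda>_\<in>Ob C. colim_proj, ?\<Delta>T) (T, colim_inj C T, ?\<Delta>T)"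
    using assms unfolding colim_square_cartesian_def Let_def .
  have univ: "\<And>u v. u \<in> Ar ?FC \<Longrightarrow> v \<in> Ar ?FC \<Longrightarrow> Dom ?FC u = Dom ?FC v \<Longrightarrow> Cod ?FC u = ?\<Delta>S \<Longrightarrow>
      Cod ?FC v = T \<Longrightarrow>
      Comp ?FC (?\<Delta>S, \<lambda>_\<in>Ob C. colim_proj, ?\<Delta>T) u = Comp ?FC (T, colim_inj C T, ?\<Delta>T) v \<Longrightarrow>
      \<exists>!w. w \<in> hom ?FC (Dom ?FC u) S \<and> Comp ?FC (S, colim_inj C S, ?\<Delta>S) w = u
        \<and> Comp ?FC (S, \<pi>, T) w = v"
    using sq unfolding pullback_square_def functor_cat_simps by blast
  have "(\<lambda>c\<in>Ob C. Comp set_cat ((\<lambda>_\<in>Ob C. colim_proj) c) (u p c)) = (\<lambda>c\<in>Ob C. Comp set_cat (colim_inj C T c) (v p c))"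
  proof (rule nat_trans_eqI)
    show "nat_trans C set_cat K ?\<Delta>T (\<lambda>c\<in>Ob C. Comp set_cat ((\<lambda>_\<in>Ob C. colim_proj) c) (u p c))"
      by (rule nat_trans_comp[OF C K _ _ u(1) colim_map_nat_trans]) (rule is_functor_const[OF C])+
    show "nat_trans C set_cat K ?\<Delta>T (\<lambda>c\<in>Ob C. Comp set_cat (colim_inj C T c) (v p c))"
      by (rule nat_trans_comp[OF C K T _ v(1) colim_nat_trans(2)]) (rule is_functor_const[OF C])
    fix c x assume cx: "c \<in> Ob C" "x \<in> elems (FO K c)"
    have "ap (p c) x \<in> elems (FO S c)" using set_nat_transD(4)[OF p] cx by blast
    then show "ap ((\<lambda>c\<in>Ob C. Comp set_cat ((\<lambda>_\<in>Ob C. colim_proj) c) (u p c)) c) x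
        = ap ((\<lambda>c\<in>Ob C. Comp set_cat (colim_inj C T c) (v p c)) c) x"
      using cx set_nat_transD(1-3)[OF u(1)] set_nat_transD(1-3)[OF v(1)]
      by (simp add: ap_comp colim_proj(2)) (simp add: u_def v_def ap_comp pq_nat colim_proj(2))
  qed
  then have ex1: "\<exists>!w. w \<in> hom ?FC (Dom ?FC (K, u p, ?\<Delta>S)) S
      \<and> Comp ?FC (S, colim_inj C S, ?\<Delta>S) w = (K, u p, ?\<Delta>S) \<and> Comp ?FC (S, \<pi>, T) w = (K, v p, T)"
    by (intro univ) (simp_all add: K u v T is_functor_const[OF C])
  have homs: "(K, p, S) \<in> hom ?FC K S" "(K, q, S) \<in> hom ?FC K S"
    using p q K S by (simp_all add: hom_def)
  have comps: "Comp ?FC (S, colim_inj C S, ?\<Delta>S) (K, p, S) = (K, u p, ?\<Delta>S)"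
    "Comp ?FC (S, \<pi>, T) (K, p, S) = (K, v p, T)"
    "Comp ?FC (S, colim_inj C S, ?\<Delta>S) (K, q, S) = (K, u p, ?\<Delta>S)"
    "Comp ?FC (S, \<pi>, T) (K, q, S) = (K, v p, T)"
    using u_eq v_eq by (simp_all add: u_def v_def)
  have "(K, p, S) = (K, q, S)"
    by (rule Uniq_D[OF conjunct2[OF ex1[unfolded ex1_iff_ex_Uniq]]])
      (simp_all only: functor_cat_simps(2) homs comps simp_thms)
  then have "ap (p c) (vpair y y') = ap (q c) (vpair y y')" by simp
  moreover have "vpair y y' \<in> kernel_pairs c"
    using ends eq in_eq by (auto simp: kernel_pairs_def)
  ultimately show "y = y'" using pq[OF ends(1), of "vpair y y'"] by simp
qed

text \<open>
  The mediating transformation is determined pointwise by \<open>separated_ex1\<close>, and is natural because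
  both candidates for its value have the same images under the two legs.
\<close>
lemma separated_colim_square:
  assumes sep: separated
  shows "colim_square_cartesian C S T \<pi>"
proof -
  let ?FC = "functor_cat C set_cat" and ?\<Delta>S = "const_functor C set_cat (colim C S)"
    and ?\<Delta>T = "const_functor C set_cat (colim C T)"
  have univ: "\<exists>!w. w \<in> hom ?FC X S \<and> Comp ?FC (S, colim_inj C S, ?\<Delta>S) w = (X, \<mu>, ?\<Delta>S)
        \<and> Comp ?FC (S, \<pi>, T) w = (X, \<nu>, T)"
    if X: "is_functor C set_cat X" and \<mu>: "nat_trans C set_cat X ?\<Delta>S \<mu>" and \<nu>: "nat_trans C set_cat X T \<nu>"
      and eq: "(\<lambda>c\<in>Ob C. Comp set_cat ((\<lambda>_\<in>Ob C. colim_proj) c) (\<mu> c)) = (\<lambda>c\<in>Ob C. Comp set_cat (colim_inj C T c) (\<nu> c))"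
    for X \<mu> \<nu>
  proof -
    note \<mu>' = set_coconeD[OF C X \<mu>] and \<nu>' = set_nat_transD[OF \<nu>]
    have \<mu>'': "Dom set_cat (\<mu> c) = FO X c" if "c \<in> Ob C" for c
      using \<mu>'(1)[OF that] by (simp add: hom_def)
    have pb: "\<exists>!y. y \<in> elems (FO S c) \<and> ap (\<pi> c) y = ap (\<nu> c) x \<and> inS c y = ap (\<mu> c) x"
      if "c \<in> Ob C" "x \<in> elems (FO X c)" for c x
    proof (rule separated_ex1[OF sep that(1)])
      have "ap ((\<lambda>c\<in>Ob C. Comp set_cat ((\<lambda>_\<in>Ob C. colim_proj) c) (\<mu> c)) c) x
          = ap ((\<lambda>c\<in>Ob C. Comp set_cat (colim_inj C T c) (\<nu> c)) c) x"
        by (simp only: eq)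
      then show "ap colim_proj (ap (\<mu> c) x) = inT c (ap (\<nu> c) x)"
        using that by (simp add: ap_comp \<mu>'' \<nu>')
    qed (use that \<mu>' \<nu>' in auto)
    define k where "k c x = (THE y. y \<in> elems (FO S c) \<and> ap (\<pi> c) y = ap (\<nu> c) x \<and> inS c y = ap (\<mu> c) x)"
      for c x
    have k: "k c x \<in> elems (FO S c)" "ap (\<pi> c) (k c x) = ap (\<nu> c) x" "inS c (k c x) = ap (\<mu> c) x"
      if "c \<in> Ob C" "x \<in> elems (FO X c)" for c x
      using theI'[OF pb[OF that]] by (simp_all add: k_def)
    have k_eq: "k c x = y" if "c \<in> Ob C" "x \<in> elems (FO X c)" "y \<in> elems (FO S c)"
      "ap (\<pi> c) y = ap (\<nu> c) x" "inS c y = ap (\<mu> c) x" for c x y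
      using pb[OF that(1,2)] k[OF that(1,2)] that by blast
    define \<kappa> where "\<kappa> = (\<lambda>c\<in>Ob C. (FO X c, \<lambda>x\<in>elems (FO X c). k c x, FO S c))"
    have ap_\<kappa>: "ap (\<kappa> c) x = k c x" if "c \<in> Ob C" "x \<in> elems (FO X c)" for c x
      using that by (simp add: \<kappa>_def)
    have \<kappa>: "nat_trans C set_cat X S \<kappa>"
    proof (rule set_nat_transI[OF C X S])
      fix f x assume f: "f \<in> Ar C" "x \<in> elems (FO X (Dom C f))"
      then have "k (Cod C f) (ap (FA X f) x) = ap (FA S f) (k (Dom C f) x)"
        using set_functorD[OF X C] k[of "Dom C f" x] \<nu>'(5)[OF C X] \<mu>'(3) inS(3)
        by (intro k_eq) (simp_all add: C' S' \<pi>_natural)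
      then show "ap (FA S f) (ap (\<kappa> (Dom C f)) x) = ap (\<kappa> (Cod C f)) (ap (FA X f) x)"
        using f set_functorD[OF X C] by (simp add: ap_\<kappa> C')
    qed (use k in \<open>auto simp: \<kappa>_def hom_def\<close>)
    show ?thesis
    proof (rule ex1I[of _ "(X, \<kappa>, S)"])
      have "(\<lambda>c\<in>Ob C. Comp set_cat (colim_inj C S c) (\<kappa> c)) = \<mu>"
        by (rule nat_trans_eqI[OF nat_trans_comp[OF C X S is_functor_const[OF C] \<kappa> colim_nat_trans(1)] \<mu>])
          (simp add: ap_comp set_nat_transD[OF \<kappa>] ap_\<kappa> k)
      moreover have "(\<lambda>c\<in>Ob C. Comp set_cat (\<pi> c) (\<kappa> c)) = \<nu>"
        by (rule nat_trans_eqI[OF nat_trans_comp[OF C X S T \<kappa> \<pi>] \<nu>])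
          (simp add: ap_comp set_nat_transD[OF \<kappa>] ap_\<kappa> k)
      ultimately show "(X, \<kappa>, S) \<in> hom ?FC X S \<and> Comp ?FC (S, colim_inj C S, ?\<Delta>S) (X, \<kappa>, S) = (X, \<mu>, ?\<Delta>S)
          \<and> Comp ?FC (S, \<pi>, T) (X, \<kappa>, S) = (X, \<nu>, T)"
        using X S \<kappa> by (simp add: hom_def)
    next
      fix w assume w: "w \<in> hom ?FC X S \<and> Comp ?FC (S, colim_inj C S, ?\<Delta>S) w = (X, \<mu>, ?\<Delta>S)
          \<and> Comp ?FC (S, \<pi>, T) w = (X, \<nu>, T)"
      obtain X' \<rho> S' where "w = (X', \<rho>, S')" by (metis prod_cases3)
      with w have wr: "w = (X, \<rho>, S)" and \<rho>: "nat_trans C set_cat X S \<rho>"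
        and \<mu>_eq: "(\<lambda>c\<in>Ob C. Comp set_cat (colim_inj C S c) (\<rho> c)) = \<mu>"
        and \<nu>_eq: "(\<lambda>c\<in>Ob C. Comp set_cat (\<pi> c) (\<rho> c)) = \<nu>"
        by (auto simp: hom_def)
      have "\<kappa> = \<rho>"
      proof (rule nat_trans_eqI[OF \<kappa> \<rho>])
        fix c x assume cx: "c \<in> Ob C" "x \<in> elems (FO X c)"
        show "ap (\<kappa> c) x = ap (\<rho> c) x"
          unfolding ap_\<kappa>[OF cx]
          by (rule k_eq)
            (use cx set_nat_transD[OF \<rho>] arg_cong[OF \<mu>_eq, of "\<lambda>h. ap (h c) x"]
              arg_cong[OF \<nu>_eq, of "\<lambda>h. ap (h c) x"] in \<open>simp_all add: ap_comp\<close>)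
      qed
      with wr show "w = (X, \<kappa>, S)" by simp
    qed
  qed
  have comm: "(\<lambda>c\<in>Ob C. Comp set_cat ((\<lambda>_\<in>Ob C. colim_proj) c) (colim_inj C S c))
      = (\<lambda>c\<in>Ob C. Comp set_cat (colim_inj C T c) (\<pi> c))"
  proof (rule nat_trans_eqI)
    show "nat_trans C set_cat S ?\<Delta>T (\<lambda>c\<in>Ob C. Comp set_cat ((\<lambda>_\<in>Ob C. colim_proj) c) (colim_inj C S c))"
      by (rule nat_trans_comp[OF C S _ _ colim_nat_trans(1) colim_map_nat_trans]) (rule is_functor_const[OF C])+
    show "nat_trans C set_cat S ?\<Delta>T (\<lambda>c\<in>Ob C. Comp set_cat (colim_inj C T c) (\<pi> c))"
      by (rule nat_trans_comp[OF C S T _ \<pi> colim_nat_trans(2)]) (rule is_functor_const[OF C])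
    fix c x assume cx: "c \<in> Ob C" "x \<in> elems (FO S c)"
    then show "ap ((\<lambda>c\<in>Ob C. Comp set_cat ((\<lambda>_\<in>Ob C. colim_proj) c) (colim_inj C S c)) c) x
        = ap ((\<lambda>c\<in>Ob C. Comp set_cat (colim_inj C T c) (\<pi> c)) c) x"
      using set_nat_transD(1-3)[OF colim_nat_trans(1)] set_nat_transD(1-3)[OF \<pi>]
      by (simp add: ap_comp colim_proj(2))
  qed
  show ?thesis
    unfolding colim_square_cartesian_def Let_def pullback_square_def functor_cat_simps
  proof (intro conjI ballI impI; (elim conjE)?)
    fix u v assume uv: "u \<in> Ar ?FC" "v \<in> Ar ?FC" "Dom ?FC u = Dom ?FC v" "Cod ?FC u = ?\<Delta>S" "Cod ?FC v = T"
      and eq: "Comp ?FC (?\<Delta>S, \<lambda>_\<in>Ob C. colim_proj, ?\<Delta>T) u = Comp ?FC (T, colim_inj C T, ?\<Delta>T) v"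
    obtain X \<mu> Y X' \<nu> Y' where "u = (X, \<mu>, Y)" "v = (X', \<nu>, Y')" by (metis prod_cases3)
    with uv have *: "u = (X, \<mu>, ?\<Delta>S)" "v = (X, \<nu>, T)" "is_functor C set_cat X"
      "nat_trans C set_cat X ?\<Delta>S \<mu>" "nat_trans C set_cat X T \<nu>" by auto
    show "\<exists>!w. w \<in> hom ?FC (Dom ?FC u) S \<and> Comp ?FC (S, colim_inj C S, ?\<Delta>S) w = u
        \<and> Comp ?FC (S, \<pi>, T) w = v"
      using univ[OF *(3-5)] eq unfolding * functor_cat_simps by simp
  qed (use S T C \<pi> comm in \<open>simp_all add: is_functor_const colim_nat_trans colim_map_nat_trans\<close>)
qed

lemma colim_square_iff_separated: "colim_square_cartesian C S T \<pi> \<longleftrightarrow> separated"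
  using colim_square_separated separated_colim_square by blast

end


section \<open>Set-models of contextual categories\<close>

lemma set_iso_bij:
  assumes "iso_arrow set_cat h"
  shows "bij_betw (ap h) (elems (Dom set_cat h)) (elems (Cod set_cat h))"
proof -
  obtain k where h: "h \<in> Ar set_cat" and k: "k \<in> Ar set_cat" "Dom set_cat k = Cod set_cat h"
    "Cod set_cat k = Dom set_cat h" and eq: "Comp set_cat k h = Idn set_cat (Dom set_cat h)"
    "Comp set_cat h k = Idn set_cat (Cod set_cat h)"
    using assms unfolding iso_arrow_def hom_def by auto
  have "ap k (ap h x) = x" if "x \<in> elems (Dom set_cat h)" for x
    using ap_comp[OF that, of k] that by (simp add: eq)
  moreover have "ap h (ap k y) = y" if "y \<in> elems (Cod set_cat h)" for y
    using ap_comp[of y k h] that k by (simp add: eq)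
  ultimately show ?thesis
    by (intro bij_betw_byWitness[where f' = "ap k"]) (use h k set_arrow_ap in fastforce)+
qed

lemma set_isoI:
  assumes "h \<in> Ar set_cat" "bij_betw (ap h) (elems (Dom set_cat h)) (elems (Cod set_cat h))"
  shows "iso_arrow set_cat h"
proof -
  obtain A f B where h: "h = (A, f, B)" by (metis prod_cases3)
  then have f: "f \<in> elems A \<rightarrow>\<^sub>E elems B" "inj_on f (elems A)" "f ` elems A = elems B"
    using assms by (simp_all add: bij_betw_def)
  define k where "k = (\<lambda>y\<in>elems B. inv_into (elems A) f y)"
  have k: "k \<in> elems B \<rightarrow>\<^sub>E elems A" using f(3) by (auto simp: k_def inv_into_into)
  have "compose (elems A) k f = (\<lambda>x\<in>elems A. x)" "compose (elems B) f k = (\<lambda>y\<in>elems B. y)"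
    using f by (auto simp: k_def compose_def f_inv_into_f intro!: restrict_ext)
  then show ?thesis
    unfolding iso_arrow_def hom_def h using f k
    by (intro conjI bexI[of _ "(B, k, A)"]) simp_all
qed

lemma terminal_set_singleton:
  assumes "terminal set_cat t"
  obtains x where "elems t = {x}"
proof -
  obtain p :: 'a where p: "elems p = {undefined}" by (metis imageE range_elems_singleton)
  have ex1: "\<exists>!f. f \<in> hom set_cat p t" using assms unfolding terminal_def by simp
  then obtain f where f: "f \<in> hom set_cat p t" by blast
  have "y = ap f undefined" if "y \<in> elems t" for y
  proof -
    have "(p, \<lambda>_\<in>elems p. y, t) \<in> hom set_cat p t" using that by (auto simp: hom_def)
    then have "f = (p, \<lambda>_\<in>elems p. y, t)" using ex1 f by blast
    then show ?thesis by (simp add: p)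
  qed
  moreover have "ap f undefined \<in> elems t"
    using f set_arrow_ap[of f undefined] p by (auto simp: hom_def)
  ultimately have "elems t = {ap f undefined}" by blast
  then show thesis by (rule that)
qed

lemma small_set_subset:
  assumes "small_set U B" "A \<subseteq> B"
  shows "small_set U A"
proof -
  obtain x :: 'a and f where f: "bij_betw f (elems x) B" using assms(1) unfolding small_set_def by blast
  obtain z where z: "elems z = {i \<in> elems x. f i \<in> A}"
    using range_elems_subset[of "{i \<in> elems x. f i \<in> A}" x] by blast
  have "bij_betw f (elems z) A"
    unfolding z by (rule bij_betw_subset[OF f]) (use f assms(2) in \<open>auto simp: bij_betw_def\<close>)
  then show ?thesis unfolding small_set_def by blast
qed

lemma fam_cat_simps [simp]:
  "Ob fam_cat = fam_ob"
  "(Ys, f, Xs) \<in> Ar fam_cat \<longleftrightarrow> Ys \<in> fam_ob \<and> Xs \<in> fam_ob \<and> f \<in> elems (fam_total Ys) \<rightarrow>\<^sub>E elems (fam_total Xs)"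
  "Dom fam_cat (Ys, f, Xs) = Ys" "Cod fam_cat (Ys, f, Xs) = Xs"
  "Idn fam_cat Xs = (Xs, \<lambda>x\<in>elems (fam_total Xs). x, Xs)"
  "Comp fam_cat (Ys', g, Zs) (Xs, f, Ys) = (Xs, compose (elems (fam_total Xs)) g f, Zs)"
  "len fam_cat = length" "ft fam_cat = butlast"
  "disp fam_cat Xs = (Xs, \<lambda>z\<in>elems (fam_total Xs). vfst z, butlast Xs)"
  by (simp_all add: fam_cat_def)

lemma elems_fam_total_snoc:
  "elems (fam_total (Xs @ [X])) = {vpair x y | x y. x \<in> elems (fam_total Xs) \<and> y \<in> elems (X x)}"
  by (simp add: fam_total_def elems_vcoprod)

lemma elems_fam_total_Nil: "elems (fam_total []) = {mk_set {}}"
  by (simp add: fam_total_def elems_mk_set range_elems_singleton)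

locale contextual_model =
  fixes A :: "('o, 'm) ctx_cat"
    and F :: "('o, 'm, 'u::grothendieck_universe, 'u setmap) functr"
  assumes ctx: "contextual_category A"
    and small: "small_ctx_cat TYPE('u) A"
    and model: "set_model A F"
begin

lemma A: "category A"
  using ctx by (simp add: contextual_category_def)

lemma F: "is_functor A set_cat F"
  using model by (simp add: set_model_def)

lemmas A' = categoryD[OF A]
lemmas F' = functorD[OF F]
lemmas Fx = set_functorD[OF F A]

lemma ft: "a \<in> Ob A \<Longrightarrow> ft A a \<in> Ob A" "a \<in> Ob A \<Longrightarrow> len A (ft A a) = len A a - 1"
proof -
  assume a: "a \<in> Ob A"
  have *: "ft A a \<in> Ob A \<and> (1 \<le> len A a \<longrightarrow> len A (ft A a) = len A a - 1) \<and>
      (len A a = 0 \<longrightarrow> len A (ft A a) = 0)"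
    using ctx[unfolded contextual_category_def, THEN conjunct2, THEN conjunct1] a by blast
  then show "ft A a \<in> Ob A" by blast
  from * show "len A (ft A a) = len A a - 1" by (cases "len A a") auto
qed

lemma disp:
  assumes "a \<in> Ob A" "1 \<le> len A a"
  shows "disp A a \<in> Ar A" "Dom A (disp A a) = a" "Cod A (disp A a) = ft A a"
proof -
  have "disp A a \<in> hom A a (ft A a)"
    using ctx assms unfolding contextual_category_def by blast
  then show "disp A a \<in> Ar A" "Dom A (disp A a) = a" "Cod A (disp A a) = ft A a"
    by (auto simp: hom_def)
qed

lemma dsq:
  assumes "(f', f) \<in> dsq A"
  shows "f' \<in> Ar A" "f \<in> Ar A" "1 \<le> len A (Dom A f')" "1 \<le> len A (Cod A f')"
    "Dom A f = ft A (Dom A f')" "Cod A f = ft A (Cod A f')"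
    "Comp A (disp A (Cod A f')) f' = Comp A f (disp A (Dom A f'))"
proof -
  have "\<forall>(f', f)\<in>dsq A. f' \<in> Ar A \<and> f \<in> Ar A \<and> 1 \<le> len A (Dom A f') \<and> 1 \<le> len A (Cod A f') \<and>
      pullback_square A f' (disp A (Dom A f')) (disp A (Cod A f')) f"
    using ctx unfolding contextual_category_def by (elim conjE)
  with assms have *: "f' \<in> Ar A" "f \<in> Ar A" "1 \<le> len A (Dom A f')" "1 \<le> len A (Cod A f')"
    and pb: "pullback_square A f' (disp A (Dom A f')) (disp A (Cod A f')) f" by auto
  then show "f' \<in> Ar A" "f \<in> Ar A" "1 \<le> len A (Dom A f')" "1 \<le> len A (Cod A f')" by auto
  have "Cod A (disp A (Dom A f')) = Dom A f" "Cod A (disp A (Cod A f')) = Cod A f"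
    "Comp A (disp A (Cod A f')) f' = Comp A f (disp A (Dom A f'))"
    using pb unfolding pullback_square_def by auto
  then show "Dom A f = ft A (Dom A f')" "Cod A f = ft A (Cod A f')"
    "Comp A (disp A (Cod A f')) f' = Comp A f (disp A (Dom A f'))"
    using disp * A' by auto
qed

lemma dsq_comp:
  assumes "(f', f) \<in> dsq A" "(g', g) \<in> dsq A" "Cod A f' = Dom A g'"
  shows "(Comp A g' f', Comp A g f) \<in> dsq A"
proof -
  have "\<forall>(f', f)\<in>dsq A. \<forall>(g', g)\<in>dsq A. Cod A f' = Dom A g' \<longrightarrow> (Comp A g' f', Comp A g f) \<in> dsq A"
    using ctx unfolding contextual_category_def by (elim conjE)
  with assms show ?thesis by blast
qed

lemma dsq_idn: "a \<in> Ob A \<Longrightarrow> 1 \<le> len A a \<Longrightarrow> (Idn A a, Idn A (ft A a)) \<in> dsq A"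
  using ctx unfolding contextual_category_def by blast

lemma disp_cat_simps [simp]:
  "Ob (disp_cat A) = disp A ` {a \<in> Ob A. 1 \<le> len A a}" "Ar (disp_cat A) = dsq A"
  "Dom (disp_cat A) (f', f) = disp A (Dom A f')" "Cod (disp_cat A) (f', f) = disp A (Cod A f')"
  "Idn (disp_cat A) p = (Idn A (Dom A p), Idn A (Cod A p))"
  "Comp (disp_cat A) (g', g) (f', f) = (Comp A g' f', Comp A g f)"
  by (simp_all add: disp_cat_def)

lemma disp_inject:
  "a \<in> Ob A \<Longrightarrow> 1 \<le> len A a \<Longrightarrow> b \<in> Ob A \<Longrightarrow> 1 \<le> len A b \<Longrightarrow> disp A a = disp A b \<longleftrightarrow> a = b"
  by (metis disp(2))

lemma dsq_ob: "(f', f) \<in> dsq A \<Longrightarrow> Dom A f' \<in> Ob A" "(f', f) \<in> dsq A \<Longrightarrow> Cod A f' \<in> Ob A"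
  using dsq(1) A' by auto

lemma category_disp: "category (disp_cat A)"
  unfolding category_def hom_def
proof (intro conjI ballI impI)
  fix p assume "p \<in> Ob (disp_cat A)"
  then show "Idn (disp_cat A) p \<in> {f \<in> Ar (disp_cat A). Dom (disp_cat A) f = p \<and> Cod (disp_cat A) f = p}"
    by (auto simp: disp A' dsq_idn)
next
  fix s assume "s \<in> Ar (disp_cat A)"
  then obtain f' f where s: "s = (f', f)" "(f', f) \<in> dsq A" by (cases s) auto
  note f = dsq[OF s(2)] dsq_ob[OF s(2)]
  show "Dom (disp_cat A) s \<in> Ob (disp_cat A)" "Cod (disp_cat A) s \<in> Ob (disp_cat A)"
    using s f by auto
  show "Comp (disp_cat A) s (Idn (disp_cat A) (Dom (disp_cat A) s)) = s"
    "Comp (disp_cat A) (Idn (disp_cat A) (Cod (disp_cat A) s)) s = s"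
    using s f A'(9)[of f'] A'(9)[of f] A'(10)[of f'] A'(10)[of f] by (simp_all add: disp)
  fix t assume "t \<in> Ar (disp_cat A)" "Cod (disp_cat A) s = Dom (disp_cat A) t"
  then obtain g' g where t: "t = (g', g)" "(g', g) \<in> dsq A" "disp A (Cod A f') = disp A (Dom A g')"
    using s by (cases t) auto
  note g = dsq[OF t(2)] dsq_ob[OF t(2)]
  have fg: "Cod A f' = Dom A g'" using t(3) f g disp_inject by blast
  show "Comp (disp_cat A) t s \<in> {h \<in> Ar (disp_cat A). Dom (disp_cat A) h = Dom (disp_cat A) s \<and>
      Cod (disp_cat A) h = Cod (disp_cat A) t}"
    using s t f g fg dsq_comp[OF s(2) t(2) fg] by (simp add: A')
  fix u assume "u \<in> Ar (disp_cat A)" "Cod (disp_cat A) t = Dom (disp_cat A) u"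
  then obtain h' h where u: "u = (h', h)" "(h', h) \<in> dsq A" "disp A (Cod A g') = disp A (Dom A h')"
    using t by (cases u) auto
  note h = dsq[OF u(2)] dsq_ob[OF u(2)]
  have gh: "Cod A g' = Dom A h'" using u(3) g h disp_inject by blast
  show "Comp (disp_cat A) u (Comp (disp_cat A) t s) = Comp (disp_cat A) (Comp (disp_cat A) u t) s"
    using s t u f g h fg gh A'(11)[of f' g' h'] A'(11)[of f g h] by simp
qed

lemma model_simps [simp]:
  "a \<in> Ob A \<Longrightarrow> 1 \<le> len A a \<Longrightarrow> FO (model_src A F) (disp A a) = FO F a"
  "a \<in> Ob A \<Longrightarrow> 1 \<le> len A a \<Longrightarrow> FO (model_tgt A F) (disp A a) = FO F (ft A a)"
  "a \<in> Ob A \<Longrightarrow> 1 \<le> len A a \<Longrightarrow> model_proj A F (disp A a) = FA F (disp A a)"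
  "(f', f) \<in> dsq A \<Longrightarrow> FA (model_src A F) (f', f) = FA F f'"
  "(f', f) \<in> dsq A \<Longrightarrow> FA (model_tgt A F) (f', f) = FA F f"
  by (simp_all add: model_src_def model_tgt_def model_proj_def disp)

lemma is_functor_src: "is_functor (disp_cat A) set_cat (model_src A F)"
  unfolding model_src_def
proof (rule is_functor_mk_functor[OF category_disp])
  fix s t assume "s \<in> Ar (disp_cat A)" "t \<in> Ar (disp_cat A)" "Cod (disp_cat A) s = Dom (disp_cat A) t"
  moreover obtain f' f g' g where "s = (f', f)" "t = (g', g)" by (cases s; cases t)
  ultimately show "(case Comp (disp_cat A) t s of (f', f) \<Rightarrow> FA F f')
      = Comp set_cat (case t of (f', f) \<Rightarrow> FA F f') (case s of (f', f) \<Rightarrow> FA F f')"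
    using dsq dsq_ob disp_inject by (simp add: F')
qed (use dsq dsq_ob in \<open>auto simp: disp F' simp del: set_cat_simps(5)\<close>)

lemma is_functor_tgt: "is_functor (disp_cat A) set_cat (model_tgt A F)"
  unfolding model_tgt_def
proof (rule is_functor_mk_functor[OF category_disp])
  fix s t assume "s \<in> Ar (disp_cat A)" "t \<in> Ar (disp_cat A)" "Cod (disp_cat A) s = Dom (disp_cat A) t"
  moreover obtain f' f g' g where "s = (f', f)" "t = (g', g)" by (cases s; cases t)
  ultimately show "(case Comp (disp_cat A) t s of (f', f) \<Rightarrow> FA F f)
      = Comp set_cat (case t of (f', f) \<Rightarrow> FA F f) (case s of (f', f) \<Rightarrow> FA F f)"
    using dsq dsq_ob disp_inject by (simp add: F')
qed (use dsq dsq_ob in \<open>auto simp: disp ft F' simp del: set_cat_simps(5)\<close>)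

lemma model_square:
  assumes "(f', f) \<in> dsq A" "y \<in> elems (FO F (Dom A f'))"
  shows "ap (FA F (disp A (Cod A f'))) (ap (FA F f') y) = ap (FA F f) (ap (FA F (disp A (Dom A f'))) y)"
proof -
  note f = dsq[OF assms(1)] dsq_ob[OF assms(1)]
  have "ap (FA F (Comp A (disp A (Cod A f')) f')) y = ap (FA F (Comp A f (disp A (Dom A f')))) y"
    by (simp only: f(7))
  then show ?thesis using f(1-6,8,9) assms(2) by (simp add: Fx disp)
qed

lemma is_nat_trans_proj:
  "nat_trans (disp_cat A) set_cat (model_src A F) (model_tgt A F) (model_proj A F)"
proof (rule set_nat_transI[OF category_disp is_functor_src is_functor_tgt])
  fix s y assume "s \<in> Ar (disp_cat A)" "y \<in> elems (FO (model_src A F) (Dom (disp_cat A) s))"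
  moreover obtain f' f where "s = (f', f)" by (cases s)
  ultimately show "ap (FA (model_tgt A F) s) (ap (model_proj A F (Dom (disp_cat A) s)) y)
      = ap (model_proj A F (Cod (disp_cat A) s)) (ap (FA (model_src A F) s) y)"
    using dsq dsq_ob model_square by simp
qed (auto simp: model_proj_def[THEN arg_cong, of "\<lambda>x. x \<in> _"] hom_def F' disp)

lemma proj_cartesian:
  assumes "s \<in> Ar (disp_cat A)" "x \<in> elems (FO (model_tgt A F) (Dom (disp_cat A) s))"
    "y \<in> elems (FO (model_src A F) (Cod (disp_cat A) s))"
    "ap (model_proj A F (Cod (disp_cat A) s)) y = ap (FA (model_tgt A F) s) x"
  shows "\<exists>!z. z \<in> elems (FO (model_src A F) (Dom (disp_cat A) s)) \<and>
    ap (model_proj A F (Dom (disp_cat A) s)) z = x \<and> ap (FA (model_src A F) s) z = y"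
proof -
  obtain f' f where s: "s = (f', f)" "(f', f) \<in> dsq A" using assms(1) by (cases s) auto
  note f = dsq[OF s(2)] dsq_ob[OF s(2)]
  have "\<forall>(f', f)\<in>dsq A. pullback_square set_cat
        (FA F f') (FA F (disp A (Dom A f'))) (FA F (disp A (Cod A f'))) (FA F f)"
    using model unfolding set_model_def by (elim conjE)
  with s(2) have "pullback_square set_cat
        (FA F f') (FA F (disp A (Dom A f'))) (FA F (disp A (Cod A f'))) (FA F f)" by blast
  from set_pullbackD[OF this, of y x] show ?thesis
    using assms s f by (simp add: F' disp conj_commute)
qed

sublocale D: small_cartesian_transformation "disp_cat A" "model_src A F" "model_tgt A F" "model_proj A F"
proof
  show "small_set TYPE('u) (Ob (disp_cat A))"
    by (rule small_set_subset[of _ "Ar A"]) (use small disp in \<open>auto simp: small_ctx_cat_def\<close>)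
qed (fact category_disp is_functor_src is_functor_tgt is_nat_trans_proj proj_cartesian)+


section \<open>Strict models are loop-free\<close>

text \<open>
  Transfer the points of a strictifiable model to the total sets of the strict model, where they are
  pairs of a point of the base and a label. Strict pullback in families changes the base point only,
  so the label, the second component, is constant along distinguished squares, hence along zigzags.
  Points of one fiber also have the same first component, so if they are connected they are equal.
\<close>
lemma strictifiable_separated:
  assumes "strictifiable A F"
  shows D.separated
proof -
  obtain G \<eta> where G: "strict_morphism A fam_cat G"
    and \<eta>: "nat_trans A set_cat (functor_comp A fam_total_functor G) F \<eta>"
    and iso: "\<And>a. a \<in> Ob A \<Longrightarrow> iso_arrow set_cat (\<eta> a)"
    using assms unfolding strictifiable_def naturally_isomorphic_def by blast
  have Gf: "is_functor A fam_cat G" using G by (simp add: strict_morphism_def)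
  note G' = functorD[OF Gf]
  define tot where "tot a = elems (fam_total (FO G a))" for a
  define g where "g f = fst (snd (FA G f))" for f
  have G_arr: "FA G f = (FO G (Dom A f), g f, FO G (Cod A f))" if "f \<in> Ar A" for f
    using G'(3)[OF that] G'(4)[OF that] by (cases "FA G f") (auto simp: g_def)
  have \<eta>_ob: "Dom set_cat (\<eta> a) = fam_total (FO G a)" "Cod set_cat (\<eta> a) = FO F a" if "a \<in> Ob A" for a
    using set_nat_transD(2,3)[OF \<eta> that] that G'(1)[OF that] by (simp_all add: fam_total_functor_def)
  have bij: "bij_betw (ap (\<eta> a)) (tot a) (elems (FO F a))" if "a \<in> Ob A" for a
    using set_iso_bij[OF iso[OF that]] \<eta>_ob[OF that] by (simp add: tot_def)
  have g_in: "g f z \<in> tot (Cod A f)" if "f \<in> Ar A" "z \<in> tot (Dom A f)" for f z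
    using G'(2)[OF that(1)] that(2) unfolding G_arr[OF that(1)] by (auto simp: tot_def)
  have nat: "ap (\<eta> (Cod A f)) (g f z) = ap (FA F f) (ap (\<eta> (Dom A f)) z)"
    if f: "f \<in> Ar A" and z: "z \<in> tot (Dom A f)" for f z
  proof -
    have "Comp set_cat (FA F f) (\<eta> (Dom A f)) = Comp set_cat (\<eta> (Cod A f)) (FA (functor_comp A fam_total_functor G) f)"
      using \<eta> f unfolding nat_trans_def by blast
    moreover have "FA (functor_comp A fam_total_functor G) f
        = (fam_total (FO G (Dom A f)), g f, fam_total (FO G (Cod A f)))"
      using f G'(2)[OF f] by (simp add: fam_total_functor_def G_arr)
    ultimately have "ap (Comp set_cat (FA F f) (\<eta> (Dom A f))) z
        = ap (Comp set_cat (\<eta> (Cod A f)) (fam_total (FO G (Dom A f)), g f, fam_total (FO G (Cod A f)))) z"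
      by simp
    then show ?thesis using z f by (simp add: ap_comp \<eta>_ob A' tot_def)
  qed
  define \<theta> where "\<theta> a = inv_into (tot a) (ap (\<eta> a))" for a
  have \<theta>: "\<theta> a y \<in> tot a" "ap (\<eta> a) (\<theta> a y) = y" if "a \<in> Ob A" "y \<in> elems (FO F a)" for a y
    using bij[OF that(1)] that(2) by (auto simp: \<theta>_def bij_betw_def inv_into_into f_inv_into_f)
  have \<theta>_nat: "\<theta> (Cod A f) (ap (FA F f) y) = g f (\<theta> (Dom A f) y)"
    if f: "f \<in> Ar A" and y: "y \<in> elems (FO F (Dom A f))" for f y
  proof -
    have z: "\<theta> (Dom A f) y \<in> tot (Dom A f)" "ap (\<eta> (Dom A f)) (\<theta> (Dom A f) y) = y"
      using \<theta> f y A' by auto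
    have "ap (\<eta> (Cod A f)) (g f (\<theta> (Dom A f) y)) = ap (FA F f) y"
      using nat[OF f z(1)] z(2) by simp
    then show ?thesis
      using bij[of "Cod A f"] g_in[OF f z(1)] f A' unfolding \<theta>_def
      by (metis bij_betw_def inv_into_f_f)
  qed
  have snd_inv: "vsnd (g f' z) = vsnd z" if s: "(f', f) \<in> dsq A" and z: "z \<in> tot (Dom A f')" for f' f z
  proof -
    have "(FA G f', FA G f) \<in> dsq fam_cat" using G s unfolding strict_morphism_def by blast
    then obtain Ys k Xs X where "FA G f' = (fam_reindex Ys k X, fam_lift Ys k X, Xs @ [X])"
      unfolding fam_cat_def by auto
    then have "g f' = fam_lift Ys k X" "tot (Dom A f') = elems (fam_total (fam_reindex Ys k X))"
      using G_arr[OF dsq(1)[OF s]] by (simp_all add: tot_def)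
    with z show ?thesis by (simp add: fam_lift_def)
  qed
  have fst_eq: "\<theta> (ft A a) (ap (FA F (disp A a)) y) = vfst (\<theta> a y)"
    if a: "a \<in> Ob A" "1 \<le> len A a" and y: "y \<in> elems (FO F a)" for a y
  proof -
    have "FA G (disp A a) = disp fam_cat (FO G a)" using G a unfolding strict_morphism_def by blast
    then have "g (disp A a) = (\<lambda>z\<in>tot a. vfst z)" by (simp add: g_def tot_def)
    then show ?thesis using \<theta>_nat[of "disp A a" y] a y \<theta>(1)[OF a(1) y] by (simp add: disp)
  qed
  have eq: "y = y'" if a: "a \<in> Ob A" "1 \<le> len A a" and y: "y \<in> elems (FO F a)" "y' \<in> elems (FO F a)"
    and fst: "ap (FA F (disp A a)) y = ap (FA F (disp A a)) y'" and snd: "vsnd (\<theta> a y) = vsnd (\<theta> a y')"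
    for a y y'
  proof -
    have "length (FO G a) = len A a" using G a unfolding strict_morphism_def by simp
    then obtain Xs X where "FO G a = Xs @ [X]" using a(2) by (cases "FO G a" rule: rev_cases) auto
    then have "\<exists>x l. z = vpair x l" if "z \<in> tot a" for z
      using that by (auto simp: tot_def elems_fam_total_snoc)
    then obtain x l x' l' where "\<theta> a y = vpair x l" "\<theta> a y' = vpair x' l'"
      using \<theta>(1)[OF a(1)] y by metis
    moreover have "vfst (\<theta> a y) = vfst (\<theta> a y')" using fst_eq[OF a] y fst by metis
    ultimately have "\<theta> a y = \<theta> a y'" using snd by simp
    then show ?thesis using \<theta>(2)[OF a(1)] y by metis
  qed
  show ?thesis
    unfolding D.separated_def
  proof (intro allI impI, elim conjE)
    fix c y y' w assume w: "zigzag D.ES (c, y) w (c, y')"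
      and proj_eq: "ap (model_proj A F c) y = ap (model_proj A F c) y'"
    from zigzag_ends[OF D.ES w] obtain a where a: "a \<in> Ob A" "1 \<le> len A a" "c = disp A a"
      and y: "y \<in> elems (FO F a)" "y' \<in> elems (FO F a)" by auto
    define k where "k = (\<lambda>(p, y). vsnd (\<theta> (Dom A p) y))"
    have "(c, y') \<in> component D.ES (c, y)"
      using w component_zigzag[OF D.ES zigzag_ends(1)[OF D.ES w]] by blast
    then have "k (c, y') = k (c, y)"
    proof (rule component_invariant)
      fix e assume "e \<in> Ar D.ES"
      then obtain f' f x where e: "e = ((f', f), x)" "(f', f) \<in> dsq A" "x \<in> elems (FO F (Dom A f'))"
        using dsq dsq_ob by (cases e) auto
      note f = dsq[OF e(2)] dsq_ob[OF e(2)]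
      have "vsnd (\<theta> (Cod A f') (ap (FA F f') x)) = vsnd (\<theta> (Dom A f') x)"
        using \<theta>_nat[OF f(1) e(3)] snd_inv[OF e(2) \<theta>(1)[OF f(8) e(3)]] by simp
      then show "k (Dom D.ES e) = k (Cod D.ES e)"
        using e f by (simp add: k_def disp)
    qed
    then have "vsnd (\<theta> a y) = vsnd (\<theta> a y')" using a by (simp add: k_def disp)
    then show "y = y'" using eq[OF a(1,2) y] proj_eq a by simp
  qed
qed


section \<open>Strictification of a loop-free model\<close>

text \<open>
  The label of a point is its class in the colimit of the sources. By separation the points of a
  fiber are distinguished by their labels, and the labels that occur over a point of the base are
  those that the comparison of colimits sends to the class of that point. These sets depend on the
  class of the point only, and are therefore strictly invariant under distinguished squares, which
  is what a strict morphism into families demands.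
\<close>

definition labelled :: "'o \<Rightarrow> 'u \<Rightarrow> 'u \<Rightarrow> 'u" where
  "labelled a x l =
    (THE y. y \<in> elems (FO F a) \<and> ap (FA F (disp A a)) y = x \<and> D.inS (disp A a) y = l)"

definition labels :: "'o \<Rightarrow> 'u \<Rightarrow> 'u" where
  "labels a x = mk_set {l \<in> elems (colim (disp_cat A) (model_src A F)). ap D.colim_proj l = D.inT (disp A a) x}"

text \<open>
  Recursion on the length of a context: the sequence of families representing it, together with the
  comparison of its total set with the given model. In length 0 the model has exactly one point.
\<close>
primrec strictify :: "nat \<Rightarrow> 'o \<Rightarrow> ('u \<Rightarrow> 'u) list \<times> ('u \<Rightarrow> 'u)" where
  "strictify 0 a = ([], \<lambda>_. THE x. x \<in> elems (FO F a))"
| "strictify (Suc n) a =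
    (let (Xs, \<theta>) = strictify n (ft A a)
     in (Xs @ [\<lambda>z\<in>elems (fam_total Xs). labels a (\<theta> z)], \<lambda>z. labelled a (\<theta> (vfst z)) (vsnd z)))"

definition "strict_ob a = fst (strictify (len A a) a)"
definition "realize a = snd (strictify (len A a) a)"
abbreviation "tot a \<equiv> elems (fam_total (strict_ob a))"
definition "fam a = (\<lambda>z\<in>tot (ft A a). labels a (realize (ft A a) z))"

lemma strict_len0: "len A a = 0 \<Longrightarrow> strict_ob a = [] \<and> realize a = (\<lambda>_. THE x. x \<in> elems (FO F a))"
  by (simp add: strict_ob_def realize_def)

lemma strict_step:
  assumes "a \<in> Ob A" "1 \<le> len A a"
  shows "strict_ob a = strict_ob (ft A a) @ [fam a]"
    "realize a z = labelled a (realize (ft A a) (vfst z)) (vsnd z)"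
proof -
  obtain n where n: "len A a = Suc n" using assms(2) by (cases "len A a") auto
  then have "len A (ft A a) = n" using ft[OF assms(1)] by simp
  with n show "strict_ob a = strict_ob (ft A a) @ [fam a]"
    "realize a z = labelled a (realize (ft A a) (vfst z)) (vsnd z)"
    by (simp_all add: strict_ob_def realize_def fam_def split_beta)
qed

lemma elems_labels:
  "elems (labels a x) = {l \<in> elems (colim (disp_cat A) (model_src A F)). ap D.colim_proj l = D.inT (disp A a) x}"
  unfolding labels_def by (rule elems_mk_set, rule range_elems_subset) auto

lemma strict_ob_fam: "a \<in> Ob A \<Longrightarrow> strict_ob a \<in> fam_ob \<and> length (strict_ob a) = len A a"
proof (induction "len A a" arbitrary: a)
  case 0
  then show ?case by (simp add: strict_len0 fam_ob_Nil)
next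
  case (Suc n)
  then have a: "a \<in> Ob A" "1 \<le> len A a" by auto
  have "strict_ob (ft A a) \<in> fam_ob \<and> length (strict_ob (ft A a)) = len A (ft A a)"
    by (rule Suc.hyps(1)) (use Suc ft[of a] in auto)
  then show ?case
    using ft(2)[OF a(1)] a(2) unfolding strict_step(1)[OF a]
    by (auto intro!: fam_ob_snoc simp: fam_def)
qed

lemma tot_step:
  assumes "a \<in> Ob A" "1 \<le> len A a"
  shows "tot a = {vpair x l | x l. x \<in> tot (ft A a) \<and> l \<in> elems (labels a (realize (ft A a) x))}"
  unfolding strict_step(1)[OF assms] elems_fam_total_snoc by (auto simp: fam_def)

context
  assumes sep: D.separated
begin

lemma labelled:
  assumes a: "a \<in> Ob A" "1 \<le> len A a" and x: "x \<in> elems (FO F (ft A a))" and l: "l \<in> elems (labels a x)"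
  shows "labelled a x l \<in> elems (FO F a)" "ap (FA F (disp A a)) (labelled a x l) = x"
    "D.inS (disp A a) (labelled a x l) = l"
    "y \<in> elems (FO F a) \<Longrightarrow> ap (FA F (disp A a)) y = x \<Longrightarrow> D.inS (disp A a) y = l \<Longrightarrow> labelled a x l = y"
proof -
  have "\<exists>!y. y \<in> elems (FO F a) \<and> ap (FA F (disp A a)) y = x \<and> D.inS (disp A a) y = l"
    using D.separated_ex1[OF sep, of "disp A a" l x] a x l by (simp add: elems_labels)
  note ex1 = this
  show "labelled a x l \<in> elems (FO F a)" "ap (FA F (disp A a)) (labelled a x l) = x"
    "D.inS (disp A a) (labelled a x l) = l"
    using theI'[OF ex1] by (simp_all add: labelled_def)
  show "y \<in> elems (FO F a) \<Longrightarrow> ap (FA F (disp A a)) y = x \<Longrightarrow> D.inS (disp A a) y = l \<Longrightarrow> labelled a x l = y"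
    unfolding labelled_def by (rule the1_equality[OF ex1]) simp
qed

lemma inS_labels:
  assumes "a \<in> Ob A" "1 \<le> len A a" "y \<in> elems (FO F a)"
  shows "D.inS (disp A a) y \<in> elems (labels a (ap (FA F (disp A a)) y))"
  using assms D.inS(2)[of "disp A a" y] D.colim_proj(2)[of "disp A a" y] by (simp add: elems_labels)

lemma realize_bij: "a \<in> Ob A \<Longrightarrow> bij_betw (realize a) (tot a) (elems (FO F a))"
proof (induction "len A a" arbitrary: a)
  case 0
  then have "terminal set_cat (FO F a)" using model unfolding set_model_def by simp
  then obtain x where "elems (FO F a) = {x}" by (rule terminal_set_singleton)
  then show ?case using 0 by (simp add: strict_len0 elems_fam_total_Nil bij_betw_def)
next
  case (Suc n)
  then have a: "a \<in> Ob A" "1 \<le> len A a" by auto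
  have IH: "bij_betw (realize (ft A a)) (tot (ft A a)) (elems (FO F (ft A a)))"
    by (rule Suc.hyps(1)) (use Suc ft[of a] in auto)
  have IH_in: "realize (ft A a) x \<in> elems (FO F (ft A a))" if "x \<in> tot (ft A a)" for x
    using IH that by (auto simp: bij_betw_def)
  note lab = labelled[OF a IH_in]
  show ?case unfolding bij_betw_def
  proof
    show "inj_on (realize a) (tot a)"
    proof (rule inj_onI)
      fix z z' assume "z \<in> tot a" "z' \<in> tot a" and eq: "realize a z = realize a z'"
      then obtain x l x' l' where z: "z = vpair x l" "x \<in> tot (ft A a)" "l \<in> elems (labels a (realize (ft A a) x))"
        and z': "z' = vpair x' l'" "x' \<in> tot (ft A a)" "l' \<in> elems (labels a (realize (ft A a) x'))"
        unfolding tot_step[OF a] by auto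
      from eq have eq': "labelled a (realize (ft A a) x) l = labelled a (realize (ft A a) x') l'"
        by (simp add: strict_step(2)[OF a] z z')
      have "realize (ft A a) x = realize (ft A a) x'"
        using lab(2)[OF z(2,3)] lab(2)[OF z'(2,3)] eq' by simp
      then have "x = x'" using IH z(2) z'(2) by (auto simp: bij_betw_def inj_on_def)
      moreover have "l = l'" using lab(3)[OF z(2,3)] lab(3)[OF z'(2,3)] eq' by simp
      ultimately show "z = z'" using z z' by simp
    qed
    show "realize a ` tot a = elems (FO F a)"
    proof (intro equalityI subsetI)
      fix y assume "y \<in> realize a ` tot a"
      then show "y \<in> elems (FO F a)"
        unfolding tot_step[OF a] by (auto simp: strict_step(2)[OF a] lab(1))
    next
      fix y assume y: "y \<in> elems (FO F a)"
      then have "ap (FA F (disp A a)) y \<in> elems (FO F (ft A a))"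
        using Fx(1)[of "disp A a" y] a by (simp add: disp)
      then obtain x where x: "x \<in> tot (ft A a)" "realize (ft A a) x = ap (FA F (disp A a)) y"
        using IH by (metis bij_betw_def imageE)
      define z where "z = vpair x (D.inS (disp A a) y)"
      have l: "D.inS (disp A a) y \<in> elems (labels a (realize (ft A a) x))"
        using inS_labels[OF a y] x(2) by simp
      have "z \<in> tot a" unfolding tot_step[OF a] z_def using x l by blast
      moreover have "realize a z = y"
        unfolding strict_step(2)[OF a] z_def using lab(4)[OF x(1) l y] x(2) by simp
      ultimately show "y \<in> realize a ` tot a" by blast
    qed
  qed
qed

lemma realize_in: "a \<in> Ob A \<Longrightarrow> z \<in> tot a \<Longrightarrow> realize a z \<in> elems (FO F a)"
  using realize_bij by (auto simp: bij_betw_def)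

lemma realize_inject: "a \<in> Ob A \<Longrightarrow> z \<in> tot a \<Longrightarrow> z' \<in> tot a \<Longrightarrow> realize a z = realize a z' \<Longrightarrow> z = z'"
  using realize_bij by (auto simp: bij_betw_def inj_on_def)

lemma realize_step:
  assumes a: "a \<in> Ob A" "1 \<le> len A a" and z: "z \<in> tot a"
  shows "vfst z \<in> tot (ft A a)" "vsnd z \<in> elems (labels a (realize (ft A a) (vfst z)))"
    "ap (FA F (disp A a)) (realize a z) = realize (ft A a) (vfst z)"
    "D.inS (disp A a) (realize a z) = vsnd z"
proof -
  show 1: "vfst z \<in> tot (ft A a)" and 2: "vsnd z \<in> elems (labels a (realize (ft A a) (vfst z)))"
    using z unfolding tot_step[OF a] by auto
  note lab = labelled[OF a realize_in[OF ft(1)[OF a(1)] 1] 2]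
  show "ap (FA F (disp A a)) (realize a z) = realize (ft A a) (vfst z)"
    "D.inS (disp A a) (realize a z) = vsnd z"
    unfolding strict_step(2)[OF a] by (rule lab)+
qed

definition strict_fun :: "'m \<Rightarrow> 'u \<Rightarrow> 'u" where
  "strict_fun f = (\<lambda>z\<in>tot (Dom A f). inv_into (tot (Cod A f)) (realize (Cod A f))
    (ap (FA F f) (realize (Dom A f) z)))"

lemma strict_fun:
  assumes f: "f \<in> Ar A" and z: "z \<in> tot (Dom A f)"
  shows "strict_fun f z \<in> tot (Cod A f)"
    "realize (Cod A f) (strict_fun f z) = ap (FA F f) (realize (Dom A f) z)"
proof -
  have "ap (FA F f) (realize (Dom A f) z) \<in> realize (Cod A f) ` tot (Cod A f)"
    using realize_bij[of "Cod A f"] f z by (simp add: bij_betw_def A' Fx realize_in)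
  then show "strict_fun f z \<in> tot (Cod A f)"
    "realize (Cod A f) (strict_fun f z) = ap (FA F f) (realize (Dom A f) z)"
    using z by (simp_all add: strict_fun_def inv_into_into f_inv_into_f)
qed

lemma strict_fun_eq:
  assumes "f \<in> Ar A" "z \<in> tot (Dom A f)" "z' \<in> tot (Cod A f)"
    "realize (Cod A f) z' = ap (FA F f) (realize (Dom A f) z)"
  shows "strict_fun f z = z'"
  by (rule realize_inject[of "Cod A f"]) (use assms strict_fun A' in auto)

definition "strict_functor = mk_functor A strict_ob (\<lambda>f. (strict_ob (Dom A f), strict_fun f, strict_ob (Cod A f)))"

lemma is_functor_strict: "is_functor A fam_cat strict_functor"
  unfolding strict_functor_def
proof (rule is_functor_mk_functor[OF A])
  fix f assume f: "f \<in> Ar A"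
  show "(strict_ob (Dom A f), strict_fun f, strict_ob (Cod A f)) \<in> Ar fam_cat"
    using f strict_ob_fam strict_fun by (auto simp: A') (simp add: strict_fun_def)
next
  fix a assume a: "a \<in> Ob A"
  have "strict_fun (Idn A a) = (\<lambda>x\<in>tot a. x)"
  proof (rule extensionalityI[of _ "tot a"])
    fix z assume "z \<in> tot a"
    then show "strict_fun (Idn A a) z = (\<lambda>x\<in>tot a. x) z"
      using a by (simp, intro strict_fun_eq) (simp_all add: A' Fx realize_in)
  qed (use a in \<open>simp_all add: strict_fun_def A'\<close>)
  then show "(strict_ob (Dom A (Idn A a)), strict_fun (Idn A a), strict_ob (Cod A (Idn A a)))
      = Idn fam_cat (strict_ob a)"
    using a by (simp add: A')
next
  fix f g assume fg: "f \<in> Ar A" "g \<in> Ar A" "Cod A f = Dom A g"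
  have "strict_fun (Comp A g f) = compose (tot (Dom A f)) (strict_fun g) (strict_fun f)"
  proof (rule extensionalityI[of _ "tot (Dom A f)"])
    fix z assume z: "z \<in> tot (Dom A f)"
    then show "strict_fun (Comp A g f) z = compose (tot (Dom A f)) (strict_fun g) (strict_fun f) z"
      using fg strict_fun[OF fg(1) z] by (simp add: compose_def, intro strict_fun_eq)
        (simp_all add: A' Fx realize_in strict_fun)
  qed (use fg in \<open>simp_all add: strict_fun_def A' compose_def\<close>)
  then show "(strict_ob (Dom A (Comp A g f)), strict_fun (Comp A g f), strict_ob (Cod A (Comp A g f)))
      = Comp fam_cat (strict_ob (Dom A g), strict_fun g, strict_ob (Cod A g))
          (strict_ob (Dom A f), strict_fun f, strict_ob (Cod A f))"
    using fg by (simp add: A')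
qed (use strict_ob_fam in simp_all)

lemma strict_disp:
  assumes a: "a \<in> Ob A" "1 \<le> len A a"
  shows "strict_fun (disp A a) = (\<lambda>z\<in>tot a. vfst z)"
proof (rule extensionalityI[of _ "tot a"])
  fix z assume z: "z \<in> tot a"
  then show "strict_fun (disp A a) z = (\<lambda>z\<in>tot a. vfst z) z"
    using realize_step[OF a z] a by (simp, intro strict_fun_eq) (simp_all add: disp)
qed (use a in \<open>simp_all add: strict_fun_def disp\<close>)

text \<open>
  The component of the universal cocone at the base is invariant along a distinguished square;
  therefore the families at its two ends agree on the nose after reindexing.
\<close>
lemma strict_labels:
  assumes s: "(f', f) \<in> dsq A" and z: "z \<in> tot (Dom A f)"
  shows "labels (Cod A f') (realize (Cod A f) (strict_fun f z)) = labels (Dom A f') (realize (Dom A f) z)"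
proof -
  note f = dsq[OF s] dsq_ob[OF s]
  have "realize (Dom A f) z \<in> elems (FO F (ft A (Dom A f')))"
    using realize_in[of "Dom A f" z] f z by (simp add: ft)
  then have "D.inT (disp A (Cod A f')) (ap (FA F f) (realize (Dom A f) z))
      = D.inT (disp A (Dom A f')) (realize (Dom A f) z)"
    using D.inT(3)[of "(f', f)" "realize (Dom A f) z"] s f by simp
  then show ?thesis by (simp only: labels_def strict_fun(2)[OF f(2) z])
qed

text \<open>
  Only equality of arrows is at stake, since the comparison maps are injective. The sides agree by
  \<open>strict_labels\<close>; the top arrow preserves labels because it belongs to the cocone of sources.
\<close>
lemma strict_dsq:
  assumes s: "(f', f) \<in> dsq A"
  shows "((strict_ob (Dom A f'), strict_fun f', strict_ob (Cod A f')),
    (strict_ob (Dom A f), strict_fun f, strict_ob (Cod A f))) \<in> dsq fam_cat"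
proof -
  note f = dsq[OF s] dsq_ob[OF s]
  define a b where "a = Dom A f'" and "b = Cod A f'"
  have a: "a \<in> Ob A" "1 \<le> len A a" and b: "b \<in> Ob A" "1 \<le> len A b" using f by (auto simp: a_def b_def)
  have fab: "Dom A f = ft A a" "Cod A f = ft A b" using f by (auto simp: a_def b_def)
  let ?Ys = "strict_ob (ft A a)"
  have "compose (tot (ft A a)) (fam b) (strict_fun f) = fam a"
  proof (rule extensionalityI[of _ "tot (ft A a)"])
    fix z assume z: "z \<in> tot (ft A a)"
    then show "compose (tot (ft A a)) (fam b) (strict_fun f) z = fam a z"
      using strict_labels[OF s, of z] strict_fun(1)[OF f(2), of z] fab
      by (simp add: compose_def fam_def a_def b_def)
  qed (simp_all add: fam_def)
  then have reindex: "fam_reindex ?Ys (strict_fun f) (fam b) = strict_ob a"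
    by (simp add: fam_reindex_def strict_step(1)[OF a])
  have lift: "fam_lift ?Ys (strict_fun f) (fam b) = strict_fun f'"
    unfolding fam_lift_def reindex
  proof (rule extensionalityI[of _ "tot a"])
    fix z assume z: "z \<in> tot a"
    note rz = realize_step[OF a z]
    define w where "w = vpair (strict_fun f (vfst z)) (vsnd z)"
    have w1: "strict_fun f (vfst z) \<in> tot (ft A b)" using strict_fun(1)[OF f(2)] rz(1) fab by simp
    have w2: "vsnd z \<in> elems (labels b (realize (ft A b) (strict_fun f (vfst z))))"
      using rz(2) strict_labels[OF s, of "vfst z"] rz(1) fab by (simp add: a_def b_def)
    have w: "w \<in> tot b" unfolding tot_step[OF b] w_def using w1 w2 by blast
    have y: "realize a z \<in> elems (FO F a)" by (rule realize_in[OF a(1) z])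
    have "realize b w = ap (FA F f') (realize a z)"
      unfolding strict_step(2)[OF b] w_def vfst_vpair vsnd_vpair
    proof (rule labelled(4)[OF b realize_in[OF ft(1)[OF b(1)] w1] w2])
      show "ap (FA F f') (realize a z) \<in> elems (FO F b)"
        using Fx(1)[OF f(1)] y by (simp add: a_def b_def)
      show "ap (FA F (disp A b)) (ap (FA F f') (realize a z)) = realize (ft A b) (strict_fun f (vfst z))"
        using model_square[OF s] y rz strict_fun(2)[OF f(2), of "vfst z"] fab by (simp add: a_def b_def)
      show "D.inS (disp A b) (ap (FA F f') (realize a z)) = vsnd z"
        using D.inS(3)[of "(f', f)" "realize a z"] s f y rz(4) by (simp add: a_def b_def)
    qed
    then have "strict_fun f' z = w"
      by (intro strict_fun_eq) (use f z w in \<open>simp_all add: a_def b_def\<close>)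
    then show "(\<lambda>z\<in>tot a. vpair (strict_fun f (vfst z)) (vsnd z)) z = strict_fun f' z"
      using z by (simp add: w_def)
  qed (simp_all add: strict_fun_def a_def)
  have "((fam_reindex ?Ys (strict_fun f) (fam b), fam_lift ?Ys (strict_fun f) (fam b), strict_ob (ft A b) @ [fam b]),
      (?Ys, strict_fun f, strict_ob (ft A b))) \<in> dsq fam_cat"
  proof -
    have "?Ys \<in> fam_ob" "strict_ob (ft A b) @ [fam b] \<in> fam_ob"
      using strict_ob_fam ft a b strict_step(1)[OF b] by metis+
    moreover have "strict_fun f \<in> tot (ft A a) \<rightarrow>\<^sub>E tot (ft A b)"
      using strict_fun(1)[OF f(2)] fab by (auto simp: strict_fun_def)
    ultimately show ?thesis unfolding fam_cat_def by simp
  qed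
  then show ?thesis
    unfolding reindex lift strict_step(1)[OF b, symmetric] fab unfolding a_def b_def .
qed

lemma strict_morphism_strict: "strict_morphism A fam_cat strict_functor"
  unfolding strict_morphism_def
proof (intro conjI ballI impI)
  fix a assume a: "a \<in> Ob A"
  show "len fam_cat (FO strict_functor a) = len A a"
    using a strict_ob_fam by (simp add: strict_functor_def)
  have "strict_ob (ft A a) = butlast (strict_ob a)"
    using a strict_step(1)[OF a] strict_len0[of a] strict_len0[of "ft A a"] ft(2)[OF a]
    by (cases "len A a") auto
  note bl = this
  then show "FO strict_functor (ft A a) = ft fam_cat (FO strict_functor a)"
    using a ft by (simp add: strict_functor_def)
  assume l: "1 \<le> len A a"
  then show "FA strict_functor (disp A a) = disp fam_cat (FO strict_functor a)"
    using a bl by (simp add: strict_functor_def disp strict_disp)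
next
  fix s assume "s \<in> dsq A"
  moreover obtain f' f where "s = (f', f)" by (cases s)
  ultimately show "case s of (f', f) \<Rightarrow> (FA strict_functor f', FA strict_functor f) \<in> dsq fam_cat"
    using strict_dsq[of f' f] dsq[of f' f] by (simp add: strict_functor_def)
qed (rule is_functor_strict)

lemma strictifiable: "strictifiable A F"
  unfolding strictifiable_def naturally_isomorphic_def
proof (intro exI conjI ballI)
  define \<eta> where "\<eta> = (\<lambda>a\<in>Ob A. (fam_total (strict_ob a), \<lambda>z\<in>tot a. realize a z, FO F a))"
  have sim: "FO (functor_comp A fam_total_functor strict_functor) a = fam_total (strict_ob a)"
    if "a \<in> Ob A" for a
    using that strict_ob_fam by (simp add: fam_total_functor_def strict_functor_def)
  have sim': "FA (functor_comp A fam_total_functor strict_functor) f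
      = (fam_total (strict_ob (Dom A f)), strict_fun f, fam_total (strict_ob (Cod A f)))"
    if "f \<in> Ar A" for f
    using that functorD(2)[OF is_functor_strict that]
    by (simp add: fam_total_functor_def strict_functor_def)
  show "strict_morphism A fam_cat strict_functor" by (rule strict_morphism_strict)
  show "nat_trans A set_cat (functor_comp A fam_total_functor strict_functor) F \<eta>"
    unfolding nat_trans_def
  proof (intro conjI ballI)
    fix a assume "a \<in> Ob A"
    then show "\<eta> a \<in> hom set_cat (FO (functor_comp A fam_total_functor strict_functor) a) (FO F a)"
      using realize_in by (simp add: \<eta>_def hom_def sim del: functor_comp_simps)
  next
    fix f assume f: "f \<in> Ar A"
    have "strict_fun f \<in> tot (Dom A f) \<rightarrow>\<^sub>E tot (Cod A f)"
      using strict_fun(1)[OF f] by (auto simp: strict_fun_def)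
    then show "Comp set_cat (FA F f) (\<eta> (Dom A f))
        = Comp set_cat (\<eta> (Cod A f)) (FA (functor_comp A fam_total_functor strict_functor) f)"
      unfolding sim'[OF f] using f realize_in
      by (intro set_arrow_eqI)
        (auto simp: categoryD[OF category_set_cat] \<eta>_def A' ap_comp compose_def strict_fun F' Fx(1))
  qed (simp add: \<eta>_def)
  fix a assume a: "a \<in> Ob A"
  have "bij_betw (\<lambda>z\<in>tot a. realize a z) (tot a) (elems (FO F a))"
    using realize_bij[OF a] by (simp cong: bij_betw_cong)
  then show "iso_arrow set_cat (\<eta> a)"
    using a realize_in by (intro set_isoI) (auto simp: \<eta>_def)
qed

end

lemma strictifiable_iff_separated: "strictifiable A F \<longleftrightarrow> D.separated"
  using strictifiable strictifiable_separated by blast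

end

theorem theorem6p12:
  fixes A :: "('o, 'm) ctx_cat"
    and F :: "('o, 'm, 'u::grothendieck_universe, 'u setmap) functr"
  assumes "contextual_category A"
    and "small_ctx_cat TYPE('u) A"
    and "set_model A F"
  shows "(strictifiable A F \<longleftrightarrow> loop_free A F) \<and>
    (strictifiable A F \<longleftrightarrow>
       nt_loop_free (disp_cat A) (model_src A F) (model_tgt A F) (model_proj A F)) \<and>
    (strictifiable A F \<longleftrightarrow>
       pi0_square_cartesian (disp_cat A) (model_src A F) (model_tgt A F) (model_proj A F)) \<and>
    (strictifiable A F \<longleftrightarrow>
       colim_square_cartesian (disp_cat A) (model_src A F) (model_tgt A F) (model_proj A F))"
proof -
  interpret contextual_model A F by unfold_locales (fact assms)+
  show ?thesis
    by (simp add: loop_free_def strictifiable_iff_separated D.nt_loop_free_iff_separated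
        D.pi0_square_iff_separated D.colim_square_iff_separated)
qed


end
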